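(* Let $G$ be an SE-graph, $\phi$ an $(I|J)$-flow and $\phi'$ an $(I'|J')$-flow in $G$. Let $\pi=\{f,g\}\in M(\phi,\phi')$ and let $(\psi,\psi')$ be the double flow obtained from $(\phi,\phi')$ by the flow exchange operation using the single couple $\pi$. Then: (i) if $\pi$ is an R-couple with $f<g$, then $w(\phi)w(\phi')=q\,w(\psi)w(\psi')$ when $f\in I$, and $w(\phi)w(\phi')=q^{-1}w(\psi)w(\psi')$ when $f\in I'$; if $\pi$ is a C-couple with $f<g$, then $w(\phi)w(\phi')=q\,w(\psi)w(\psi')$ when $f\in J$, and $w(\phi)w(\phi')=q^{-1}w(\psi)w(\psi')$ when $f\in J'$; (ii) if $\pi$ is an RC-couple, then $w(\phi)w(\phi')=w(\psi)w(\psi')$.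
   Context: Notation: $[p]=\{1,\dots,p\}$; $\mathcal E^{m,n}$ is the set of pairs $(I|J)$, $I\subseteq[m]$, $J\subseteq[n]$, $|I|=|J|$. Fix a field $\mathbb K$, $q\in\mathbb K^\ast$. An SE-graph is a finite directed graph $G=(V,E)$ embedded in the plane (planar with a fixed layout) such that: every edge is either horizontal (H-edge) directed to the right or vertical (V-edge) directed downward; there are distinguished sources $r_1,\dots,r_m$ on a vertical line in this order upward and sinks $c_1,\dots,c_n$ on a horizontal line in this order from left to right; sources are incident only with H-edges, sinks only with V-edges; every vertex lies on a directed path from a source to a sink. $W$ = set of inner vertices. $\mathcal L_G$ is the $\mathbb K$-algebra of Laurent polynomials in $W$ with relations, for distinct $u,v\in W$: $uv=qvu$ if there is a directed horizontal path from $u$ to $v$; $vu=quv$ if there is a directed vertical path from $u$ to $v$; $uv=vu$ otherwise. Edge weights: $w(e)=v$ if $e=(u,v)$ with $u$ a source; $w(e)=u^{-1}v$ for an H-edge $e=(u,v)$ with $u,v\in W$; $w(e)=1$ for V-edges; path weight = ordered product of edge weights. For $(I|J)\in\mathcal E^{m,n}$, an $(I|J)$-flow is a set of pairwise vertex-disjoint directed paths from $\{r_i:i\in I\}$ to $\{c_j:j\in J\}$; ordering its paths $P_1,\dots,P_k$ by increasing index of their source, its weight is $w(P_1)\cdots w(P_k)$ (ordered product). Let $Y^r=I\triangle I'$, $Y^c=J\triangle J'$. For an $(I|J)$-flow $\phi$ and an $(I'|J')$-flow $\phi'$ with edge sets $E_\phi,E_{\phi'}$, let $U=E_\phi\triangle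 E_{\phi'}$. In the subgraph formed by $U$ each vertex has degree 1, 2 or 4, the degree-1 vertices being $\{r_i:i\in Y^r\}\cup\{c_j:j\in Y^c\}$. Splitting each degree-4 vertex $v$ into nearby $v',v''$ (edges of $U$ entering $v$ enter $v'$, those leaving $v$ leave $v''$) yields a disjoint union of simple paths $P'_1,\dots,P'_k$ and cycles; the endpoints of $P'_i$ determine a pair $\pi_i$ of elements of $Y^r\sqcup Y^c$, $M(\phi,\phi')=\{\pi_1,\dots,\pi_k\}$, and $P(\pi_i)$ is the image of $P'_i$ in $G$. A couple is an R-couple if contained in $Y^r$, a C-couple if contained in $Y^c$, and an RC-couple otherwise. The flow exchange operation using $\pi\in M(\phi,\phi')$ produces $\psi$ with edge set $E_\phi\triangle E_{P(\pi)}$ and $\psi'$ with edge set $E_{\phi'}\triangle E_{P(\pi)}$; $\psi$ is an $(I\triangle(\pi\cap Y^r)\,|\,J\triangle(\pi\cap Y^c))$-flow and $\psi'$ an $(I'\triangle(\pi\cap Y^r)\,|\,J'\triangle(\pi\cap Y^c))$-flow. *)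

theory Defs
  imports "HOL-Analysis.Analysis"
begin

section \<open>SE-graphs\<close>

text \<open>A graph together with a straight-line planar layout (every edge is a horizontal
or vertical segment), sources r_1..r_m and sinks c_1..c_n.\<close>

record 'v segraph =
  verts :: "'v set"
  edges :: "('v \<times> 'v) set"
  pos   :: "'v \<Rightarrow> real \<times> real"
  nsrc  :: nat
  nsnk  :: nat
  src   :: "nat \<Rightarrow> 'v"
  snk   :: "nat \<Rightarrow> 'v"

definition H_edge :: "'v segraph \<Rightarrow> 'v \<times> 'v \<Rightarrow> bool" where
  "H_edge G e \<longleftrightarrow> e \<in> edges G \<and> snd (pos G (fst e)) = snd (pos G (snd e))
                    \<and> fst (pos G (fst e)) < fst (pos G (snd e))"

definition V_edge :: "'v segraph \<Rightarrow> 'v \<times> 'v \<Rightarrow> bool" where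
  "V_edge G e \<longleftrightarrow> e \<in> edges G \<and> fst (pos G (fst e)) = fst (pos G (snd e))
                    \<and> snd (pos G (fst e)) > snd (pos G (snd e))"

definition sources :: "'v segraph \<Rightarrow> 'v set" where
  "sources G = src G ` {1..nsrc G}"

definition sinks :: "'v segraph \<Rightarrow> 'v set" where
  "sinks G = snk G ` {1..nsnk G}"

definition inner :: "'v segraph \<Rightarrow> 'v set" where
  "inner G = verts G - sources G - sinks G"

definition eseg :: "'v segraph \<Rightarrow> 'v \<times> 'v \<Rightarrow> (real \<times> real) set" where
  "eseg G e = closed_segment (pos G (fst e)) (pos G (snd e))"

definition SE_graph :: "'v segraph \<Rightarrow> bool" where
  "SE_graph G \<longleftrightarrow>
     finite (verts G) \<and> edges G \<subseteq> verts G \<times> verts G \<and>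
     inj_on (pos G) (verts G) \<and>
     \<comment> \<open>each edge is an H-edge (directed right) or a V-edge (directed down)\<close>
     (\<forall>e\<in>edges G. H_edge G e \<or> V_edge G e) \<and>
     \<comment> \<open>planarity of the layout\<close>
     (\<forall>e1\<in>edges G. \<forall>e2\<in>edges G. e1 \<noteq> e2 \<longrightarrow>
        eseg G e1 \<inter> eseg G e2 \<subseteq> pos G ` ({fst e1, snd e1} \<inter> {fst e2, snd e2})) \<and>
     (\<forall>e\<in>edges G. \<forall>w\<in>verts G. pos G w \<in> eseg G e \<longrightarrow> w = fst e \<or> w = snd e) \<and>
     \<comment> \<open>sources on a vertical line, in order upward\<close>
     inj_on (src G) {1..nsrc G} \<and> sources G \<subseteq> verts G \<and>
     (\<forall>i\<in>{1..nsrc G}. \<forall>i'\<in>{1..nsrc G}.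
        fst (pos G (src G i)) = fst (pos G (src G i')) \<and>
        (i < i' \<longrightarrow> snd (pos G (src G i)) < snd (pos G (src G i')))) \<and>
     \<comment> \<open>sinks on a horizontal line, in order from left to right\<close>
     inj_on (snk G) {1..nsnk G} \<and> sinks G \<subseteq> verts G \<and>
     (\<forall>j\<in>{1..nsnk G}. \<forall>j'\<in>{1..nsnk G}.
        snd (pos G (snk G j)) = snd (pos G (snk G j')) \<and>
        (j < j' \<longrightarrow> fst (pos G (snk G j)) < fst (pos G (snk G j')))) \<and>
     sources G \<inter> sinks G = {} \<and>
     \<comment> \<open>sources have no entering edges and are incident only with H-edges;
         sinks have no leaving edges and are incident only with V-edges\<close>
     (\<forall>e\<in>edges G. snd e \<notin> sources G \<and> (fst e \<in> sources G \<longrightarrow> H_edge G e)) \<and>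
     (\<forall>e\<in>edges G. fst e \<notin> sinks G \<and> (snd e \<in> sinks G \<longrightarrow> V_edge G e)) \<and>
     \<comment> \<open>every vertex lies on a directed path from a source to a sink\<close>
     (\<forall>v\<in>verts G. \<exists>s\<in>sources G. \<exists>t\<in>sinks G.
        (s, v) \<in> (edges G)\<^sup>* \<and> (v, t) \<in> (edges G)\<^sup>*)"

section \<open>The quantum algebra L_G\<close>

text \<open>L_G is realised as the quantum torus: an element is a (finitely supported)
function from exponent vectors to K, the exponent vector a standing for the ordered
monomial prod_{u ascending} u^(a u) (w.r.t. the linear order on vertices).
The product of ordered monomials is m_a m_b = q^(beta a b) m_(a+b).\<close>

definition hpath :: "'v segraph \<Rightarrow> 'v \<Rightarrow> 'v \<Rightarrow> bool" where
  "hpath G u v \<longleftrightarrow> (u, v) \<in> {e. H_edge G e}\<^sup>+"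

definition vpath :: "'v segraph \<Rightarrow> 'v \<Rightarrow> 'v \<Rightarrow> bool" where
  "vpath G u v \<longleftrightarrow> (u, v) \<in> {e. V_edge G e}\<^sup>+"

text \<open>u v = q^(lam u v) v u in L_G (for distinct inner u, v).\<close>
definition lam :: "'v segraph \<Rightarrow> 'v \<Rightarrow> 'v \<Rightarrow> int" where
  "lam G u v = (if hpath G u v \<or> vpath G v u then 1
                else if vpath G u v \<or> hpath G v u then -1 else 0)"

definition beta :: "('v::linorder) segraph \<Rightarrow> ('v \<Rightarrow> int) \<Rightarrow> ('v \<Rightarrow> int) \<Rightarrow> int" where
  "beta G a b = (\<Sum>p \<in> {p \<in> inner G \<times> inner G. snd p < fst p}.
                    lam G (fst p) (snd p) * a (fst p) * b (snd p))"

type_synonym ('v, 'k) LG = "('v \<Rightarrow> int) \<Rightarrow> 'k"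

definition qmult :: "('v::linorder) segraph \<Rightarrow> 'k::field \<Rightarrow> ('v, 'k) LG \<Rightarrow> ('v, 'k) LG \<Rightarrow> ('v, 'k) LG" where
  "qmult G q f g = (\<lambda>e. \<Sum>p \<in> {p. f (fst p) \<noteq> 0 \<and> g (snd p) \<noteq> 0 \<and> (\<lambda>x. fst p x + snd p x) = e}.
                      f (fst p) * g (snd p) * q powi beta G (fst p) (snd p))"

definition mono :: "('v \<Rightarrow> int) \<Rightarrow> ('v, 'k::field) LG" where
  "mono a = (\<lambda>e. if e = a then 1 else 0)"

definition one_LG :: "('v, 'k::field) LG" where
  "one_LG = mono (\<lambda>_. 0)"

definition smul :: "'k::field \<Rightarrow> ('v, 'k) LG \<Rightarrow> ('v, 'k) LG" where
  "smul c f = (\<lambda>e. c * f e)"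

text \<open>The generator v and its inverse v^{-1}.\<close>
definition gen :: "'v \<Rightarrow> ('v, 'k::field) LG" where
  "gen v = mono (\<lambda>x. if x = v then 1 else 0)"

definition geninv :: "'v \<Rightarrow> ('v, 'k::field) LG" where
  "geninv v = mono (\<lambda>x. if x = v then -1 else 0)"

section \<open>Paths, weights, flows\<close>

definition pedges :: "'v list \<Rightarrow> ('v \<times> 'v) set" where
  "pedges p = set (zip p (tl p))"

definition dpath :: "'v segraph \<Rightarrow> 'v list \<Rightarrow> bool" where
  "dpath G p \<longleftrightarrow> p \<noteq> [] \<and> distinct p \<and> set p \<subseteq> verts G \<and> pedges p \<subseteq> edges G"

definition edge_weight :: "('v::linorder) segraph \<Rightarrow> 'k::field \<Rightarrow> 'v \<times> 'v \<Rightarrow> ('v, 'k) LG" where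
  "edge_weight G q e = (if fst e \<in> sources G then gen (snd e)
             else if H_edge G e then qmult G q (geninv (fst e)) (gen (snd e))
             else one_LG)"

definition path_weight :: "('v::linorder) segraph \<Rightarrow> 'k::field \<Rightarrow> 'v list \<Rightarrow> ('v, 'k) LG" where
  "path_weight G q p = foldr (\<lambda>e acc. qmult G q (edge_weight G q e) acc) (zip p (tl p)) one_LG"

text \<open>An (I|J)-flow is represented by the family of its paths indexed by their sources:
phi i is the path starting at r_i, for i in I.\<close>
definition is_flow :: "'v segraph \<Rightarrow> nat set \<Rightarrow> nat set \<Rightarrow> (nat \<Rightarrow> 'v list) \<Rightarrow> bool" where
  "is_flow G I J phi \<longleftrightarrow>
     I \<subseteq> {1..nsrc G} \<and> J \<subseteq> {1..nsnk G} \<and> card I = card J \<and>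
     (\<forall>i\<in>I. dpath G (phi i) \<and> hd (phi i) = src G i) \<and>
     (\<lambda>i. last (phi i)) ` I = snk G ` J \<and>
     (\<forall>i\<in>I. \<forall>i'\<in>I. i \<noteq> i' \<longrightarrow> set (phi i) \<inter> set (phi i') = {})"

definition flow_edges :: "nat set \<Rightarrow> (nat \<Rightarrow> 'v list) \<Rightarrow> ('v \<times> 'v) set" where
  "flow_edges I phi = (\<Union>i\<in>I. pedges (phi i))"

text \<open>Weight w(P_1)...(P_k) with paths ordered by increasing source index.\<close>
definition flow_weight :: "('v::linorder) segraph \<Rightarrow> 'k::field \<Rightarrow> nat set \<Rightarrow> (nat \<Rightarrow> 'v list) \<Rightarrow> ('v, 'k) LG" where
  "flow_weight G q I phi =
     foldr (\<lambda>i acc. qmult G q (path_weight G q (phi i)) acc) (sorted_list_of_set I) one_LG"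

section \<open>Couples and the flow exchange\<close>

definition symdiff :: "'a set \<Rightarrow> 'a set \<Rightarrow> 'a set" where
  "symdiff A B = (A - B) \<union> (B - A)"

definition udeg :: "('v \<times> 'v) set \<Rightarrow> 'v \<Rightarrow> nat" where
  "udeg U x = card {e \<in> U. fst e = x \<or> snd e = x}"

text \<open>Splitting: a degree-4 vertex x becomes x' = (x,False) (entered by the edges
entering x) and x'' = (x,True) (left by the edges leaving x); other vertices x are (x,False).\<close>
definition in_node :: "('v \<times> 'v) set \<Rightarrow> 'v \<Rightarrow> 'v \<times> bool" where
  "in_node U x = (x, False)"

definition out_node :: "('v \<times> 'v) set \<Rightarrow> 'v \<Rightarrow> 'v \<times> bool" where
  "out_node U x = (x, udeg U x = 4)"

definition split_adj :: "('v \<times> 'v) set \<Rightarrow> (('v \<times> bool) \<times> ('v \<times> bool)) set" where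
  "split_adj U = {(out_node U (fst e), in_node U (snd e)) | e. e \<in> U}"

definition split_conn :: "('v \<times> 'v) set \<Rightarrow> (('v \<times> bool) \<times> ('v \<times> bool)) set" where
  "split_conn U = (split_adj U \<union> (split_adj U)\<inverse>)\<^sup>*"

text \<open>Elements of Y^r \<sqcup> Y^c: Inl i for rows, Inr j for columns; their terminal vertex.\<close>
definition term_node :: "'v segraph \<Rightarrow> nat + nat \<Rightarrow> 'v \<times> bool" where
  "term_node G x = (case x of Inl i \<Rightarrow> (src G i, False) | Inr j \<Rightarrow> (snk G j, False))"

definition Yset :: "nat set \<Rightarrow> nat set \<Rightarrow> nat set \<Rightarrow> nat set \<Rightarrow> (nat + nat) set" where
  "Yset I J I' J' = Inl ` symdiff I I' \<union> Inr ` symdiff J J'"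

definition U_set :: "nat set \<Rightarrow> (nat \<Rightarrow> 'v list) \<Rightarrow> nat set \<Rightarrow> (nat \<Rightarrow> 'v list) \<Rightarrow> ('v \<times> 'v) set" where
  "U_set I phi I' phi' = symdiff (flow_edges I phi) (flow_edges I' phi')"

text \<open>{f,g} \<in> M(phi,phi'): f, g are the two ends of one path component of the split U.\<close>
definition is_couple :: "'v segraph \<Rightarrow> nat set \<Rightarrow> nat set \<Rightarrow> (nat \<Rightarrow> 'v list)
     \<Rightarrow> nat set \<Rightarrow> nat set \<Rightarrow> (nat \<Rightarrow> 'v list) \<Rightarrow> nat + nat \<Rightarrow> nat + nat \<Rightarrow> bool" where
  "is_couple G I J phi I' J' phi' f g \<longleftrightarrow>
     f \<in> Yset I J I' J' \<and> g \<in> Yset I J I' J' \<and> f \<noteq> g \<and>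
     (term_node G f, term_node G g) \<in> split_conn (U_set I phi I' phi')"

text \<open>Edge set of P(pi): the edges of U in the component of the split graph
containing the end f of pi.\<close>
definition couple_path :: "'v segraph \<Rightarrow> nat set \<Rightarrow> (nat \<Rightarrow> 'v list)
     \<Rightarrow> nat set \<Rightarrow> (nat \<Rightarrow> 'v list) \<Rightarrow> nat + nat \<Rightarrow> ('v \<times> 'v) set" where
  "couple_path G I phi I' phi' f =
     {e \<in> U_set I phi I' phi'.
        (term_node G f, out_node (U_set I phi I' phi') (fst e)) \<in> split_conn (U_set I phi I' phi')}"

definition rows_of :: "(nat + nat) set \<Rightarrow> nat set" where
  "rows_of P = {i. Inl i \<in> P}"

definition cols_of :: "(nat + nat) set \<Rightarrow> nat set" where
  "cols_of P = {j. Inr j \<in> P}"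

end

(* Every product of generators and their inverses is a power of q times a monomial, and its Weyl
   normalisation (q^(k/2) times the symmetrised monomial [a], with [a][b] = q^(Lam a b / 2) [a + b])
   turns the statement into an identity between integers. Each path weight and each flow weight
   has k = 0, because disjoint paths do not interact. So with d the signed edge vector of the
   exchanged path P(pi) (+1 on edges of phi', -1 on edges of phi), comparing the two sides amounts
   to computing Lam(d, phi + phi'). This evaluates to a local sum along P(pi): a count of signed
   turns, plus a contribution of the two ends of the path.

   The turn count is a discrete Umlaufsatz. Sweep the plane from left to right (and downwards within a
   column). The edges of U crossing the sweep line, together with one stub per source met so far,
   are joined by the arcs of U already swept in a noncrossing matching. Passing a vertex creates a
   pair of adjacent ends, joins two adjacent ends, or prolongs an arc, and in each case the turn
   count of every arc stays determined by the sign of its upper end. *)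
theory Submission
  imports Defs
begin

section \<open>The quantum torus\<close>

text \<open>\<open>Lam\<close> relates vertices that may be far apart in a row or a column. It
  becomes local because the exponent vector of a balanced edge vector can be read off from the
  horizontal edges or from the vertical ones. Pairing the first reading with the row half of
  \<open>lam\<close> and the second with the column half makes both sums telescope; values at the
  ends of edges and terms at sources and sinks survive. The second argument is the sum of both
  flows, so at a vertex used by one flow alone its exponent \<open>pot\<close> is the turn made
  there. Where the exchanged path switches from one flow to the other, \<open>pot\<close> cancels
  between two edges of opposite colour, and the turn is supplied by the sweep. The sweep takes the
  place of a Jordan curve argument: its global input is that two arcs about to be joined do not
  cross. The resulting exponent of q is the sign of the upper end plus half of the colours of the
  edges at the two ends. Those colours cancel for two sources or two sinks; for a source and a sink
  they cancel the sign instead. This is the origin of the exponents 1, -1 and 0.\<close>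

lemma qmult_mono:
  fixes q :: "'k::field"
  assumes "c \<noteq> 0" "d \<noteq> 0"
  shows "qmult G q (smul c (mono a)) (smul d (mono b)) = smul (c * d * q powi beta G a b) (mono (\<lambda>x. a x + b x))"
proof
  fix e
  have "{p. smul c (mono a) (fst p) \<noteq> 0 \<and> smul d (mono b) (snd p) \<noteq> 0 \<and> (\<lambda>x. fst p x + snd p x) = e}
     = (if (\<lambda>x. a x + b x) = e then {(a, b)} else {})"
    using assms by (auto simp: smul_def mono_def)
  then show "qmult G q (smul c (mono a)) (smul d (mono b)) e = smul (c * d * q powi beta G a b) (mono (\<lambda>x. a x + b x)) e"
    unfolding qmult_def by (auto simp: smul_def mono_def)
qed

section \<open>The commutation form and the Weyl normalisation\<close>

lemma beta_add_left: "beta G (\<lambda>x. a x + b x) c = beta G a c + beta G b c"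
  unfolding beta_def by (simp add: algebra_simps sum.distrib)

lemma beta_add_right: "beta G c (\<lambda>x. a x + b x) = beta G c a + beta G c b"
  unfolding beta_def by (simp add: algebra_simps sum.distrib)

definition Lam :: "('v::linorder) segraph \<Rightarrow> ('v \<Rightarrow> int) \<Rightarrow> ('v \<Rightarrow> int) \<Rightarrow> int" where
  "Lam G a b = beta G a b - beta G b a"

lemma Lam_add_left: "Lam G (\<lambda>x. a x + b x) c = Lam G a c + Lam G b c"
  by (simp add: Lam_def beta_add_left beta_add_right)

lemma Lam_add_right: "Lam G c (\<lambda>x. a x + b x) = Lam G c a + Lam G c b"
  by (simp add: Lam_def beta_add_left beta_add_right)

lemma Lam_skew: "Lam G a b = - Lam G b a"
  by (simp add: Lam_def)

lemma Lam_zero_left [simp]: "Lam G (\<lambda>_. 0) a = 0"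
  by (simp add: Lam_def beta_def)

lemma Lam_zero_right [simp]: "Lam G a (\<lambda>_. 0) = 0"
  by (simp add: Lam_def beta_def)

text \<open>With [a] = q^(beta a a / 2) m_a one has [a][b] = q^(Lam a b / 2) [a + b];
  the predicate says X = q^(k/2) [a], avoiding square roots of q.\<close>
definition weyl :: "('v::linorder) segraph \<Rightarrow> 'k::field \<Rightarrow> ('v, 'k) LG \<Rightarrow> ('v \<Rightarrow> int) \<Rightarrow> int \<Rightarrow> bool" where
  "weyl G q X a k \<longleftrightarrow> (\<exists>n. X = smul (q powi n) (mono a) \<and> 2 * n = beta G a a + k)"

text \<open>Multiplying costs \<open>beta G a b\<close>, whereas normalising the sum of
  \<open>a\<close> and \<open>b\<close> accounts for half of \<open>beta G a b + beta G b a\<close>.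
  The difference is half of \<open>Lam G a b\<close>, and \<open>k\<close> counts halves.\<close>

lemma weyl_mult:
  assumes "q \<noteq> 0" "weyl G q X a k" "weyl G q Y b l"
  shows "weyl G q (qmult G q X Y) (\<lambda>x. a x + b x) (k + l + Lam G a b)"
proof -
  obtain n m where *: "X = smul (q powi n) (mono a)" "2 * n = beta G a a + k"
    "Y = smul (q powi m) (mono b)" "2 * m = beta G b b + l"
    using assms unfolding weyl_def by auto
  have "qmult G q X Y = smul (q powi (n + m + beta G a b)) (mono (\<lambda>x. a x + b x))"
    using assms(1) unfolding * by (subst qmult_mono) (auto simp: power_int_add)
  moreover have "2 * (n + m + beta G a b) = beta G (\<lambda>x. a x + b x) (\<lambda>x. a x + b x) + (k + l + Lam G a b)"
    using * by (simp add: beta_add_left beta_add_right Lam_def)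
  ultimately show ?thesis unfolding weyl_def by blast
qed

lemma weyl_one: "weyl G q one_LG (\<lambda>_. 0) 0"
proof -
  have "beta G (\<lambda>_. 0) (\<lambda>_. 0) = 0" by (simp add: beta_def)
  then show ?thesis
    unfolding weyl_def one_LG_def by (intro exI[of _ 0]) (simp add: smul_def)
qed

text \<open>\<open>beta\<close> runs over strictly ordered pairs, so one member of each pair differs
  from \<open>v\<close>.\<close>

lemma beta_single:
  assumes "\<And>x. x \<noteq> v \<Longrightarrow> a x = 0"
  shows "beta G a a = 0"
  unfolding beta_def
proof (rule sum.neutral, rule ballI)
  fix p assume "p \<in> {p \<in> inner G \<times> inner G. snd p < fst p}"
  then have "fst p \<noteq> v \<or> snd p \<noteq> v" by auto
  then show "lam G (fst p) (snd p) * a (fst p) * a (snd p) = 0" using assms by auto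
qed

lemma weyl_gen: "weyl G q (gen v) (\<lambda>x. if x = v then 1 else 0) 0"
  unfolding weyl_def gen_def by (intro exI[of _ 0]) (auto simp: smul_def beta_single[of v])

lemma weyl_geninv: "weyl G q (geninv v) (\<lambda>x. if x = v then - 1 else 0) 0"
  unfolding weyl_def geninv_def by (intro exI[of _ 0]) (auto simp: smul_def beta_single[of v])

text \<open>For equal exponent vectors the terms \<open>beta G a a\<close> cancel, and the power of
  \<open>q\<close> is half the difference of the two defects.\<close>

lemma weyl_compare:
  assumes "q \<noteq> 0" "weyl G q X a k" "weyl G q Y a l" "k - l = 2 * d"
  shows "X = smul (q powi d) Y"
proof -
  obtain n m where *: "X = smul (q powi n) (mono a)" "2 * n = beta G a a + k"
    "Y = smul (q powi m) (mono a)" "2 * m = beta G a a + l"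
    using assms unfolding weyl_def by auto
  have "n = d + m" using * assms(4) by linarith
  then show ?thesis using assms(1) unfolding *(1,3) by (auto simp: smul_def power_int_add)
qed

text \<open>The ordered pairs give \<open>beta G a b\<close>; antisymmetry of \<open>lam\<close>
  turns the reversed pairs into \<open>- beta G b a\<close> and kills the diagonal. The linear order
  on the vertices, an artefact of ordered monomials, disappears.\<close>

lemma Lam_eq:
  assumes "finite (inner G)" "\<And>u v. u \<in> inner G \<Longrightarrow> v \<in> inner G \<Longrightarrow> lam G u v = - lam G v u"
  shows "Lam G a b = (\<Sum>u\<in>inner G. \<Sum>v\<in>inner G. lam G u v * a u * b v)"
proof -
  let ?I = "inner G"
  let ?A = "{p \<in> ?I \<times> ?I. snd p < fst p}" and ?B = "{p \<in> ?I \<times> ?I. fst p < snd p}" and ?D = "{p \<in> ?I \<times> ?I. fst p = snd p}"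
  let ?f = "\<lambda>p. lam G (fst p) (snd p) * a (fst p) * b (snd p)"
  have fin: "finite (?I \<times> ?I)" using assms(1) by auto
  have "(\<Sum>u\<in>?I. \<Sum>v\<in>?I. lam G u v * a u * b v) = sum ?f (?I \<times> ?I)"
    by (simp add: sum.cartesian_product split_beta)
  also have "?I \<times> ?I = ?A \<union> (?B \<union> ?D)" by auto
  also have "sum ?f (?A \<union> (?B \<union> ?D)) = sum ?f ?A + (sum ?f ?B + sum ?f ?D)"
  proof -
    have disj1: "?A \<inter> (?B \<union> ?D) = {}" and disj2: "?B \<inter> ?D = {}" by (safe; simp)+
    have f: "finite ?A" "finite ?B" "finite ?D" by (rule finite_subset[OF _ fin]; blast)+
    have "sum ?f (?B \<union> ?D) = sum ?f ?B + sum ?f ?D"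
      by (rule sum.union_disjoint[OF f(2,3)]) (rule disj2)
    moreover have "sum ?f (?A \<union> (?B \<union> ?D)) = sum ?f ?A + sum ?f (?B \<union> ?D)"
      by (rule sum.union_disjoint[OF f(1) finite_UnI[OF f(2,3)]]) (rule disj1)
    ultimately show ?thesis by simp
  qed
  also have "sum ?f ?D = 0"
  proof (rule sum.neutral, rule ballI)
    fix p assume "p \<in> ?D"
    then show "?f p = 0" using assms(2)[of "fst p" "fst p"] by auto
  qed
  also have "sum ?f ?A = beta G a b" by (simp add: beta_def)
  also have "sum ?f ?B = - beta G b a"
  proof -
    have "sum ?f ?B = (\<Sum>p\<in>?A. ?f (snd p, fst p))"
      by (rule sum.reindex_bij_witness[of _ "\<lambda>p. (snd p, fst p)" "\<lambda>p. (snd p, fst p)"]) auto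
    also have "\<dots> = (\<Sum>p\<in>?A. - (lam G (fst p) (snd p) * b (fst p) * a (snd p)))"
    proof (rule sum.cong[OF refl])
      fix p assume "p \<in> ?A"
      then have "lam G (snd p) (fst p) = - lam G (fst p) (snd p)" by (intro assms(2)) auto
      then show "?f (snd p, fst p) = - (lam G (fst p) (snd p) * b (fst p) * a (snd p))" by simp
    qed
    finally show ?thesis by (simp add: beta_def sum_negf)
  qed
  finally show ?thesis by (simp add: Lam_def)
qed

section \<open>Geometry of SE-graphs\<close>

lemma closed_segment_horizontal:
  fixes P Q :: "real \<times> real"
  assumes "snd P = y" "snd Q = y" "fst P \<le> x" "x \<le> fst Q"
  shows "(x, y) \<in> closed_segment P Q"
proof (cases "fst P = fst Q")
  case True
  then have "(x, y) = P" using assms by (auto intro: prod_eqI)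
  then show ?thesis by simp
next
  case False
  define u where "u = (x - fst P) / (fst Q - fst P)"
  have u: "u * (fst Q - fst P) = x - fst P" using False by (simp add: u_def)
  have "0 \<le> u" "u \<le> 1" using assms False by (auto simp: u_def field_simps)
  moreover have "(x, y) = (1 - u) *\<^sub>R P + u *\<^sub>R Q"
    using u assms(1,2) by (intro prod_eqI) (auto simp: algebra_simps)
  ultimately show ?thesis unfolding closed_segment_def by blast
qed

lemma closed_segment_vertical:
  fixes P Q :: "real \<times> real"
  assumes "fst P = x" "fst Q = x" "snd Q \<le> y" "y \<le> snd P"
  shows "(x, y) \<in> closed_segment P Q"
proof (cases "snd P = snd Q")
  case True
  then have "(x, y) = P" using assms by (auto intro: prod_eqI)
  then show ?thesis by simp
next
  case False
  define u where "u = (snd P - y) / (snd P - snd Q)"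
  have u: "u * (snd P - snd Q) = snd P - y" using False by (simp add: u_def)
  have "0 \<le> u" "u \<le> 1" using assms False by (auto simp: u_def field_simps)
  moreover have "(x, y) = (1 - u) *\<^sub>R P + u *\<^sub>R Q"
    using u assms(1,2) by (intro prod_eqI) (auto simp: algebra_simps)
  ultimately show ?thesis unfolding closed_segment_def by blast
qed

locale se_graph =
  fixes G :: "('v::linorder) segraph"
  assumes SE: "SE_graph G"
begin

abbreviation "px v \<equiv> fst (pos G v)"
abbreviation "py v \<equiv> snd (pos G v)"
abbreviation "V \<equiv> verts G"
abbreviation "E \<equiv> edges G"

lemma SE_conjuncts:
  "finite V" "E \<subseteq> V \<times> V" "inj_on (pos G) V" "\<forall>e\<in>E. H_edge G e \<or> V_edge G e"
  "\<forall>e1\<in>E. \<forall>e2\<in>E. e1 \<noteq> e2 \<longrightarrow> eseg G e1 \<inter> eseg G e2 \<subseteq> pos G ` ({fst e1, snd e1} \<inter> {fst e2, snd e2})"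
  "\<forall>e\<in>E. \<forall>w\<in>V. pos G w \<in> eseg G e \<longrightarrow> w = fst e \<or> w = snd e"
  "inj_on (src G) {1..nsrc G}" "sources G \<subseteq> V"
  "\<forall>i\<in>{1..nsrc G}. \<forall>i'\<in>{1..nsrc G}. px (src G i) = px (src G i') \<and> (i < i' \<longrightarrow> py (src G i) < py (src G i'))"
  "inj_on (snk G) {1..nsnk G}" "sinks G \<subseteq> V"
  "\<forall>j\<in>{1..nsnk G}. \<forall>j'\<in>{1..nsnk G}. py (snk G j) = py (snk G j') \<and> (j < j' \<longrightarrow> px (snk G j) < px (snk G j'))"
  "sources G \<inter> sinks G = {}"
  "\<forall>e\<in>E. snd e \<notin> sources G \<and> (fst e \<in> sources G \<longrightarrow> H_edge G e)"
  "\<forall>e\<in>E. fst e \<notin> sinks G \<and> (snd e \<in> sinks G \<longrightarrow> V_edge G e)"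
  "\<forall>v\<in>V. \<exists>s\<in>sources G. \<exists>t\<in>sinks G. (s, v) \<in> E\<^sup>* \<and> (v, t) \<in> E\<^sup>*"
  by - ((insert SE, unfold SE_graph_def, elim conjE, assumption)+)

lemmas finite_verts = SE_conjuncts(1) and edges_sub = SE_conjuncts(2) and inj_pos = SE_conjuncts(3)
  and edge_HV = SE_conjuncts(4)[rule_format] and planar = SE_conjuncts(5)[rule_format]
  and vertex_on_edge = SE_conjuncts(6)[rule_format]
  and inj_src = SE_conjuncts(7) and sources_sub = SE_conjuncts(8) and src_order = SE_conjuncts(9)[rule_format]
  and inj_snk = SE_conjuncts(10) and snk_order = SE_conjuncts(12)[rule_format]
  and on_path = SE_conjuncts(16)[rule_format]

lemma source_not_sink: "v \<in> sources G \<Longrightarrow> v \<notin> sinks G"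
  using SE_conjuncts(13) by (simp add: disjoint_iff)

lemma no_edge_into_source: "e \<in> E \<Longrightarrow> snd e \<notin> sources G"
  and source_edge_H: "e \<in> E \<Longrightarrow> fst e \<in> sources G \<Longrightarrow> H_edge G e"
  using SE_conjuncts(14) by simp_all

lemma no_edge_from_sink: "e \<in> E \<Longrightarrow> fst e \<notin> sinks G"
  and sink_edge_V: "e \<in> E \<Longrightarrow> snd e \<in> sinks G \<Longrightarrow> V_edge G e"
  using SE_conjuncts(15) by simp_all

lemma finite_edges: "finite E"
  using finite_verts edges_sub by (meson finite_SigmaI finite_subset)

lemma finite_inner: "finite (inner G)"
  using finite_verts by (auto simp: inner_def)

lemma px_sources: "s \<in> sources G \<Longrightarrow> s' \<in> sources G \<Longrightarrow> px s = px s'"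
  using src_order unfolding sources_def by blast

lemma py_sinks: "s \<in> sinks G \<Longrightarrow> s' \<in> sinks G \<Longrightarrow> py s = py s'"
  using snk_order unfolding sinks_def by blast

lemma H_edgeD: "H_edge G (u, v) \<Longrightarrow> (u, v) \<in> E \<and> py u = py v \<and> px u < px v"
  by (simp add: H_edge_def)

lemma V_edgeD: "V_edge G (u, v) \<Longrightarrow> (u, v) \<in> E \<and> px u = px v \<and> py v < py u"
  by (simp add: V_edge_def)

lemma not_HV: "H_edge G e \<Longrightarrow> \<not> V_edge G e"
  by (auto simp: H_edge_def V_edge_def)

lemma not_H: "e \<in> E \<Longrightarrow> \<not> H_edge G e \<longleftrightarrow> V_edge G e"
  using edge_HV not_HV by blast

lemma edge_mono: "(u, v) \<in> E \<Longrightarrow> px u \<le> px v \<and> py v \<le> py u"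
  using edge_HV[of "(u, v)"] by (auto dest: H_edgeD V_edgeD)

lemma edge_neq: "(u, v) \<in> E \<Longrightarrow> u \<noteq> v"
  using edge_HV[of "(u, v)"] by (auto dest: H_edgeD V_edgeD)

lemma edge_verts: "(u, v) \<in> E \<Longrightarrow> u \<in> V \<and> v \<in> V"
  using edges_sub by auto

section \<open>Edges at a vertex, and the position of sources and sinks\<close>

lemma on_H_edge:
  assumes "H_edge G (u, v)" "w \<in> V" "py w = py u" "px u \<le> px w" "px w \<le> px v"
  shows "w = u \<or> w = v"
proof -
  have "(px w, py w) \<in> closed_segment (pos G u) (pos G v)"
    using assms by (intro closed_segment_horizontal) (auto simp: H_edge_def)
  then have "pos G w \<in> eseg G (u, v)" by (simp add: eseg_def)
  then show ?thesis using vertex_on_edge[of "(u, v)" w] assms by (auto simp: H_edge_def)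
qed

lemma on_V_edge:
  assumes "V_edge G (u, v)" "w \<in> V" "px w = px u" "py v \<le> py w" "py w \<le> py u"
  shows "w = u \<or> w = v"
proof -
  have "(px w, py w) \<in> closed_segment (pos G u) (pos G v)"
    using assms by (intro closed_segment_vertical) (auto simp: V_edge_def)
  then have "pos G w \<in> eseg G (u, v)" by (simp add: eseg_def)
  then show ?thesis using vertex_on_edge[of "(u, v)" w] assms by (auto simp: V_edge_def)
qed

text \<open>The head of the shorter of two such edges would lie on the longer one, and a vertex on
  an edge is one of its ends.\<close>

lemma H_out_unique: "H_edge G (u, v) \<Longrightarrow> H_edge G (u, w) \<Longrightarrow> v = w"
  using on_H_edge[of u v w] on_H_edge[of u w v] by (smt (verit) H_edgeD edge_verts)

lemma H_in_unique: "H_edge G (v, u) \<Longrightarrow> H_edge G (w, u) \<Longrightarrow> v = w"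
  using on_H_edge[of v u w] on_H_edge[of w u v] by (smt (verit) H_edgeD edge_verts)

lemma V_out_unique: "V_edge G (u, v) \<Longrightarrow> V_edge G (u, w) \<Longrightarrow> v = w"
  using on_V_edge[of u v w] on_V_edge[of u w v] by (smt (verit) V_edgeD edge_verts)

lemma V_in_unique: "V_edge G (v, u) \<Longrightarrow> V_edge G (w, u) \<Longrightarrow> v = w"
  using on_V_edge[of v u w] on_V_edge[of w u v] by (smt (verit) V_edgeD edge_verts)

text \<open>Both vertical inequalities are strict, so the crossing point is interior to the vertical
  edge and cannot be the common end that planarity demands.\<close>

lemma no_crossing:
  assumes "H_edge G (a, b)" "V_edge G (c, d)" "px a \<le> px c" "px c \<le> px b" "py d < py a" "py a < py c"
  shows False
proof -
  have "(px c, py a) \<in> eseg G (a, b)"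
    using closed_segment_horizontal[of "pos G a" "py a" "pos G b" "px c"] assms by (auto simp: eseg_def H_edge_def)
  moreover have "(px c, py a) \<in> eseg G (c, d)"
    using closed_segment_vertical[of "pos G c" "px c" "pos G d" "py a"] assms by (auto simp: eseg_def V_edge_def)
  moreover have "(a, b) \<noteq> (c, d)" using assms not_HV by blast
  moreover have "(a, b) \<in> E" "(c, d) \<in> E" using H_edgeD[OF assms(1)] V_edgeD[OF assms(2)] by blast+
  ultimately have "(px c, py a) \<in> pos G ` ({fst (a, b), snd (a, b)} \<inter> {fst (c, d), snd (c, d)})"
    using planar by blast
  then obtain w where "w = c \<or> w = d" "pos G w = (px c, py a)" by force
  then have "py w = py a" by simp
  then show False using \<open>w = c \<or> w = d\<close> assms(5,6) by auto
qed

text \<open>No edge goes left and the first edge out of a source is horizontal, hence goes strictly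
  right; all sources have the same abscissa.\<close>

lemma source_right:
  assumes "v \<in> V" "v \<notin> sources G" "s \<in> sources G"
  shows "px s < px v"
proof -
  obtain s' where s': "s' \<in> sources G" "(s', v) \<in> E\<^sup>*" using on_path assms by blast
  have "v = s' \<or> px s' < px v" using s'(2)
  proof (induction rule: rtrancl_induct)
    case (step u w)
    then show ?case using source_edge_H[of "(u, w)"] s'(1) edge_mono[of u w] H_edgeD[of u w] by auto
  qed auto
  then show ?thesis using s' assms px_sources by metis
qed

lemma sink_below:
  assumes "v \<in> V" "v \<notin> sinks G" "t \<in> sinks G"
  shows "py t < py v"
proof -
  obtain t' where t': "t' \<in> sinks G" "(v, t') \<in> E\<^sup>*" using on_path assms by blast
  have "v = t' \<or> py t' < py v" using t'(2)
  proof (induction rule: converse_rtrancl_induct)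
    case (step u w)
    then show ?case using sink_edge_V[of "(u, w)"] t'(1) edge_mono[of u w] V_edgeD[of u w] by auto
  qed auto
  then show ?thesis using t' assms py_sinks by metis
qed

lemma inner_iff: "v \<in> inner G \<longleftrightarrow> v \<in> V \<and> v \<notin> sources G \<and> v \<notin> sinks G"
  by (auto simp: inner_def)

lemma H_snd_inner: "H_edge G (u, v) \<Longrightarrow> v \<in> inner G"
  using no_edge_into_source[of "(u, v)"] sink_edge_V[of "(u, v)"] not_HV edge_verts by (auto simp: inner_iff dest: H_edgeD)

lemma V_fst_inner: "V_edge G (u, v) \<Longrightarrow> u \<in> inner G"
  using no_edge_from_sink[of "(u, v)"] source_edge_H[of "(u, v)"] not_HV edge_verts by (auto simp: inner_iff dest: V_edgeD)

section \<open>Straight paths and the two halves of \<open>lam\<close>\<close>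

lemma hpath_pos: "hpath G u v \<Longrightarrow> px u < px v \<and> py u = py v"
  unfolding hpath_def by (induction rule: trancl_induct) (auto dest: H_edgeD)

lemma vpath_pos: "vpath G u v \<Longrightarrow> py v < py u \<and> px u = px v"
  unfolding vpath_def by (induction rule: trancl_induct) (auto dest: V_edgeD)

text \<open>At most one H-edge leaves \<open>a\<close>, so every horizontal path from
  \<open>a\<close> begins with it.\<close>

lemma hpath_step_left:
  assumes "H_edge G (a, b)" shows "hpath G a w \<longleftrightarrow> w = b \<or> hpath G b w"
proof
  assume "hpath G a w"
  then obtain c where "H_edge G (a, c)" "(c, w) \<in> {e. H_edge G e}\<^sup>*"
    unfolding hpath_def by (auto dest: tranclD)
  then show "w = b \<or> hpath G b w" using H_out_unique[OF assms] by (auto simp: hpath_def rtrancl_eq_or_trancl)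
qed (use assms in \<open>auto simp: hpath_def intro: trancl_into_trancl2\<close>)

lemma hpath_step_right:
  assumes "H_edge G (a, b)" shows "hpath G w b \<longleftrightarrow> w = a \<or> hpath G w a"
proof
  assume "hpath G w b"
  then obtain c where "H_edge G (c, b)" "(w, c) \<in> {e. H_edge G e}\<^sup>*"
    unfolding hpath_def by (auto dest: tranclD2)
  then show "w = a \<or> hpath G w a" using H_in_unique[OF assms] by (auto simp: hpath_def rtrancl_eq_or_trancl)
qed (use assms in \<open>auto simp: hpath_def intro: trancl_into_trancl\<close>)

lemma vpath_step_left:
  assumes "V_edge G (a, b)" shows "vpath G a w \<longleftrightarrow> w = b \<or> vpath G b w"
proof
  assume "vpath G a w"
  then obtain c where "V_edge G (a, c)" "(c, w) \<in> {e. V_edge G e}\<^sup>*"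
    unfolding vpath_def by (auto dest: tranclD)
  then show "w = b \<or> vpath G b w" using V_out_unique[OF assms] by (auto simp: vpath_def rtrancl_eq_or_trancl)
qed (use assms in \<open>auto simp: vpath_def intro: trancl_into_trancl2\<close>)

lemma vpath_step_right:
  assumes "V_edge G (a, b)" shows "vpath G w b \<longleftrightarrow> w = a \<or> vpath G w a"
proof
  assume "vpath G w b"
  then obtain c where "V_edge G (c, b)" "(w, c) \<in> {e. V_edge G e}\<^sup>*"
    unfolding vpath_def by (auto dest: tranclD2)
  then show "w = a \<or> vpath G w a" using V_in_unique[OF assms] by (auto simp: vpath_def rtrancl_eq_or_trancl)
qed (use assms in \<open>auto simp: vpath_def intro: trancl_into_trancl\<close>)

lemma no_hpath_into_source: "s \<in> sources G \<Longrightarrow> \<not> hpath G u s"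
  unfolding hpath_def by (metis H_edge_def mem_Collect_eq no_edge_into_source snd_conv tranclD2)

lemma no_vpath_from_sink: "t \<in> sinks G \<Longrightarrow> \<not> vpath G t u"
  unfolding vpath_def by (metis V_edge_def mem_Collect_eq no_edge_from_sink fst_conv tranclD)

definition lamh :: "'v \<Rightarrow> 'v \<Rightarrow> int" where
  "lamh u v = of_bool (hpath G u v) - of_bool (hpath G v u)"

definition lamv :: "'v \<Rightarrow> 'v \<Rightarrow> int" where
  "lamv u v = of_bool (vpath G v u) - of_bool (vpath G u v)"

text \<open>Each kind of straight path fixes the relative position of its ends, so at most one of
  the four kinds is present and the nested conditionals of \<open>lam\<close> amount to a
  sum.\<close>

lemma lam_split: "lam G u v = lamh u v + lamv u v"
proof -
  have "\<not> (hpath G u v \<and> hpath G v u)" "\<not> (vpath G u v \<and> vpath G v u)"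
    "\<not> (hpath G u v \<and> vpath G u v)" "\<not> (hpath G u v \<and> vpath G v u)"
    "\<not> (hpath G v u \<and> vpath G u v)" "\<not> (hpath G v u \<and> vpath G v u)"
    using hpath_pos[of u v] hpath_pos[of v u] vpath_pos[of u v] vpath_pos[of v u] by linarith+
  then show ?thesis unfolding lam_def lamh_def lamv_def by auto
qed

lemma Lam_sum: "Lam G a b = (\<Sum>u\<in>inner G. \<Sum>v\<in>inner G. lam G u v * a u * b v)"
  by (rule Lam_eq[OF finite_inner]) (simp add: lam_split lamh_def lamv_def)

text \<open>A discrete derivative: a step along an H-edge changes the row relation only to the two
  ends of the edge. If \<open>a\<close> is a source, the value at \<open>a\<close> is not
  subtracted, and the relation to the whole row is left over.\<close>

lemma lamh_edge:
  assumes "H_edge G (a, b)" and w: "w \<in> inner G"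
  shows "lamh b w - of_bool (a \<in> inner G) * lamh a w =
     of_bool (a \<in> sources G \<and> hpath G a w) - of_bool (w = a \<and> a \<in> inner G) - of_bool (w = b)"
proof -
  have a: "a \<in> sources G \<longleftrightarrow> a \<notin> inner G"
    using assms no_edge_from_sink[of "(a, b)"] edge_verts[of a b] by (auto simp: inner_iff dest: H_edgeD)
  have n: "\<not> hpath G b b" "\<not> hpath G a a" "\<not> hpath G b a"
    using hpath_pos[of b b] hpath_pos[of a a] hpath_pos[of b a] H_edgeD[OF assms(1)] by auto
  have "a \<noteq> b" using assms by (auto dest: H_edgeD)
  show ?thesis
    using hpath_step_left[OF assms(1), of w] hpath_step_right[OF assms(1), of w] a n w \<open>a \<noteq> b\<close> no_hpath_into_source[of a w]
    by (auto simp: lamh_def)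
qed

lemma lamv_edge:
  assumes "V_edge G (a, b)" and w: "w \<in> inner G"
  shows "lamv a w - of_bool (b \<in> inner G) * lamv b w =
     of_bool (b \<in> sinks G \<and> vpath G w b) - of_bool (w = a) - of_bool (w = b \<and> b \<in> inner G)"
proof -
  have a: "b \<in> sinks G \<longleftrightarrow> b \<notin> inner G"
    using assms no_edge_into_source[of "(a, b)"] edge_verts[of a b] by (auto simp: inner_iff dest: V_edgeD)
  have n: "\<not> vpath G b b" "\<not> vpath G a a" "\<not> vpath G b a"
    using vpath_pos[of b b] vpath_pos[of a a] vpath_pos[of b a] V_edgeD[OF assms(1)] by auto
  have "a \<noteq> b" using assms by (auto dest: V_edgeD)
  show ?thesis
    using vpath_step_left[OF assms(1), of w] vpath_step_right[OF assms(1), of w] a n w \<open>a \<noteq> b\<close> no_vpath_from_sink[of b w]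
    by (auto simp: lamv_def)
qed

end

section \<open>Commutation of balanced edge vectors\<close>

context se_graph begin

text \<open>The exponents of \<open>edge_weight\<close>: those of \<open>u^-1 v\<close> for an
  H-edge between inner vertices and of \<open>v\<close> for one that leaves a source, because only
  inner vertices are recorded.\<close>

definition h_div :: "'v \<times> 'v \<Rightarrow> 'v \<Rightarrow> int" where
  "h_div e w = (if H_edge G e \<and> w \<in> inner G then of_bool (snd e = w) - of_bool (fst e = w) else 0)"

text \<open>The sign is opposite to that of \<open>h_div\<close>: at a balanced vertex the
  horizontal surplus of inflow equals the vertical surplus of outflow.\<close>

definition v_div :: "'v \<times> 'v \<Rightarrow> 'v \<Rightarrow> int" where
  "v_div e w = (if V_edge G e \<and> w \<in> inner G then of_bool (fst e = w) - of_bool (snd e = w) else 0)"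

text \<open>The exponent vector of the monomial belonging to an edge vector c, read off from the horizontal
  edges; for balanced c the vertical edges give the same vector, see hsum_eq_v_div.\<close>
definition hsum :: "('v \<times> 'v \<Rightarrow> int) \<Rightarrow> 'v \<Rightarrow> int" where
  "hsum c w = (\<Sum>e\<in>E. c e * h_div e w)"

definition balanced :: "('v \<times> 'v \<Rightarrow> int) \<Rightarrow> bool" where
  "balanced c \<longleftrightarrow> (\<forall>w\<in>inner G. (\<Sum>e\<in>E. c e * (of_bool (snd e = w) - of_bool (fst e = w))) = 0)"

lemma hsum_outside: "w \<notin> inner G \<Longrightarrow> hsum c w = 0"
  by (simp add: hsum_def h_div_def)

lemma hsum_add: "hsum (\<lambda>e. c e + d e) w = hsum c w + hsum d w"
  by (simp add: hsum_def algebra_simps sum.distrib)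

lemma hsum_diff: "hsum (\<lambda>e. c e - d e) w = hsum c w - hsum d w"
  by (simp add: hsum_def algebra_simps sum_subtractf)

lemma balanced_add: "balanced c \<Longrightarrow> balanced d \<Longrightarrow> balanced (\<lambda>e. c e + d e)"
  by (simp add: balanced_def algebra_simps sum.distrib sum_subtractf)

lemma balanced_diff: "balanced c \<Longrightarrow> balanced d \<Longrightarrow> balanced (\<lambda>e. c e - d e)"
  by (simp add: balanced_def algebra_simps sum.distrib sum_subtractf)

lemma hsum_eq_v_div:
  assumes "balanced c"
  shows "hsum c w = (\<Sum>e\<in>E. c e * v_div e w)"
proof (cases "w \<in> inner G")
  case True
  have "hsum c w - (\<Sum>e\<in>E. c e * v_div e w) = (\<Sum>e\<in>E. c e * (of_bool (snd e = w) - of_bool (fst e = w)))"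
    unfolding hsum_def sum_subtractf[symmetric]
  proof (rule sum.cong[OF refl])
    fix e assume "e \<in> E"
    then show "c e * h_div e w - c e * v_div e w = c e * (of_bool (snd e = w) - of_bool (fst e = w))"
      using not_H[of e] True by (cases "H_edge G e") (simp_all add: h_div_def v_div_def algebra_simps)
  qed
  then show ?thesis using assms True by (simp add: balanced_def)
next
  case False
  then show ?thesis by (simp add: hsum_def h_div_def v_div_def)
qed

section \<open>Summation by parts for \<open>Lam\<close>\<close>

lemma sum_of_bool_eq:
  assumes "finite A"
  shows "(\<Sum>u\<in>A. (f u :: int) * of_bool (a = u)) = (if a \<in> A then f a else 0)"
proof -
  have "(\<Sum>u\<in>A. f u * of_bool (a = u)) = (\<Sum>u\<in>A. if a = u then f u else 0)"
    by (rule sum.cong) auto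
  then show ?thesis using assms by (simp add: sum.delta')
qed

lemma sum_lamh_h_div:
  assumes "e \<in> E" "v \<in> inner G"
  shows "(\<Sum>u\<in>inner G. lamh u v * h_div e u) =
    of_bool (H_edge G e) * (of_bool (fst e \<in> sources G \<and> hpath G (fst e) v) - of_bool (fst e = v) - of_bool (snd e = v))"
proof (cases "H_edge G e")
  case True
  have "(\<Sum>u\<in>inner G. lamh u v * h_div e u)
      = (\<Sum>u\<in>inner G. lamh u v * of_bool (snd e = u)) - (\<Sum>u\<in>inner G. lamh u v * of_bool (fst e = u))"
    using True by (simp add: h_div_def algebra_simps sum_subtractf)
  also have "\<dots> = lamh (snd e) v - of_bool (fst e \<in> inner G) * lamh (fst e) v"
    unfolding sum_of_bool_eq[OF finite_inner] using True H_snd_inner[of "fst e" "snd e"] by simp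
  also have "\<dots> = of_bool (fst e \<in> sources G \<and> hpath G (fst e) v) - of_bool (fst e = v) - of_bool (snd e = v)"
    using lamh_edge[of "fst e" "snd e" v] True assms(2) by auto
  finally show ?thesis using True by simp
qed (simp add: h_div_def)

lemma sum_lamv_v_div:
  assumes "e \<in> E" "v \<in> inner G"
  shows "(\<Sum>u\<in>inner G. lamv u v * v_div e u) =
    of_bool (V_edge G e) * (of_bool (snd e \<in> sinks G \<and> vpath G v (snd e)) - of_bool (fst e = v) - of_bool (snd e = v))"
proof (cases "V_edge G e")
  case True
  have "(\<Sum>u\<in>inner G. lamv u v * v_div e u)
      = (\<Sum>u\<in>inner G. lamv u v * of_bool (fst e = u)) - (\<Sum>u\<in>inner G. lamv u v * of_bool (snd e = u))"
    using True by (simp add: v_div_def algebra_simps sum_subtractf)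
  also have "\<dots> = lamv (fst e) v - of_bool (snd e \<in> inner G) * lamv (snd e) v"
    unfolding sum_of_bool_eq[OF finite_inner] using True V_fst_inner[of "fst e" "snd e"] by simp
  also have "\<dots> = of_bool (snd e \<in> sinks G \<and> vpath G v (snd e)) - of_bool (fst e = v) - of_bool (snd e = v)"
    using lamv_edge[of "fst e" "snd e" v] True assms(2) by auto
  finally show ?thesis using True by simp
qed (simp add: v_div_def)

lemma sum_bilinear_swap:
  "(\<Sum>u\<in>A. \<Sum>v\<in>B. f u v * (\<Sum>e\<in>C. c e * g e u) * y v) = (\<Sum>e\<in>C. c e * (\<Sum>v\<in>B. y v * (\<Sum>u\<in>A. (f u v :: int) * g e u)))"
proof -
  have "(\<Sum>u\<in>A. \<Sum>v\<in>B. f u v * (\<Sum>e\<in>C. c e * g e u) * y v) = (\<Sum>u\<in>A. \<Sum>v\<in>B. \<Sum>e\<in>C. c e * (y v * (f u v * g e u)))"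
    by (simp add: sum_distrib_left sum_distrib_right mult_ac)
  also have "\<dots> = (\<Sum>u\<in>A. \<Sum>e\<in>C. \<Sum>v\<in>B. c e * (y v * (f u v * g e u)))"
    by (intro sum.cong refl sum.swap)
  also have "\<dots> = (\<Sum>e\<in>C. \<Sum>u\<in>A. \<Sum>v\<in>B. c e * (y v * (f u v * g e u)))"
    by (rule sum.swap)
  also have "\<dots> = (\<Sum>e\<in>C. \<Sum>v\<in>B. \<Sum>u\<in>A. c e * (y v * (f u v * g e u)))"
    by (intro sum.cong refl sum.swap)
  also have "\<dots> = (\<Sum>e\<in>C. c e * (\<Sum>v\<in>B. y v * (\<Sum>u\<in>A. f u v * g e u)))"
    by (simp only: sum_distrib_left)
  finally show ?thesis .
qed

text \<open>By \<open>sum_lamh_h_div\<close> and \<open>sum_lamv_v_div\<close> H-edges and V-edges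
  contribute in the same form, so the first sum no longer distinguishes them. The other two sums
  come from the telescoping partner that is missing at a source or a sink.\<close>

lemma Lam_hsum:
  assumes c: "balanced c" and y: "\<And>w. w \<notin> inner G \<Longrightarrow> y w = 0"
  shows "Lam G (hsum c) y = - (\<Sum>e\<in>E. c e * (y (fst e) + y (snd e)))
     + (\<Sum>e\<in>{e\<in>E. fst e \<in> sources G}. c e * (\<Sum>w\<in>{w\<in>inner G. hpath G (fst e) w}. y w))
     + (\<Sum>e\<in>{e\<in>E. snd e \<in> sinks G}. c e * (\<Sum>w\<in>{w\<in>inner G. vpath G w (snd e)}. y w))"
proof -
  let ?I = "inner G"
  let ?hs = "\<lambda>e. \<Sum>w\<in>{w\<in>?I. hpath G (fst e) w}. y w" and ?vs = "\<lambda>e. \<Sum>w\<in>{w\<in>?I. vpath G w (snd e)}. y w"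
  have pt: "(\<Sum>v\<in>?I. y v * of_bool (a = v)) = y a" for a
    unfolding sum_of_bool_eq[OF finite_inner] using y by auto
  have ob: "(\<Sum>v\<in>?I. y v * of_bool (Q v)) = sum y {v\<in>?I. Q v}" for Q
  proof -
    have "(\<Sum>v\<in>?I. y v * of_bool (Q v)) = (\<Sum>v\<in>?I. if Q v then y v else 0)" by (rule sum.cong) auto
    then show ?thesis using finite_inner by (simp add: sum.inter_filter)
  qed
  have H: "(\<Sum>v\<in>?I. y v * (\<Sum>u\<in>?I. lamh u v * h_div e u)) =
     of_bool (H_edge G e) * (of_bool (fst e \<in> sources G) * ?hs e - y (fst e) - y (snd e))" if "e \<in> E" for e
  proof -
    have "(\<Sum>v\<in>?I. y v * (\<Sum>u\<in>?I. lamh u v * h_div e u)) =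
       (\<Sum>v\<in>?I. of_bool (H_edge G e) * (of_bool (fst e \<in> sources G) * (y v * of_bool (hpath G (fst e) v)) - y v * of_bool (fst e = v) - y v * of_bool (snd e = v)))"
      by (rule sum.cong[OF refl], subst sum_lamh_h_div[OF that], assumption) (simp add: algebra_simps of_bool_conj)
    also have "\<dots> = of_bool (H_edge G e) * (of_bool (fst e \<in> sources G) * ?hs e - y (fst e) - y (snd e))"
      by (simp only: sum_distrib_left[symmetric] sum_subtractf pt ob)
    finally show ?thesis .
  qed
  have V: "(\<Sum>v\<in>?I. y v * (\<Sum>u\<in>?I. lamv u v * v_div e u)) =
     of_bool (V_edge G e) * (of_bool (snd e \<in> sinks G) * ?vs e - y (fst e) - y (snd e))" if "e \<in> E" for e
  proof -
    have "(\<Sum>v\<in>?I. y v * (\<Sum>u\<in>?I. lamv u v * v_div e u)) =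
       (\<Sum>v\<in>?I. of_bool (V_edge G e) * (of_bool (snd e \<in> sinks G) * (y v * of_bool (vpath G v (snd e))) - y v * of_bool (fst e = v) - y v * of_bool (snd e = v)))"
      by (rule sum.cong[OF refl], subst sum_lamv_v_div[OF that], assumption) (simp add: algebra_simps of_bool_conj)
    also have "\<dots> = of_bool (V_edge G e) * (of_bool (snd e \<in> sinks G) * ?vs e - y (fst e) - y (snd e))"
      by (simp only: sum_distrib_left[symmetric] sum_subtractf pt ob)
    finally show ?thesis .
  qed
  \<comment> \<open>The same vector \<open>hsum c\<close> is written by horizontal edges in the
    first sum and by vertical edges in the second.\<close>
  have "Lam G (hsum c) y = (\<Sum>u\<in>?I. \<Sum>v\<in>?I. lamh u v * (\<Sum>e\<in>E. c e * h_div e u) * y v)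
     + (\<Sum>u\<in>?I. \<Sum>v\<in>?I. lamv u v * (\<Sum>e\<in>E. c e * v_div e u) * y v)"
    unfolding Lam_sum hsum_eq_v_div[OF c, symmetric] unfolding hsum_def[symmetric]
    by (simp add: lam_split algebra_simps sum.distrib)
  also have "\<dots> = (\<Sum>e\<in>E. c e * (of_bool (H_edge G e) * (of_bool (fst e \<in> sources G) * ?hs e - y (fst e) - y (snd e))))
     + (\<Sum>e\<in>E. c e * (of_bool (V_edge G e) * (of_bool (snd e \<in> sinks G) * ?vs e - y (fst e) - y (snd e))))"
    unfolding sum_bilinear_swap using H V by simp
  also have "\<dots> = (\<Sum>e\<in>E. - (c e * (y (fst e) + y (snd e))) + (if fst e \<in> sources G then c e * ?hs e else 0)
       + (if snd e \<in> sinks G then c e * ?vs e else 0))"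
    unfolding sum.distrib[symmetric]
  proof (rule sum.cong[OF refl])
    fix e assume e: "e \<in> E"
    show "c e * (of_bool (H_edge G e) * (of_bool (fst e \<in> sources G) * ?hs e - y (fst e) - y (snd e)))
      + c e * (of_bool (V_edge G e) * (of_bool (snd e \<in> sinks G) * ?vs e - y (fst e) - y (snd e)))
      = - (c e * (y (fst e) + y (snd e))) + (if fst e \<in> sources G then c e * ?hs e else 0) + (if snd e \<in> sinks G then c e * ?vs e else 0)"
      using not_H[OF e] source_edge_H[OF e] sink_edge_V[OF e] by (cases "H_edge G e") (auto simp: algebra_simps)
  qed
  also have "\<dots> = - (\<Sum>e\<in>E. c e * (y (fst e) + y (snd e)))
     + (\<Sum>e\<in>{e\<in>E. fst e \<in> sources G}. c e * ?hs e)
     + (\<Sum>e\<in>{e\<in>E. snd e \<in> sinks G}. c e * ?vs e)"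
    by (simp only: sum.distrib sum_negf sum.inter_filter[OF finite_edges])
  finally show ?thesis .
qed

text \<open>Each H-edge in the row to the right of \<open>r\<close> counts +1 at its head and -1 at
  its tail; only for the edge leaving \<open>r\<close> is the tail missing.\<close>

lemma row_sum:
  assumes "r \<in> sources G"
  shows "(\<Sum>w\<in>{w\<in>inner G. hpath G r w}. hsum c w) = (\<Sum>e\<in>{e\<in>E. fst e = r}. c e)"
proof -
  let ?L = "{w\<in>inner G. hpath G r w}"
  have fin: "finite ?L" using finite_inner by auto
  have *: "(\<Sum>w\<in>?L. h_div e w) = of_bool (fst e = r)" if e: "e \<in> E" for e
  proof (cases "H_edge G e")
    case True
    have b: "snd e \<in> inner G" using True H_snd_inner[of "fst e" "snd e"] by simp
    have a: "hpath G r (fst e) \<Longrightarrow> fst e \<in> inner G"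
      using no_hpath_into_source[of "fst e" r] no_edge_from_sink[OF e] edge_verts[of "fst e" "snd e"] e by (auto simp: inner_iff)
    have "(\<Sum>w\<in>?L. h_div e w) = (\<Sum>w\<in>?L. 1 * of_bool (snd e = w)) - (\<Sum>w\<in>?L. 1 * of_bool (fst e = w))"
      unfolding sum_subtractf[symmetric] by (rule sum.cong) (use True in \<open>auto simp: h_div_def\<close>)
    also have "\<dots> = of_bool (hpath G r (snd e)) - of_bool (hpath G r (fst e))"
      unfolding sum_of_bool_eq[OF fin] using a b by auto
    also have "\<dots> = of_bool (fst e = r)"
      using hpath_step_right[of "fst e" "snd e" r] True hpath_pos[of r r] by auto
    finally show ?thesis .
  next
    case False
    then show ?thesis using source_edge_H[OF e] assms by (auto simp: h_div_def)
  qed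
  have "(\<Sum>w\<in>?L. hsum c w) = (\<Sum>e\<in>E. c e * (\<Sum>w\<in>?L. h_div e w))"
    unfolding hsum_def by (subst sum.swap) (simp add: sum_distrib_left)
  also have "\<dots> = (\<Sum>e\<in>E. if fst e = r then c e else 0)" by (rule sum.cong) (auto simp: *)
  finally show ?thesis using finite_edges by (simp add: sum.inter_filter)
qed

text \<open>A column telescopes in the vertical reading of \<open>hsum c\<close>, which is where
  balancedness enters.\<close>

lemma column_sum:
  assumes "t \<in> sinks G" "balanced c"
  shows "(\<Sum>w\<in>{w\<in>inner G. vpath G w t}. hsum c w) = (\<Sum>e\<in>{e\<in>E. snd e = t}. c e)"
proof -
  let ?L = "{w\<in>inner G. vpath G w t}"
  have fin: "finite ?L" using finite_inner by auto
  have *: "(\<Sum>w\<in>?L. v_div e w) = of_bool (snd e = t)" if e: "e \<in> E" for e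
  proof (cases "V_edge G e")
    case True
    have b: "fst e \<in> inner G" using True V_fst_inner[of "fst e" "snd e"] by simp
    have a: "vpath G (snd e) t \<Longrightarrow> snd e \<in> inner G"
      using no_vpath_from_sink[of "snd e" t] no_edge_into_source[OF e] edge_verts[of "fst e" "snd e"] e by (auto simp: inner_iff)
    have "(\<Sum>w\<in>?L. v_div e w) = (\<Sum>w\<in>?L. 1 * of_bool (fst e = w)) - (\<Sum>w\<in>?L. 1 * of_bool (snd e = w))"
      unfolding sum_subtractf[symmetric] by (rule sum.cong) (use True in \<open>auto simp: v_div_def\<close>)
    also have "\<dots> = of_bool (vpath G (fst e) t) - of_bool (vpath G (snd e) t)"
      unfolding sum_of_bool_eq[OF fin] using a b by auto
    also have "\<dots> = of_bool (snd e = t)"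
      using vpath_step_left[of "fst e" "snd e" t] True vpath_pos[of t t] by auto
    finally show ?thesis .
  next
    case False
    then show ?thesis using sink_edge_V[OF e] assms by (auto simp: v_div_def)
  qed
  have "(\<Sum>w\<in>?L. hsum c w) = (\<Sum>e\<in>E. c e * (\<Sum>w\<in>?L. v_div e w))"
    unfolding hsum_eq_v_div[OF assms(2)] by (subst sum.swap) (simp add: sum_distrib_left)
  also have "\<dots> = (\<Sum>e\<in>E. if snd e = t then c e else 0)" by (rule sum.cong) (auto simp: *)
  finally show ?thesis using finite_edges by (simp add: sum.inter_filter)
qed

text \<open>A source has one leaving edge and a sink one entering edge, so the row and column sums
  of \<open>hsum d\<close> reduce to \<open>d\<close> on that edge. Every term now belongs to a
  single edge.\<close>

lemma Lam_hsum_hsum: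
  assumes c: "balanced c" and d: "balanced d"
  shows "Lam G (hsum c) (hsum d) = - (\<Sum>e\<in>E. c e * (hsum d (fst e) + hsum d (snd e)))
     + (\<Sum>e\<in>{e\<in>E. fst e \<in> sources G}. c e * d e) + (\<Sum>e\<in>{e\<in>E. snd e \<in> sinks G}. c e * d e)"
proof -
  have 1: "(\<Sum>w\<in>{w\<in>inner G. hpath G (fst e) w}. hsum d w) = d e" if "e \<in> E" "fst e \<in> sources G" for e
  proof -
    have "{e'\<in>E. fst e' = fst e} = {e}"
      using that H_out_unique[of "fst e" "snd e"] source_edge_H by (auto simp: prod_eq_iff) (metis prod.collapse source_edge_H fst_conv)
    then show ?thesis using row_sum[OF that(2), of d] by simp
  qed
  have 2: "(\<Sum>w\<in>{w\<in>inner G. vpath G w (snd e)}. hsum d w) = d e" if "e \<in> E" "snd e \<in> sinks G" for e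
  proof -
    have "{e'\<in>E. snd e' = snd e} = {e}"
      using that V_in_unique[of "fst e" "snd e"] sink_edge_V by (auto simp: prod_eq_iff) (metis prod.collapse sink_edge_V snd_conv)
    then show ?thesis using column_sum[OF that(2) d] by simp
  qed
  have "(\<Sum>e\<in>{e\<in>E. fst e \<in> sources G}. c e * (\<Sum>w\<in>{w\<in>inner G. hpath G (fst e) w}. hsum d w))
      = (\<Sum>e\<in>{e\<in>E. fst e \<in> sources G}. c e * d e)"
    by (intro sum.cong refl) (use 1 in auto)
  moreover have "(\<Sum>e\<in>{e\<in>E. snd e \<in> sinks G}. c e * (\<Sum>w\<in>{w\<in>inner G. vpath G w (snd e)}. hsum d w))
      = (\<Sum>e\<in>{e\<in>E. snd e \<in> sinks G}. c e * d e)"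
    by (intro sum.cong refl) (use 2 in auto)
  ultimately show ?thesis
    using Lam_hsum[OF c, of "hsum d"] hsum_outside by simp
qed

end

section \<open>Weights of paths and flows\<close>

lemma pedges_Cons [simp]: "pedges (u # v # p) = insert (u, v) (pedges (v # p))"
  by (simp add: pedges_def)

lemma pedges_single [simp]: "pedges [v] = {}"
  by (simp add: pedges_def)

lemma pedges_verts: "e \<in> pedges p \<Longrightarrow> fst e \<in> set p \<and> snd e \<in> set p"
  unfolding pedges_def by (cases e; cases p) (auto dest: set_zip_leftD set_zip_rightD)

context se_graph begin

section \<open>Normalisation of a single path weight\<close>

definition path_exp :: "'v list \<Rightarrow> 'v \<Rightarrow> int" where
  "path_exp p w = (\<Sum>e\<leftarrow>zip p (tl p). h_div e w)"

lemma path_exp_Cons [simp]: "path_exp (u # v # p) w = h_div (u, v) w + path_exp (v # p) w"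
  by (simp add: path_exp_def)

lemma path_exp_single [simp]: "path_exp [v] w = 0"
  by (simp add: path_exp_def)

lemma path_exp_notin:
  assumes "w \<notin> set p" shows "path_exp p w = 0"
proof -
  have "h_div e w = 0" if "e \<in> pedges p" for e
    using pedges_verts[OF that] assms by (auto simp: h_div_def)
  then have "map (\<lambda>e. h_div e w) (zip p (tl p)) = map (\<lambda>e. 0) (zip p (tl p))"
    by (intro map_cong) (auto simp: pedges_def)
  then show ?thesis unfolding path_exp_def by (simp only: sum_list_0)
qed

text \<open>Shows that a path which has left a row downwards has no further row relation with
  it.\<close>

lemma path_below:
  assumes "pedges (v # p) \<subseteq> E" "w \<in> set (v # p)"
  shows "py w \<le> py v"
  using assms
proof (induction p arbitrary: v)
  case (Cons u p)
  then have "(v, u) \<in> E" by auto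
  from edge_mono[OF this] show ?case using Cons by fastforce
qed auto

lemma lamh_py: "py u \<noteq> py w \<Longrightarrow> lamh u w = 0"
  using hpath_pos[of u w] hpath_pos[of w u] by (auto simp: lamh_def)

abbreviation ind :: "'a set \<Rightarrow> 'a \<Rightarrow> int" where
  "ind A \<equiv> \<lambda>x. of_bool (x \<in> A)"

text \<open>Both sides are 1 if the path leaves v horizontally, and 0 otherwise.\<close>
lemma sum_lamh_path:
  assumes "pedges (v # p) \<subseteq> E" "distinct (v # p)" "v \<in> inner G"
  shows "(\<Sum>w\<in>inner G. lamh v w * path_exp (v # p) w) = - path_exp (v # p) v"
  using assms
proof (induction p arbitrary: v)
  case (Cons u p)
  have vu: "(v, u) \<in> E" using Cons by auto
  have v0: "path_exp (u # p) v = 0" using Cons by (intro path_exp_notin) auto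
  show ?case
  proof (cases "H_edge G (v, u)")
    case True
    have u: "u \<in> inner G" using True by (rule H_snd_inner)
    have IH: "(\<Sum>w\<in>inner G. lamh u w * path_exp (u # p) w) = - path_exp (u # p) u"
      using Cons u by auto
    have ne: "v \<noteq> u" using Cons by auto
    have uv: "lamh u u = 0" "lamh u v = -1" using True H_edgeD[OF True] hpath_pos[of u v]
      by (auto simp: lamh_def hpath_def)
    let ?x = "path_exp (v # u # p)"
    have "(\<Sum>w\<in>inner G. lamh v w * ?x w) = (\<Sum>w\<in>inner G. lamh u w * ?x w + ?x w * of_bool (v = w) + ?x w * of_bool (u = w))"
    proof (rule sum.cong[OF refl])
      fix w assume w: "w \<in> inner G"
      have "v \<notin> sources G" using Cons.prems by (auto simp: inner_iff)
      then have eq: "lamh v w = lamh u w + of_bool (v = w) + of_bool (u = w)"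
        using lamh_edge[OF True w] Cons.prems by (simp add: eq_commute[of w])
      show "lamh v w * ?x w = lamh u w * ?x w + ?x w * of_bool (v = w) + ?x w * of_bool (u = w)"
        unfolding eq by (simp only: ring_distribs mult.commute)
    qed
    also have "\<dots> = (\<Sum>w\<in>inner G. lamh u w * ?x w) + ?x v + ?x u"
      unfolding sum.distrib sum_of_bool_eq[OF finite_inner] using Cons.prems u by simp
    also have "(\<Sum>w\<in>inner G. lamh u w * ?x w) = (\<Sum>w\<in>inner G. lamh u w * of_bool (u = w)) - (\<Sum>w\<in>inner G. lamh u w * of_bool (v = w))
          + (\<Sum>w\<in>inner G. lamh u w * path_exp (u # p) w)"
      unfolding sum_subtractf[symmetric] sum.distrib[symmetric]
      by (rule sum.cong[OF refl]) (use True in \<open>simp add: h_div_def algebra_simps\<close>)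
    also have "\<dots> = 1 - path_exp (u # p) u"
      unfolding sum_of_bool_eq[OF finite_inner] IH using Cons.prems u uv by simp
    finally show ?thesis using v0 u True ne Cons.prems by (simp add: h_div_def)
  next
    case False
    then have V: "V_edge G (v, u)" using not_H vu by blast
    have x: "path_exp (v # u # p) w = path_exp (u # p) w" for w using False by (simp add: h_div_def)
    have "lamh v w * path_exp (u # p) w = 0" for w
    proof (cases "w \<in> set (u # p)")
      case True
      then have "py w \<le> py u" using Cons.prems by (intro path_below) auto
      then show ?thesis using V_edgeD[OF V] lamh_py[of v w] by auto
    qed (use path_exp_notin in auto)
    then show ?thesis by (simp only: x v0 sum.neutral_const minus_zero)
  qed
qed auto

lemma Lam_delta:
  assumes "v \<in> inner G"
  shows "Lam G (\<lambda>x. if x = v then 1 else 0) b = (\<Sum>w\<in>inner G. lamh v w * b w) + (\<Sum>w\<in>inner G. lamv v w * b w)"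
proof -
  have "Lam G (\<lambda>x. if x = v then 1 else 0) b = (\<Sum>u\<in>inner G. if u = v then (\<Sum>w\<in>inner G. lam G v w * b w) else 0)"
    unfolding Lam_sum by (rule sum.cong) auto
  also have "\<dots> = (\<Sum>w\<in>inner G. lam G v w * b w)" using assms finite_inner by simp
  finally show ?thesis by (simp add: lam_split algebra_simps sum.distrib)
qed

text \<open>Replacing \<open>v\<close> by \<open>u\<close> removes the row part, which is
  \<open>- path_exp (v # p) v\<close> by \<open>sum_lamh_path\<close>, and adds exactly this amount
  to the column part.\<close>

lemma Lam_V_step:
  assumes V: "V_edge G (u, v)" and p: "pedges (v # p) \<subseteq> E" "distinct (v # p)" "u \<notin> set (v # p)" "v \<in> inner G"
  shows "Lam G (\<lambda>x. if x = u then 1 else 0) (path_exp (v # p)) = Lam G (\<lambda>x. if x = v then 1 else 0) (path_exp (v # p))"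
proof -
  let ?x = "path_exp (v # p)"
  have u: "u \<in> inner G" using V by (rule V_fst_inner)
  have u0: "?x u = 0" using p by (intro path_exp_notin)
  have "lamh u w * ?x w = 0" for w
  proof (cases "w \<in> set (v # p)")
    case True
    then have "py w \<le> py v" using p by (intro path_below) auto
    then show ?thesis using V_edgeD[OF V] lamh_py[of u w] by auto
  qed (use path_exp_notin in auto)
  then have "(\<Sum>w\<in>inner G. lamh u w * ?x w) = 0" by (simp only: sum.neutral_const)
  moreover have "(\<Sum>w\<in>inner G. lamv u w * ?x w) = (\<Sum>w\<in>inner G. lamv v w * ?x w) - ?x v"
  proof -
    have "(\<Sum>w\<in>inner G. lamv u w * ?x w) = (\<Sum>w\<in>inner G. lamv v w * ?x w - ?x w * of_bool (v = w) - ?x w * of_bool (u = w))"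
    proof (rule sum.cong[OF refl])
      fix w assume w: "w \<in> inner G"
      have "v \<notin> sinks G" using p by (auto simp: inner_iff)
      then have eq: "lamv u w = lamv v w - of_bool (v = w) - of_bool (u = w)"
        using lamv_edge[OF V w] p by (simp add: eq_commute[of w])
      show "lamv u w * ?x w = lamv v w * ?x w - ?x w * of_bool (v = w) - ?x w * of_bool (u = w)"
        unfolding eq by (simp only: ring_distribs mult.commute)
    qed
    then show ?thesis unfolding sum_subtractf sum_of_bool_eq[OF finite_inner] using p u u0 by simp
  qed
  ultimately show ?thesis
    unfolding Lam_delta[OF u] Lam_delta[OF p(4)] sum_lamh_path[OF p(1,2,4)] by simp
qed

lemma path_weight_Cons: "path_weight G q (u # v # p) = qmult G q (edge_weight G q (u, v)) (path_weight G q (v # p))"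
  by (simp add: path_weight_def)

text \<open>A suffix becomes Weyl-normalised after multiplication by \<open>v\<close> from the left;
  this is what the defect expresses. At an H-edge the factor \<open>v\<close> cancels against
  \<open>v^-1\<close> in the edge weight, and at a V-edge \<open>Lam_V_step\<close> moves the factor
  to the next vertex.\<close>

lemma weyl_path_suffix:
  assumes "q \<noteq> 0" "pedges (v # p) \<subseteq> E" "distinct (v # p)" "v \<in> inner G" "last (v # p) \<in> sinks G"
  shows "weyl G q (path_weight G q (v # p)) (path_exp (v # p)) (- Lam G (\<lambda>x. if x = v then 1 else 0) (path_exp (v # p)))"
  using assms(2-)
proof (induction p arbitrary: v)
  case Nil
  then show ?case by (simp add: inner_iff)
next
  case (Cons u p)
  have vu: "(v, u) \<in> E" using Cons by auto
  have v: "v \<notin> sources G" using Cons by (auto simp: inner_iff)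
  let ?d = "\<lambda>v x. if x = v then 1 else 0 :: int" and ?x = "path_exp (u # p)"
  show ?case
  proof (cases "H_edge G (v, u)")
    case True
    then have u: "u \<in> inner G" by (rule H_snd_inner)
    have IH: "weyl G q (path_weight G q (u # p)) ?x (- Lam G (?d u) ?x)" using Cons u by auto
    have ew: "edge_weight G q (v, u) = qmult G q (geninv v) (gen u)" using v True by (simp add: edge_weight_def)
    let ?m = "\<lambda>x. if x = v then - 1 else 0 :: int"
    note w = weyl_mult[OF assms(1) weyl_mult[OF assms(1) weyl_geninv[of G q v] weyl_gen[of G q u]] IH]
    have m: "Lam G ?m b + Lam G (?d v) b = 0" for b
    proof -
      have z: "(\<lambda>x. ?m x + ?d v x) = (\<lambda>_. 0)" by auto
      show ?thesis unfolding Lam_add_left[symmetric] z by simp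
    qed
    have e: "path_exp (v # u # p) = (\<lambda>x. (?m x + ?d u x) + ?x x)"
      using True Cons.prems u by (auto simp: h_div_def fun_eq_iff)
    have "(0 + 0 + Lam G ?m (?d u)) + - Lam G (?d u) ?x + Lam G (\<lambda>x. ?m x + ?d u x) ?x
       = - Lam G (?d v) (\<lambda>x. (?m x + ?d u x) + ?x x)"
      using m[of "?d u"] m[of ?x] m[of ?m] Lam_skew[of G ?m ?m] unfolding Lam_add_left Lam_add_right by linarith
    then show ?thesis using w unfolding path_weight_Cons ew e by simp
  next
    case False
    then have V: "V_edge G (v, u)" using not_H vu by blast
    have ew: "edge_weight G q (v, u) = one_LG" using v False by (simp add: edge_weight_def)
    have e: "path_exp (v # u # p) = (\<lambda>x. 0 + ?x x)" using False by (auto simp: h_div_def fun_eq_iff)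
    have "weyl G q (path_weight G q (u # p)) ?x (- Lam G (?d v) ?x)"
    proof (cases "u \<in> sinks G")
      case True
      then have p: "p = []" using Cons.prems no_edge_from_sink by (cases p) auto
      have x: "?x = (\<lambda>_. 0)" by (simp add: p fun_eq_iff)
      show ?thesis unfolding x unfolding p using weyl_one by (simp add: path_weight_def)
    next
      case False
      then have u: "u \<in> inner G" using no_edge_into_source[OF vu] edge_verts[OF vu] by (simp add: inner_iff)
      then have "weyl G q (path_weight G q (u # p)) ?x (- Lam G (?d u) ?x)" using Cons by auto
      then show ?thesis using Lam_V_step[OF V, of p] Cons.prems u by simp
    qed
    from weyl_mult[OF assms(1) weyl_one this] show ?thesis unfolding path_weight_Cons ew e by simp
  qed
qed

text \<open>The edge at the source has weight \<open>v\<close>, which is precisely the left factor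
  missing in \<open>weyl_path_suffix\<close>.\<close>

lemma weyl_path:
  assumes "q \<noteq> 0" "dpath G p" "hd p \<in> sources G" "last p \<in> sinks G"
  shows "weyl G q (path_weight G q p) (path_exp p) 0"
proof -
  obtain s v r where p: "p = s # v # r"
    using assms source_not_sink by (metis dpath_def last_ConsL list.collapse)
  have *: "pedges (v # r) \<subseteq> E" "distinct (v # r)" "(s, v) \<in> E" "s \<in> sources G" "last (v # r) \<in> sinks G"
    using assms p by (auto simp: dpath_def)
  have H: "H_edge G (s, v)" using source_edge_H *(3,4) by simp
  then have v: "v \<in> inner G" by (rule H_snd_inner)
  let ?d = "\<lambda>x. if x = v then 1 else 0 :: int"
  have e: "path_exp p = (\<lambda>x. ?d x + path_exp (v # r) x)"
    using H v *(4) by (auto simp: p h_div_def fun_eq_iff inner_iff)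
  show ?thesis
    using weyl_mult[OF assms(1) weyl_gen[of G q v] weyl_path_suffix[OF assms(1) *(1,2) v *(5)]] *(4)
    unfolding e by (simp add: p path_weight_Cons edge_weight_def)
qed

section \<open>From paths to flows as balanced edge vectors\<close>

lemma path_exp_hsum:
  assumes "dpath G p"
  shows "path_exp p = hsum (ind (pedges p))"
proof
  fix w
  have "distinct (zip p (tl p))" using assms by (simp add: dpath_def distinct_zipI1)
  then have "path_exp p w = (\<Sum>e\<in>pedges p. h_div e w)"
    by (simp add: path_exp_def pedges_def sum_list_distinct_conv_sum_set)
  also have "\<dots> = hsum (ind (pedges p)) w"
    unfolding hsum_def using assms finite_edges by (intro sum.mono_neutral_cong_left) (auto simp: dpath_def)
  finally show "path_exp p w = hsum (ind (pedges p)) w" .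
qed

text \<open>The divergence telescopes to the two ends of the path, a source and a sink, and these
  are not inner.\<close>

lemma balanced_path:
  assumes "dpath G p" "hd p \<in> sources G" "last p \<in> sinks G"
  shows "balanced (ind (pedges p))"
  unfolding balanced_def
proof
  fix w assume w: "w \<in> inner G"
  let ?f = "\<lambda>e. of_bool (snd e = w) - of_bool (fst e = w) :: int"
  have tele: "p \<noteq> [] \<Longrightarrow> (\<Sum>e\<leftarrow>zip p (tl p). ?f e) = of_bool (last p = w) - of_bool (hd p = w)" for p :: "'v list"
  proof (induction p)
    case (Cons u p)
    then show ?case by (cases p) auto
  qed simp
  have "distinct (zip p (tl p))" using assms by (simp add: dpath_def distinct_zipI1)
  then have "(\<Sum>e\<in>pedges p. ?f e) = (\<Sum>e\<leftarrow>zip p (tl p). ?f e)"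
    by (simp add: pedges_def sum_list_distinct_conv_sum_set)
  also have "\<dots> = 0" using tele[of p] assms w by (auto simp: dpath_def inner_iff)
  finally have "(\<Sum>e\<in>pedges p. ?f e) = 0" .
  moreover have "(\<Sum>e\<in>E. ind (pedges p) e * ?f e) = (\<Sum>e\<in>pedges p. ?f e)"
    using assms finite_edges by (intro sum.mono_neutral_cong_right) (auto simp: dpath_def)
  ultimately show "(\<Sum>e\<in>E. ind (pedges p) e * ?f e) = 0" by simp
qed

text \<open>In the local formula an edge of \<open>A\<close> meets \<open>B\<close> only through
  \<open>hsum (ind B)\<close> at its ends and through \<open>ind B\<close> on itself; both vanish if
  no vertex is shared.\<close>

lemma Lam_disjoint:
  assumes "balanced (ind A)" "balanced (ind B)"
    and disj: "\<And>e e'. e \<in> A \<Longrightarrow> e' \<in> B \<Longrightarrow> {fst e, snd e} \<inter> {fst e', snd e'} = {}"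
  shows "Lam G (hsum (ind A)) (hsum (ind B)) = 0"
proof -
  have z: "hsum (ind B) w = 0" if "e \<in> A" "w \<in> {fst e, snd e}" for e w
    unfolding hsum_def
  proof (rule sum.neutral, rule ballI)
    fix e' show "ind B e' * h_div e' w = 0"
      using disj[OF that(1), of e'] that(2) by (auto simp: h_div_def)
  qed
  have "ind A e * (hsum (ind B) (fst e) + hsum (ind B) (snd e)) = 0" "ind A e * ind B e = 0" for e
    using z[of e] disj[of e e] by auto
  then show ?thesis unfolding Lam_hsum_hsum[OF assms(1,2)] by (simp only: sum.neutral_const)
qed

lemma flow_ends:
  assumes "is_flow G I J phi" "i \<in> I"
  shows "dpath G (phi i)" "hd (phi i) \<in> sources G" "last (phi i) \<in> sinks G" "hd (phi i) = src G i"
proof -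
  show "dpath G (phi i)" "hd (phi i) = src G i" using assms by (auto simp: is_flow_def)
  then show "hd (phi i) \<in> sources G" using assms by (auto simp: is_flow_def sources_def)
  have "last (phi i) \<in> snk G ` J" using assms unfolding is_flow_def by (metis imageI)
  then show "last (phi i) \<in> sinks G" using assms by (auto simp: is_flow_def sinks_def)
qed

text \<open>Each further path has vanishing \<open>Lam\<close> with the product of the others, so no
  defect accumulates. Balancedness is carried through the induction because
  \<open>Lam_disjoint\<close> asks for it.\<close>

lemma weyl_flow:
  assumes "q \<noteq> 0" and F: "is_flow G I J phi"
  shows "weyl G q (flow_weight G q I phi) (hsum (ind (flow_edges I phi))) 0" "balanced (ind (flow_edges I phi))"
proof -
  have "finite I" using F by (auto simp: is_flow_def intro: finite_subset)
  note pe = flow_ends[OF F]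
  have "weyl G q (foldr (\<lambda>i acc. qmult G q (path_weight G q (phi i)) acc) xs one_LG)
     (hsum (ind (\<Union>i\<in>set xs. pedges (phi i)))) 0 \<and> balanced (ind (\<Union>i\<in>set xs. pedges (phi i)))"
    if "set xs \<subseteq> I" "distinct xs" for xs
    using that
  proof (induction xs)
    case Nil
    have "hsum (ind {}) = (\<lambda>_. 0)" by (simp add: hsum_def fun_eq_iff)
    then show ?case using weyl_one[of G q] by (simp add: balanced_def)
  next
    case (Cons i xs)
    let ?A = "pedges (phi i)" and ?B = "\<Union>i\<in>set xs. pedges (phi i)"
    have i: "i \<in> I" using Cons by auto
    have disj: "{fst e, snd e} \<inter> {fst e', snd e'} = {}" if "e \<in> ?A" "e' \<in> ?B" for e e'
    proof -
      obtain j where j: "j \<in> set xs" "e' \<in> pedges (phi j)" using \<open>e' \<in> ?B\<close> by auto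
      have "set (phi i) \<inter> set (phi j) = {}" using F Cons.prems j i unfolding is_flow_def by (metis distinct.simps(2) list.set_intros(2) subsetD)
      then show ?thesis using pedges_verts[OF \<open>e \<in> ?A\<close>] pedges_verts[OF j(2)] by auto
    qed
    have u: "ind (\<Union>i\<in>set (i # xs). pedges (phi i)) = (\<lambda>e. ind ?A e + ind ?B e)"
    proof
      fix e show "ind (\<Union>i\<in>set (i # xs). pedges (phi i)) e = ind ?A e + ind ?B e"
        using disj[of e e] by auto
    qed
    have IH: "weyl G q (foldr (\<lambda>i acc. qmult G q (path_weight G q (phi i)) acc) xs one_LG) (hsum (ind ?B)) 0" "balanced (ind ?B)"
      using Cons by auto
    have bA: "balanced (ind ?A)" using balanced_path pe[OF i] by blast
    have "weyl G q (path_weight G q (phi i)) (hsum (ind ?A)) 0"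
      using weyl_path[OF assms(1) pe(1-3)[OF i]] path_exp_hsum pe[OF i] by simp
    from weyl_mult[OF assms(1) this IH(1)] have "weyl G q (qmult G q (path_weight G q (phi i)) (foldr (\<lambda>i acc. qmult G q (path_weight G q (phi i)) acc) xs one_LG)) (\<lambda>w. hsum (ind ?A) w + hsum (ind ?B) w) 0"
      using Lam_disjoint[OF bA IH(2) disj] by simp
    then show ?case unfolding u hsum_add using balanced_add[OF bA IH(2)] by simp
  qed
  from this[of "sorted_list_of_set I"] \<open>finite I\<close>
  show "weyl G q (flow_weight G q I phi) (hsum (ind (flow_edges I phi))) 0" "balanced (ind (flow_edges I phi))"
    by (simp_all add: flow_weight_def flow_edges_def)
qed

end

section \<open>Noncrossing matchings and arcs\<close>

definition upper :: "('e \<Rightarrow> real) \<Rightarrow> 'e \<Rightarrow> 'e \<Rightarrow> 'e" where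
  "upper key p q = (if key p < key q then q else p)"

lemma upper_commute:
  assumes "key p \<noteq> key q" shows "upper key p q = upper key q p"
  using assms by (auto simp: upper_def)

text \<open>The last clause is vacuous unless \<open>p\<close> is the lower end of its arc, so it is
  the usual noncrossing condition with every arc read from below.\<close>

definition nc_matching :: "('e \<Rightarrow> real) \<Rightarrow> ('e \<Rightarrow> int) \<Rightarrow> 'e set \<Rightarrow> ('e \<Rightarrow> 'e) \<Rightarrow> bool" where
  "nc_matching key sg C \<mu> \<longleftrightarrow> inj_on key C \<and>
     (\<forall>p\<in>C. \<mu> p \<in> C \<and> \<mu> (\<mu> p) = p \<and> \<mu> p \<noteq> p \<and> sg (\<mu> p) = - sg p) \<and>
     (\<forall>p\<in>C. \<forall>q\<in>C. key p < key q \<and> key q < key (\<mu> p) \<longrightarrow> key p < key (\<mu> q) \<and> key (\<mu> q) < key (\<mu> p))"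

text \<open>The new ends are placed either side by side or around all present ones. In neither case
  does an old arc have exactly one end inside the new arc. The second alternative serves the
  sources.\<close>

lemma nc_matching_create:
  assumes M: "nc_matching key sg C \<mu>" and pq: "p \<notin> C" "q \<notin> C" "key p < key q" "sg q = - sg p"
    and sep: "\<And>r. r \<in> C \<Longrightarrow> key r \<noteq> key p \<and> key r \<noteq> key q"
    and nest: "(\<forall>r\<in>C. \<not> (key p < key r \<and> key r < key q)) \<or> (\<forall>r\<in>C. key p < key r \<and> key r < key q)"
  shows "nc_matching key sg (insert p (insert q C)) (\<mu>(p := q, q := p))"
proof -
  have ne: "p \<noteq> q" using pq by auto
  have inj: "inj_on key (insert p (insert q C))"
    using M sep pq by (auto simp: nc_matching_def inj_on_def) (metis sep)+
  have inv: "\<And>r. r \<in> C \<Longrightarrow> \<mu> r \<in> C \<and> \<mu> (\<mu> r) = r \<and> \<mu> r \<noteq> r \<and> sg (\<mu> r) = - sg r"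
    using M by (auto simp: nc_matching_def)
  have nc: "\<And>a b. a \<in> C \<Longrightarrow> b \<in> C \<Longrightarrow> key a < key b \<Longrightarrow> key b < key (\<mu> a) \<Longrightarrow> key a < key (\<mu> b) \<and> key (\<mu> b) < key (\<mu> a)"
    using M unfolding nc_matching_def by blast
  let ?m = "\<mu>(p := q, q := p)"
  have old: "\<And>r. r \<in> C \<Longrightarrow> ?m r = \<mu> r" using pq by auto
  have new: "?m p = q" "?m q = p" using ne by auto
  have "\<forall>a\<in>insert p (insert q C). \<forall>b\<in>insert p (insert q C). key a < key b \<and> key b < key (?m a) \<longrightarrow> key a < key (?m b) \<and> key (?m b) < key (?m a)"
  proof (intro ballI impI)
    fix a b assume a: "a \<in> insert p (insert q C)" and b: "b \<in> insert p (insert q C)"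
      and k: "key a < key b \<and> key b < key (?m a)"
    consider "a = p" "b \<in> C" | "a \<in> C" "b = p" | "a \<in> C" "b = q" | "a \<in> C" "b \<in> C"
      using a b k new pq by fastforce
    then show "key a < key (?m b) \<and> key (?m b) < key (?m a)"
    proof cases
      case 1
      then show ?thesis using k new nest old inv by auto
    next
      case 2
      then show ?thesis using k new nest old[of a] inv[of a] sep[of a] sep[of "\<mu> a"] pq by force
    next
      case 3
      then show ?thesis using k new nest old[of a] inv[of a] sep[of a] sep[of "\<mu> a"] pq by force
    next
      case 4
      then show ?thesis using k nc old by auto
    qed
  qed
  moreover have "\<forall>r\<in>insert p (insert q C). ?m r \<in> insert p (insert q C) \<and> ?m (?m r) = r \<and> ?m r \<noteq> r \<and> sg (?m r) = - sg r"
    using inv old new ne pq by (smt (verit, best) insert_iff)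
  ultimately show ?thesis using inj unfolding nc_matching_def by blast
qed

text \<open>As \<open>q\<close> takes the place of \<open>p\<close> in the order, the renaming
  \<open>h\<close> is an order isomorphism compatible with the two matchings, and all clauses are
  transported along it.\<close>

lemma nc_matching_replace:
  assumes M: "nc_matching key sg C \<mu>" and pq: "p \<in> C" "q \<notin> C" "sg q = sg p"
    and sep: "\<And>r. r \<in> C \<Longrightarrow> r \<noteq> p \<Longrightarrow> key r \<noteq> key q \<and> (key r < key p \<longleftrightarrow> key r < key q)"
  shows "nc_matching key sg (insert q (C - {p})) (\<mu>(q := \<mu> p, \<mu> p := q))"
    "sg (upper key q (\<mu> p)) = sg (upper key p (\<mu> p))"
proof -
  have injC: "inj_on key C" using M by (auto simp: nc_matching_def)
  have inv: "\<And>r. r \<in> C \<Longrightarrow> \<mu> r \<in> C \<and> \<mu> (\<mu> r) = r \<and> \<mu> r \<noteq> r \<and> sg (\<mu> r) = - sg r"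
    using M by (auto simp: nc_matching_def)
  have nc: "\<And>a b. a \<in> C \<Longrightarrow> b \<in> C \<Longrightarrow> key a < key b \<Longrightarrow> key b < key (\<mu> a) \<Longrightarrow> key a < key (\<mu> b) \<and> key (\<mu> b) < key (\<mu> a)"
    using M unfolding nc_matching_def by blast
  show "sg (upper key q (\<mu> p)) = sg (upper key p (\<mu> p))"
    using sep[of "\<mu> p"] inv[OF pq(1)] pq inj_onD[OF injC, of p "\<mu> p"] by (auto simp: upper_def)
  let ?m = "\<mu>(q := \<mu> p, \<mu> p := q)" and ?C = "insert q (C - {p})"
  define h where "h = (\<lambda>r. if r = q then p else r)"
  have mp: "\<mu> p \<noteq> q" "\<mu> p \<noteq> p" "\<mu> p \<in> C" using inv pq by auto
  have hC: "\<And>r. r \<in> ?C \<Longrightarrow> h r \<in> C" using pq by (auto simp: h_def)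
  have hm: "\<And>r. r \<in> ?C \<Longrightarrow> h (?m r) = \<mu> (h r)" using pq mp inv by (auto simp: h_def)
  have mC: "?m r \<in> ?C" if r: "r \<in> ?C" for r
  proof (cases "r = q \<or> r = \<mu> p")
    case True
    then show ?thesis using mp by auto
  next
    case False
    then have "\<mu> r \<in> C" "\<mu> r \<noteq> p" using inv[of r] r by auto
    then show ?thesis using False by auto
  qed
  have hk: "key r < key r' \<longleftrightarrow> key (h r) < key (h r')" if "r \<in> ?C" "r' \<in> ?C" for r r'
  proof -
    have a: "key q < key x \<longleftrightarrow> key p < key x" "key x < key q \<longleftrightarrow> key x < key p" if "x \<in> C" "x \<noteq> p" for x
      using sep[of x] inj_onD[OF injC, of x p] that pq by (metis linorder_neqE not_less_iff_gr_or_eq)+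
    show ?thesis using that a[of r] a[of r'] pq by (auto simp: h_def)
  qed
  have hi: "inj_on h ?C" using pq by (auto simp: h_def inj_on_def)
  have "inj_on key ?C"
    using injC sep by (auto simp: inj_on_insert intro: inj_on_subset) metis
  moreover have "\<forall>r\<in>?C. ?m r \<in> ?C \<and> ?m (?m r) = r \<and> ?m r \<noteq> r \<and> sg (?m r) = - sg r"
  proof
    fix r assume r: "r \<in> ?C"
    have "h (?m (?m r)) = h r" using r hm mC hC inv by metis
    then have "?m (?m r) = r" using hi r mC by (meson inj_onD)
    moreover have "?m r \<noteq> r" using hm[OF r] hC[OF r] inv by metis
    moreover have "\<And>x. sg (h x) = sg x" using pq by (auto simp: h_def)
    then have "sg (?m r) = - sg r" using hm[OF r] hC[OF r] inv by metis
    ultimately show "?m r \<in> ?C \<and> ?m (?m r) = r \<and> ?m r \<noteq> r \<and> sg (?m r) = - sg r" using mC[OF r] by blast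
  qed
  moreover have "\<forall>a\<in>?C. \<forall>b\<in>?C. key a < key b \<and> key b < key (?m a) \<longrightarrow> key a < key (?m b) \<and> key (?m b) < key (?m a)"
  proof (intro ballI impI)
    fix a b assume a: "a \<in> ?C" and b: "b \<in> ?C" and k: "key a < key b \<and> key b < key (?m a)"
    have "key (h a) < key (h b)" "key (h b) < key (\<mu> (h a))"
      using k hk[OF a b] hk[OF b mC[OF a]] hm[OF a] by auto
    then have "key (h a) < key (\<mu> (h b)) \<and> key (\<mu> (h b)) < key (\<mu> (h a))"
      using nc hC a b by blast
    then show "key a < key (?m b) \<and> key (?m b) < key (?m a)"
      using hk[OF a mC[OF b]] hk[OF mC[OF b] mC[OF a]] hm[OF a] hm[OF b] by auto
  qed
  ultimately show "nc_matching key sg ?C ?m" unfolding nc_matching_def by blast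
qed

lemma nc_matching_close:
  assumes M: "nc_matching key sg C \<mu>" and "p \<in> C" "\<mu> p = q"
  shows "nc_matching key sg (C - {p, q}) \<mu>"
proof -
  have "\<And>r. r \<in> C \<Longrightarrow> \<mu> r \<in> C \<and> \<mu> (\<mu> r) = r"
    using M by (auto simp: nc_matching_def)
  then have "\<forall>r\<in>C - {p, q}. \<mu> r \<in> C - {p, q}" using assms by (metis Diff_iff insert_iff singletonD)
  then show ?thesis using M unfolding nc_matching_def by (auto intro: inj_on_subset)
qed

text \<open>Noncrossing leaves three positions for the partners p', q' of the adjacent ends p below
  q: both above with q' below p', both below with q' below p', or p' below and q' above. With p'
  above and q' below the arcs would cross. Since partners have opposite signs, the sign identity
  holds in each of the three; it is the step of the Umlaufsatz in which two arcs merge and a turn is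
  added.\<close>

lemma nc_matching_join:
  assumes M: "nc_matching key sg C \<mu>" and pq: "p \<in> C" "q \<in> C" "key p < key q" "sg q = - sg p" "\<mu> p \<noteq> q"
    and sep: "\<And>r. r \<in> C \<Longrightarrow> \<not> (key p < key r \<and> key r < key q)"
  shows "nc_matching key sg (C - {p, q}) (\<mu>(\<mu> p := \<mu> q, \<mu> q := \<mu> p))"
    "sg (upper key p (\<mu> p)) + sg (upper key q (\<mu> q)) + sg q = sg (upper key (\<mu> p) (\<mu> q))"
proof -
  have injC: "inj_on key C" using M by (auto simp: nc_matching_def)
  have inv: "\<And>r. r \<in> C \<Longrightarrow> \<mu> r \<in> C \<and> \<mu> (\<mu> r) = r \<and> \<mu> r \<noteq> r \<and> sg (\<mu> r) = - sg r"
    using M by (auto simp: nc_matching_def)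
  have nc: "\<And>a b. a \<in> C \<Longrightarrow> b \<in> C \<Longrightarrow> key a < key b \<Longrightarrow> key b < key (\<mu> a) \<Longrightarrow> key a < key (\<mu> b) \<and> key (\<mu> b) < key (\<mu> a)"
    using M unfolding nc_matching_def by blast
  define p' q' where "p' = \<mu> p" and "q' = \<mu> q"
  have p': "p' \<in> C" "\<mu> p' = p" "p' \<noteq> p" "p' \<noteq> q" "sg p' = - sg p" using inv pq by (auto simp: p'_def)
  have q': "q' \<in> C" "\<mu> q' = q" "q' \<noteq> q" "q' \<noteq> p" "sg q' = - sg q" using inv pq by (auto simp: q'_def)
  have pq': "p' \<noteq> q'" using p' q' pq by auto
  have sep': "r = p \<or> r = q \<or> key r < key p \<or> key q < key r" if "r \<in> C" for r
    using sep[OF that] that pq inj_onD[OF injC, of r p] inj_onD[OF injC, of r q] by fastforce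
  have neq: "key a \<noteq> key b" if "a \<in> C" "b \<in> C" "a \<noteq> b" for a b using that injC by (auto dest: inj_onD)
  have ncp: "key p < key p' \<Longrightarrow> key q < key p' \<Longrightarrow> key q' < key p' \<and> key p < key q'"
       "key q' < key p \<Longrightarrow> key q' < key p' \<and> key p' < key q"
    using nc[of p q] nc[of q' p] pq p' q' by (auto simp: p'_def[symmetric] q'_def[symmetric])
  have mm: "\<mu> p = p'" "\<mu> q = q'" by (auto simp: p'_def q'_def)
  show "sg (upper key p (\<mu> p)) + sg (upper key q (\<mu> q)) + sg q = sg (upper key (\<mu> p) (\<mu> q))"
    unfolding mm upper_def
    using sep'[OF p'(1)] sep'[OF q'(1)] ncp p' q' pq by (auto split: if_splits)
  let ?m = "\<mu>(p' := q', q' := p')" and ?C = "C - {p, q}"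
  have old: "\<And>r. r \<in> ?C \<Longrightarrow> r \<noteq> p' \<Longrightarrow> r \<noteq> q' \<Longrightarrow> ?m r = \<mu> r \<and> \<mu> r \<in> ?C \<and> \<mu> r \<noteq> p' \<and> \<mu> r \<noteq> q'"
    using inv mm p' q' pq by (metis Diff_iff fun_upd_apply insert_iff singletonD)
  have new: "?m p' = q'" "?m q' = p'" using pq' by auto
  have "inj_on key ?C" using injC by (auto intro: inj_on_subset)
  moreover have "\<forall>r\<in>?C. ?m r \<in> ?C \<and> ?m (?m r) = r \<and> ?m r \<noteq> r \<and> sg (?m r) = - sg r"
  proof
    fix r assume r: "r \<in> ?C"
    show "?m r \<in> ?C \<and> ?m (?m r) = r \<and> ?m r \<noteq> r \<and> sg (?m r) = - sg r"
    proof (cases "r = p' \<or> r = q'")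
      case True
      then show ?thesis using new pq' p' q' pq by auto
    next
      case False
      then show ?thesis using old[OF r] inv[of r] r by auto
    qed
  qed
  moreover have "\<forall>a\<in>?C. \<forall>b\<in>?C. key a < key b \<and> key b < key (?m a) \<longrightarrow> key a < key (?m b) \<and> key (?m b) < key (?m a)"
  proof (intro ballI impI)
    fix a b assume a: "a \<in> ?C" and b: "b \<in> ?C" and k: "key a < key b \<and> key b < key (?m a)"
    have aC: "a \<in> C" "a \<noteq> p" "a \<noteq> q" and bC: "b \<in> C" "b \<noteq> p" "b \<noteq> q" using a b by auto
    have ab: "a \<noteq> b" using k by auto
    have spa: "key a < key p \<or> key q < key a" using sep' aC by blast
    have spb: "key b < key p \<or> key q < key b" using sep' bC by blast
    \<comment> \<open>Only the arc from \<open>p'\<close> to \<open>q'\<close> is new. It is the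
      outer arc in the first two cases; in the next two, one of its ends lies inside an old
      arc.\<close>
    consider "a = p'" | "a = q'" | "a \<noteq> p'" "a \<noteq> q'" "b = p'" | "a \<noteq> p'" "a \<noteq> q'" "b = q'" | "a \<noteq> p'" "a \<noteq> q'" "b \<noteq> p'" "b \<noteq> q'" by blast
    then show "key a < key (?m b) \<and> key (?m b) < key (?m a)"
    proof cases
      case 1
      then have b': "b \<noteq> p'" "b \<noteq> q'" using k new by auto
      note ob = old[OF b b']
      have mb: "\<mu> b \<in> C" "\<mu> (\<mu> b) = b" using inv bC by auto
      have "key p' < key b" "key b < key q'" using k 1 new by auto
      have pos: "key p' < key p" "key q < key q'"
        using \<open>key p' < key b\<close> \<open>key b < key q'\<close> sep'[OF p'(1)] sep'[OF q'(1)] ncp p' q' pq by fastforce+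
      have "key p' < key (\<mu> b) \<and> key (\<mu> b) < key q'"
        using spb nc[of p' b] nc[of q b] pos \<open>key p' < key b\<close> \<open>key b < key q'\<close> p' q' pq mm bC by auto
      then show ?thesis using 1 new ob by auto
    next
      case 2
      then have b': "b \<noteq> p'" "b \<noteq> q'" using k new by auto
      note ob = old[OF b b']
      have mb: "\<mu> b \<in> C" "\<mu> (\<mu> b) = b" using inv bC by auto
      have "key q' < key b" "key b < key p'" using k 2 new by auto
      have ne2: "key (\<mu> b) \<noteq> key p'" "key (\<mu> b) \<noteq> key q'" using ob neq mb p' q' by auto
      have "key q < key q' \<or> key p' < key p"
        using \<open>key q' < key b\<close> \<open>key b < key p'\<close> sep'[OF p'(1)] sep'[OF q'(1)] ncp p' q' pq by fastforce
      then have "key q' < key (\<mu> b) \<and> key (\<mu> b) < key p'"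
      proof
        assume pos: "key q < key q'"
        then have 1: "key p < key (\<mu> b) \<and> key (\<mu> b) < key p'"
          using nc[of p b] \<open>key q' < key b\<close> \<open>key b < key p'\<close> pq p' mm bC by auto
        then have "key q < key (\<mu> b)" using sep'[OF mb(1)] ob by auto
        then show ?thesis using nc[of q "\<mu> b"] \<open>key q' < key b\<close> ne2 1 mb mm pq by (auto simp: neq_iff)
      next
        assume pos: "key p' < key p"
        then have 1: "key q' < key (\<mu> b) \<and> key (\<mu> b) < key q"
          using nc[of q' b] \<open>key q' < key b\<close> \<open>key b < key p'\<close> pq q' mm bC by auto
        then have "key (\<mu> b) < key p" using sep'[OF mb(1)] ob by auto
        then show ?thesis using nc[of p' "\<mu> b"] \<open>key b < key p'\<close> ne2 1 mb p' by (auto simp: neq_iff)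
      qed
      then show ?thesis using 2 new ob by auto
    next
      case 3
      note oa = old[OF a 3(1,2)]
      have ma: "\<mu> a \<in> C" "\<mu> (\<mu> a) = a" using inv aC by auto
      have "key a < key p'" "key p' < key (\<mu> a)" using k 3 oa by auto
      \<comment> \<open>An old arc around \<open>p'\<close> contains \<open>p\<close>, then by
        adjacency \<open>q\<close>, and then \<open>q'\<close>.\<close>
      then have "key a < key p \<and> key p < key (\<mu> a)" using nc[of a p'] p' aC by auto
      then have "key a < key q \<and> key q < key (\<mu> a)" using spa sep'[OF ma(1)] pq oa by auto
      then have "key a < key q' \<and> key q' < key (\<mu> a)" using nc[of a q] pq mm aC by auto
      then show ?thesis using 3 new oa by auto
    next
      case 4
      note oa = old[OF a 4(1,2)]
      have ma: "\<mu> a \<in> C" "\<mu> (\<mu> a) = a" using inv aC by auto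
      have "key a < key q'" "key q' < key (\<mu> a)" using k 4 oa by auto
      then have "key a < key q \<and> key q < key (\<mu> a)" using nc[of a q'] q' aC by auto
      then have "key a < key p \<and> key p < key (\<mu> a)" using spa sep'[OF ma(1)] pq oa by auto
      then have "key a < key p' \<and> key p' < key (\<mu> a)" using nc[of a p] pq mm aC by auto
      then show ?thesis using 4 new oa by auto
    next
      case 5
      then show ?thesis using nc[OF aC(1) bC(1)] k old[OF a 5(1,2)] old[OF b 5(3,4)] by auto
    qed
  qed
  ultimately show "nc_matching key sg ?C (\<mu>(\<mu> p := \<mu> q, \<mu> q := \<mu> p))" unfolding nc_matching_def mm by blast
qed


section \<open>Arcs carrying edge sets and weights\<close>

locale arc_sweep =
  fixes E :: "'e set" and nd :: "'e \<Rightarrow> 'n set" and key :: "'e \<Rightarrow> real"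
    and sg en wt :: "'e \<Rightarrow> int" and R :: "('e \<times> 'e) set"
  assumes sym_R: "sym R" and trans_R: "trans R"
begin

text \<open>C is the set of open ends, D the set of edges met so far, N the set of nodes already passed,
  and P p the edge set of the arc with ends p and its partner.\<close>
definition arc_ok :: "'e set \<Rightarrow> 'e set \<Rightarrow> 'n set \<Rightarrow> ('e \<Rightarrow> 'e) \<Rightarrow> ('e \<Rightarrow> 'e set) \<Rightarrow> 'e \<Rightarrow> bool" where
  "arc_ok C D N \<mu> P p \<longleftrightarrow>
     p \<in> P p \<and> finite (P p) \<and> P p \<subseteq> D \<and> P (\<mu> p) = P p \<and>
     (\<forall>q\<in>C. q \<noteq> p \<longrightarrow> q \<noteq> \<mu> p \<longrightarrow> P p \<inter> P q = {}) \<and>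
     (\<forall>e\<in>P p. \<forall>e'\<in>E. \<forall>n\<in>N. n \<in> nd e \<longrightarrow> n \<in> nd e' \<longrightarrow> e' \<in> P p) \<and>
     P p \<times> P p \<subseteq> R \<and>
     sum wt (P p) = 2 * sg (upper key p (\<mu> p)) + en p + en (\<mu> p)"

lemma arc_okI:
  assumes "p \<in> P p" "finite (P p)" "P p \<subseteq> D" "P (\<mu> p) = P p"
    and "\<And>q. q \<in> C \<Longrightarrow> q \<noteq> p \<Longrightarrow> q \<noteq> \<mu> p \<Longrightarrow> P p \<inter> P q = {}"
    and "\<And>e e' n. e \<in> P p \<Longrightarrow> e' \<in> E \<Longrightarrow> n \<in> nd e \<Longrightarrow> n \<in> nd e' \<Longrightarrow> n \<in> N \<Longrightarrow> e' \<in> P p"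
    and "P p \<times> P p \<subseteq> R"
    and "sum wt (P p) = 2 * sg (upper key p (\<mu> p)) + en p + en (\<mu> p)"
  shows "arc_ok C D N \<mu> P p"
  unfolding arc_ok_def using assms by simp

definition arcs :: "'e set \<Rightarrow> 'e set \<Rightarrow> 'n set \<Rightarrow> ('e \<Rightarrow> 'e) \<Rightarrow> ('e \<Rightarrow> 'e set) \<Rightarrow> bool" where
  "arcs C D N \<mu> P \<longleftrightarrow> nc_matching key sg C \<mu> \<and> (\<forall>p\<in>C. arc_ok C D N \<mu> P p)"

lemma arcsD:
  assumes "arcs C D N \<mu> P" "p \<in> C"
  shows "\<mu> p \<in> C" "\<mu> (\<mu> p) = p" "\<mu> p \<noteq> p" "sg (\<mu> p) = - sg p"
    "p \<in> P p" "finite (P p)" "P p \<subseteq> D" "P (\<mu> p) = P p"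
    "\<And>q. q \<in> C \<Longrightarrow> q \<noteq> p \<Longrightarrow> q \<noteq> \<mu> p \<Longrightarrow> P p \<inter> P q = {}"
    "\<And>e e' n. e \<in> P p \<Longrightarrow> e' \<in> E \<Longrightarrow> n \<in> nd e \<Longrightarrow> n \<in> nd e' \<Longrightarrow> n \<in> N \<Longrightarrow> e' \<in> P p"
    "\<And>e e'. e \<in> P p \<Longrightarrow> e' \<in> P p \<Longrightarrow> (e, e') \<in> R"
    "sum wt (P p) = 2 * sg (upper key p (\<mu> p)) + en p + en (\<mu> p)"
    "key p \<noteq> key (\<mu> p)" "P p \<times> P p \<subseteq> R"
proof -
  have M: "nc_matching key sg C \<mu>" and ok: "arc_ok C D N \<mu> P p"
    using assms unfolding arcs_def by blast+
  show "\<mu> p \<in> C" "\<mu> (\<mu> p) = p" "\<mu> p \<noteq> p" "sg (\<mu> p) = - sg p" "key p \<noteq> key (\<mu> p)"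
    using M assms(2) unfolding nc_matching_def inj_on_def by metis+
  show "p \<in> P p" "finite (P p)" "P p \<subseteq> D" "P (\<mu> p) = P p"
    "\<And>q. q \<in> C \<Longrightarrow> q \<noteq> p \<Longrightarrow> q \<noteq> \<mu> p \<Longrightarrow> P p \<inter> P q = {}"
    "\<And>e e' n. e \<in> P p \<Longrightarrow> e' \<in> E \<Longrightarrow> n \<in> nd e \<Longrightarrow> n \<in> nd e' \<Longrightarrow> n \<in> N \<Longrightarrow> e' \<in> P p"
    "\<And>e e'. e \<in> P p \<Longrightarrow> e' \<in> P p \<Longrightarrow> (e, e') \<in> R"
    "sum wt (P p) = 2 * sg (upper key p (\<mu> p)) + en p + en (\<mu> p)"
    "P p \<times> P p \<subseteq> R"
    using ok unfolding arc_ok_def by blast+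
qed

lemma arcs_empty: "arcs {} {} {} \<mu> P"
  by (simp add: arcs_def nc_matching_def)

lemma arcs_skip:
  assumes A: "arcs C D N \<mu> P" and n: "\<And>e. e \<in> E \<Longrightarrow> n \<notin> nd e"
  shows "arcs C D (insert n N) \<mu> P"
  using A n unfolding arcs_def arc_ok_def by simp

text \<open>The new arc consists of the two edges alone; the assumption on \<open>wt\<close> is the
  weight equation of the invariant, with \<open>q\<close> as the upper end.\<close>

lemma arcs_create:
  assumes A: "arcs C D N \<mu> P" and "D \<subseteq> E" and pq: "p \<in> E - D" "q \<in> E - D" "C \<subseteq> D"
    and key: "key p < key q" "\<And>r. r \<in> C \<Longrightarrow> key r \<noteq> key p \<and> key r \<noteq> key q"
    and nest: "(\<forall>r\<in>C. \<not> (key p < key r \<and> key r < key q)) \<or> (\<forall>r\<in>C. key p < key r \<and> key r < key q)"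
    and n: "{e \<in> E. n \<in> nd e} = {p, q}" and N: "nd p \<inter> N = {}" "nd q \<inter> N = {}"
    and sg: "sg q = - sg p" and wt: "wt p + wt q = 2 * sg q + en p + en q"
    and R: "{p, q} \<times> {p, q} \<subseteq> R"
  shows "arcs (insert p (insert q C)) (insert p (insert q D)) (insert n N)
           (\<mu>(p := q, q := p)) (P(p := {p, q}, q := {p, q}))"
proof -
  note d = arcsD[OF A]
  have ne: "p \<noteq> q" "p \<notin> C" "q \<notin> C" using pq key by auto
  let ?m = "\<mu>(p := q, q := p)" and ?P = "P(p := {p, q}, q := {p, q})" and ?C = "insert p (insert q C)"
  have M: "nc_matching key sg ?C ?m"
    using A nc_matching_create[OF _ ne(2,3) key(1) sg key(2) nest] by (auto simp: arcs_def)
  have new: "?m p = q" "?m q = p" "?P p = {p, q}" "?P q = {p, q}" using ne by auto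
  have old: "?m r = \<mu> r" "?P r = P r" "?P (\<mu> r) = P r" "p \<notin> P r" "q \<notin> P r" "r \<noteq> p" "r \<noteq> q" if "r \<in> C" for r
    using that ne d(1,3,7,8)[OF that] pq by (auto simp: fun_upd_def)
  have cl: "e' \<in> {p, q}" if "e \<in> {p, q}" "e' \<in> E" "m \<in> nd e" "m \<in> nd e'" "m \<in> insert n N" for e e' m
    using that n N by blast
  \<comment> \<open>No edge of an old arc is at the node \<open>n\<close>, so closure at
    \<open>n\<close> adds no demand on it.\<close>
  have cl': "e' \<in> P r" if r: "r \<in> C" "e \<in> P r" "e' \<in> E" "m \<in> nd e" "m \<in> nd e'" "m \<in> insert n N" for r e e' m
  proof -
    have "e \<in> E" "e \<notin> {p, q}" using r d(7)[OF r(1)] \<open>D \<subseteq> E\<close> pq by auto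
    then have "m \<noteq> n" using n r by blast
    then show ?thesis using d(10)[OF r(1) r(2,3,4,5)] r(6) by auto
  qed
  have ups: "upper key p q = q" "upper key q p = q" using key by (auto simp: upper_def)
  have "arc_ok ?C (insert p (insert q D)) (insert n N) ?m ?P r" if r: "r \<in> ?C" for r
  proof (cases "r \<in> C")
    case True
    have disj: "P r \<inter> ?P r' = {}" if "r' \<in> ?C" "r' \<noteq> r" "r' \<noteq> \<mu> r" for r'
      using that old[OF True] new d(9)[OF True] old(2) by auto
    show ?thesis
      by (intro arc_okI; unfold old(1,2,3)[OF True]) (rule d(5,6,12,14)[OF True] subset_trans[OF d(7)[OF True]] disj cl'[OF True] refl subset_insertI subset_refl subset_insertI2; assumption?)+
  next
    case False
    then have r': "r \<in> {p, q}" using r by auto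
    then have Pr: "?P r = {p, q}" "?m r \<in> {p, q}" "?P (?m r) = {p, q}" using ne by auto
    have disj: "{p, q} \<inter> ?P r' = {}" if "r' \<in> ?C" "r' \<noteq> r" "r' \<noteq> ?m r" for r'
      using that r' old(4,5,2) ne by auto
    have wts: "sum wt {p, q} = 2 * sg (upper key r (?m r)) + en r + en (?m r)"
    proof -
      have "r = p \<and> ?m r = q \<or> r = q \<and> ?m r = p" using r' new by auto
      then show ?thesis using ups wt ne(1) by (elim disjE conjE) (simp only:, simp)+
    qed
    have sub: "{p, q} \<subseteq> insert p (insert q D)" and fin: "finite {p, q}" by auto
    show ?thesis
      by (intro arc_okI; unfold Pr(1,3)) (rule r' fin sub disj R wts cl refl; assumption)+
  qed
  then show ?thesis using M unfolding arcs_def by blast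
qed

text \<open>Prolongation trades the end term of \<open>p\<close> for that of \<open>q\<close>. The
  upper end keeps its sign, so the weight of \<open>q\<close> has to be exactly the
  difference.\<close>

lemma arcs_replace:
  assumes A: "arcs C D N \<mu> P" and "D \<subseteq> E" and pq: "p \<in> C" "q \<in> E - D" "C \<subseteq> D"
    and key: "\<And>r. r \<in> C \<Longrightarrow> r \<noteq> p \<Longrightarrow> key r \<noteq> key q \<and> (key r < key p \<longleftrightarrow> key r < key q)"
    and n: "{e \<in> E. n \<in> nd e} = {p, q}" and N: "nd q \<inter> N = {}"
    and sg: "sg q = sg p" and wt: "wt q = en q - en p"
    and R: "{p, q} \<times> {p, q} \<subseteq> R"
  shows "\<exists>\<mu>' P'. arcs (insert q (C - {p})) (insert q D) (insert n N) \<mu>' P'"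
proof -
  note d = arcsD[OF A]
  have ne: "p \<noteq> q" "q \<notin> C" "\<mu> p \<noteq> q" using pq d(1) by auto
  have mp: "\<mu> p \<in> C" "\<mu> p \<noteq> p" using d pq by auto
  let ?m = "\<mu>(q := \<mu> p, \<mu> p := q)" and ?Q = "insert q (P p)" and ?C = "insert q (C - {p})"
  let ?P = "P(q := ?Q, \<mu> p := ?Q)"
  have M: "nc_matching key sg ?C ?m" and up: "sg (upper key q (\<mu> p)) = sg (upper key p (\<mu> p))"
    using A nc_matching_replace[OF _ pq(1) ne(2) sg key] by (auto simp: arcs_def)
  have new: "?m q = \<mu> p" "?m (\<mu> p) = q" "?P q = ?Q" "?P (\<mu> p) = ?Q" using ne by auto
  have old: "?m r = \<mu> r" "?P r = P r" "?P (\<mu> r) = P r" "q \<notin> P r" "P r \<inter> P p = {}"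
     if "r \<in> C" "r \<noteq> p" "r \<noteq> \<mu> p" for r
  proof -
    have "p \<noteq> \<mu> r" "\<mu> r \<noteq> \<mu> p" using d(2)[OF that(1)] d(2)[OF pq(1)] that by metis+
    then show "?m r = \<mu> r" "?P r = P r" "?P (\<mu> r) = P r" "q \<notin> P r" "P r \<inter> P p = {}"
      using that ne d(1)[OF that(1)] d(7,8)[OF that(1)] d(9)[OF that(1) pq(1)] pq by auto
  qed
  have qP: "q \<notin> P p" using d(7)[OF pq(1)] pq by auto
  have cl: "e' \<in> ?Q" if "e \<in> ?Q" "e' \<in> E" "m \<in> nd e" "m \<in> nd e'" "m \<in> insert n N" for e e' m
  proof (cases "m = n")
    case True
    then have "e' \<in> {p, q}" using n that by blast
    then show ?thesis using d(5)[OF pq(1)] by auto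
  next
    case False
    then have "e \<in> P p" "m \<in> N" using that N by auto
    then show ?thesis using d(10)[OF pq(1)] that by blast
  qed
  have cl': "e' \<in> P r" if r: "r \<in> C" "r \<noteq> p" "r \<noteq> \<mu> p" "e \<in> P r" "e' \<in> E" "m \<in> nd e" "m \<in> nd e'" "m \<in> insert n N" for r e e' m
  proof -
    have "e \<in> E" "e \<notin> {p, q}" using r d(7)[OF r(1)] \<open>D \<subseteq> E\<close> old(4,5)[OF r(1,2,3)] d(5)[OF pq(1)] by auto
    then have "m \<noteq> n" using n r by blast
    then show ?thesis using d(10)[OF r(1) r(4,5,6,7)] r(8) by auto
  qed
  have conn: "?Q \<times> ?Q \<subseteq> R"
  proof -
    have "(e, p) \<in> R" "(p, e) \<in> R" if "e \<in> ?Q" for e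
      using that R d(11)[OF pq(1)] d(5)[OF pq(1)] by auto
    then show ?thesis using trans_R by (auto elim: transE)
  qed
  have "arc_ok ?C (insert q D) (insert n N) ?m ?P r" if r: "r \<in> ?C" for r
  proof (cases "r = q \<or> r = \<mu> p")
    case False
    then have T: "r \<in> C" "r \<noteq> p" "r \<noteq> \<mu> p" using r by auto
    have disj: "P r \<inter> ?P r' = {}" if "r' \<in> ?C" "r' \<noteq> r" "r' \<noteq> \<mu> r" for r'
      using that old(4,5)[OF T] d(9)[OF T(1)] old(2) by auto
    show ?thesis
      by (intro arc_okI; unfold old(1,2,3)[OF T]) (rule d(5,6,12,14)[OF T(1)] subset_trans[OF d(7)[OF T(1)]] disj cl'[OF T] refl subset_insertI subset_refl subset_insertI2; assumption?)+
  next
    case True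
    then have Pr: "?P r = ?Q" "?m r \<in> {q, \<mu> p}" "?P (?m r) = ?Q" using ne by auto
    have disj: "?Q \<inter> ?P r' = {}" if "r' \<in> ?C" "r' \<noteq> r" "r' \<noteq> ?m r" for r'
      using that True old(4,5,2) ne by auto
    have wts: "sum wt ?Q = 2 * sg (upper key r (?m r)) + en r + en (?m r)"
    proof -
      have "sum wt ?Q = 2 * sg (upper key q (\<mu> p)) + en q + en (\<mu> p)"
        using d(6,12)[OF pq(1)] qP wt up by simp
      moreover have "upper key q (\<mu> p) = upper key (\<mu> p) q" using key mp by (intro upper_commute) metis
      ultimately show ?thesis using True new by auto
    qed
    have mem: "r \<in> ?Q" using True d(5,8)[OF pq(1)] d(5)[OF mp(1)] by auto
    have fin: "finite ?Q" and sub: "?Q \<subseteq> insert q D" using d(6,7)[OF pq(1)] by auto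
    show ?thesis
      by (intro arc_okI; unfold Pr(1,3)) (rule mem fin sub disj conn wts cl refl; assumption)+
  qed
  then show ?thesis using M unfolding arcs_def by blast
qed

text \<open>If \<open>p\<close> and \<open>q\<close> are the ends of one arc, it closes to a cycle
  and is no longer tracked. Otherwise their end terms turn into \<open>2 * sg q\<close>, which is
  what \<open>nc_matching_join\<close> needs to merge two upper ends into one.\<close>

lemma arcs_join:
  assumes A: "arcs C D N \<mu> P" and "D \<subseteq> E" and pq: "p \<in> C" "q \<in> C"
    and key: "key p < key q" "\<And>r. r \<in> C \<Longrightarrow> \<not> (key p < key r \<and> key r < key q)"
    and n: "{e \<in> E. n \<in> nd e} = {p, q}"
    and sg: "sg q = - sg p" and en: "en p + en q = 2 * sg q"
    and R: "{p, q} \<times> {p, q} \<subseteq> R"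
  shows "\<exists>\<mu>' P'. arcs (C - {p, q}) D (insert n N) \<mu>' P'"
proof -
  note d = arcsD[OF A]
  have M: "nc_matching key sg C \<mu>" using A by (auto simp: arcs_def)
  have cl': "e' \<in> P r" if r: "r \<in> C" "p \<notin> P r" "q \<notin> P r" "e \<in> P r" "e' \<in> E" "m \<in> nd e" "m \<in> nd e'" "m \<in> insert n N" for r e e' m
  proof -
    have "e \<in> E" "e \<notin> {p, q}" using r d(7)[OF r(1)] \<open>D \<subseteq> E\<close> by auto
    then have "m \<noteq> n" using n r by blast
    then show ?thesis using d(10)[OF r(1) r(4,5,6,7)] r(8) by auto
  qed
  show ?thesis
  proof (cases "\<mu> p = q")
    case True
    have "p \<notin> P r" "q \<notin> P r" if "r \<in> C - {p, q}" for r
      using d(9)[OF pq(1), of r] that True d(5,8)[OF pq(1)] d(5)[OF pq(2)] by auto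
    then have "arc_ok (C - {p, q}) D (insert n N) \<mu> P r" if "r \<in> C - {p, q}" for r
    proof -
      have r: "r \<in> C" "p \<notin> P r" "q \<notin> P r" using \<open>\<And>r. r \<in> C - {p, q} \<Longrightarrow> p \<notin> P r\<close> \<open>\<And>r. r \<in> C - {p, q} \<Longrightarrow> q \<notin> P r\<close> that by blast+
      show ?thesis
      proof (rule arc_okI)
        show "P r \<times> P r \<subseteq> R" using d(11)[OF r(1)] by blast
        show "e' \<in> P r" if "e \<in> P r" "e' \<in> E" "m \<in> nd e" "m \<in> nd e'" "m \<in> insert n N" for e e' m
          by (rule cl'[OF r that])
      qed (use d(5-9)[OF r(1)] d(12)[OF r(1)] in simp_all)
    qed
    then have "arcs (C - {p, q}) D (insert n N) \<mu> P"
      using nc_matching_close[OF M pq(1) True] unfolding arcs_def by blast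
    then show ?thesis by blast
  next
    case False
    let ?p = "\<mu> p" and ?q = "\<mu> q" and ?Q = "P p \<union> P q"
    have ne: "?p \<noteq> p" "?p \<noteq> q" "?q \<noteq> p" "?q \<noteq> q" "?p \<noteq> ?q" "?p \<in> C" "?q \<in> C" "p \<noteq> q"
      using d(1-3)[OF pq(1)] d(1-3)[OF pq(2)] False key(1) by (metis less_irrefl)+
    let ?m = "\<mu>(?p := ?q, ?q := ?p)" and ?C = "C - {p, q}"
    let ?P = "P(?p := ?Q, ?q := ?Q)"
    have M: "nc_matching key sg ?C ?m"
      and up: "sg (upper key p (\<mu> p)) + sg (upper key q (\<mu> q)) + sg q = sg (upper key (\<mu> p) (\<mu> q))"
      using nc_matching_join[OF M pq key(1) sg False key(2)] by auto
    have new: "?m ?p = ?q" "?m ?q = ?p" "?P ?p = ?Q" "?P ?q = ?Q" using ne by auto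
    have old: "?m r = \<mu> r" "?P r = P r" "?P (\<mu> r) = P r" "P r \<inter> P p = {}" "P r \<inter> P q = {}" "p \<notin> P r" "q \<notin> P r"
       if "r \<in> ?C" "r \<noteq> ?p" "r \<noteq> ?q" for r
    proof -
      have r: "r \<in> C" "r \<noteq> p" "r \<noteq> q" using that by auto
      have "\<mu> r \<noteq> p" "\<mu> r \<noteq> q" "\<mu> r \<noteq> ?p" "\<mu> r \<noteq> ?q" using d(2)[OF r(1)] d(2)[OF pq(1)] d(2)[OF pq(2)] that r by metis+
      then show "?m r = \<mu> r" "?P r = P r" "?P (\<mu> r) = P r" "P r \<inter> P p = {}" "P r \<inter> P q = {}" "p \<notin> P r" "q \<notin> P r"
        using d(8)[OF r(1)] d(9)[OF r(1) pq(1)] d(9)[OF r(1) pq(2)] that r d(5)[OF pq(1)] d(5)[OF pq(2)] by auto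
    qed
    have dj: "P p \<inter> P q = {}" using d(9)[OF pq(1,2)] ne False by auto
    have cl: "e' \<in> ?Q" if "e \<in> ?Q" "e' \<in> E" "m \<in> nd e" "m \<in> nd e'" "m \<in> insert n N" for e e' m
    proof (cases "m = n")
      case True
      then have "e' \<in> {p, q}" using n that by blast
      then show ?thesis using d(5)[OF pq(1)] d(5)[OF pq(2)] by auto
    next
      case False
      then show ?thesis using d(10)[OF pq(1)] d(10)[OF pq(2)] that by blast
    qed
    have conn: "?Q \<times> ?Q \<subseteq> R"
    proof -
      have "(e, p) \<in> R \<and> (p, e) \<in> R" if "e \<in> ?Q" for e
      proof (cases "e \<in> P p")
        case True
        then show ?thesis using d(11)[OF pq(1)] d(5)[OF pq(1)] by auto
      next
        case False
        then have "(e, q) \<in> R" "(q, e) \<in> R" using that d(11)[OF pq(2)] d(5)[OF pq(2)] by auto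
        then show ?thesis using R trans_R by (auto elim: transE)
      qed
      then show ?thesis using trans_R by (meson mem_Sigma_iff subrelI transE)
    qed
    have "arc_ok ?C (D) (insert n N) ?m ?P r" if r: "r \<in> ?C" for r
    proof (cases "r = ?p \<or> r = ?q")
      case False
      then have T: "r \<in> ?C" "r \<noteq> ?p" "r \<noteq> ?q" "r \<in> C" using r by auto
      have disj: "P r \<inter> ?P r' = {}" if "r' \<in> ?C" "r' \<noteq> r" "r' \<noteq> \<mu> r" for r'
        using old(4,5)[OF T(1,2,3)] d(9)[OF T(4), of r'] that by (cases "r' = ?p \<or> r' = ?q") auto
      show ?thesis
        by (intro arc_okI; unfold old(1,2,3)[OF T(1,2,3)]) (rule d(5,6,12,14)[OF T(4)] subset_trans[OF d(7)[OF T(4)]] disj cl'[OF T(4) old(6,7)[OF T(1,2,3)]] refl subset_insertI subset_refl subset_insertI2; assumption?)+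
    next
      case True
      then have Pr: "?P r = ?Q" "?m r \<in> {?p, ?q}" "?P (?m r) = ?Q" using ne by auto
      have disj: "?Q \<inter> ?P r' = {}" if "r' \<in> ?C" "r' \<noteq> r" "r' \<noteq> ?m r" for r'
      proof -
        have "r' \<noteq> ?p" "r' \<noteq> ?q" using True that new by auto
        then show ?thesis using old(2,4,5)[OF that(1)] by auto
      qed
      have wts: "sum wt ?Q = 2 * sg (upper key r (?m r)) + en r + en (?m r)"
      proof -
        have "sum wt ?Q = 2 * sg (upper key ?p ?q) + en ?p + en ?q"
          using d(6,12)[OF pq(1)] d(6,12)[OF pq(2)] dj en up by (simp add: sum.union_disjoint)
        moreover have "upper key ?p ?q = upper key ?q ?p"
          using M ne by (intro upper_commute) (auto simp: nc_matching_def inj_on_def)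
        ultimately show ?thesis using True new by auto
      qed
      have mem: "r \<in> ?Q" using True d(5,8)[OF pq(1)] d(5,8)[OF pq(2)] d(5)[OF ne(6)] d(5)[OF ne(7)] by auto
      have fin: "finite ?Q" and sub: "?Q \<subseteq> D" using d(6,7)[OF pq(1)] d(6,7)[OF pq(2)] by auto
      show ?thesis
        by (intro arc_okI; unfold Pr(1,3)) (rule mem fin sub disj conn wts cl refl; assumption)+
    qed
    then show ?thesis using M unfolding arcs_def by blast
  qed
qed

end

section \<open>Pairs of flows and the sweep\<close>

context se_graph begin

text \<open>What the sweep uses of a flow: the division into numbered paths is forgotten.\<close>

definition edge_flow :: "('v \<times> 'v) set \<Rightarrow> bool" where
  "edge_flow F \<longleftrightarrow> F \<subseteq> E \<and> balanced (ind F) \<and>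
     (\<forall>u v w. (u, v) \<in> F \<and> (u, w) \<in> F \<longrightarrow> v = w) \<and> (\<forall>u v w. (v, u) \<in> F \<and> (w, u) \<in> F \<longrightarrow> v = w)"

lemma edge_flowD:
  assumes "edge_flow F"
  shows "F \<subseteq> E" "balanced (ind F)" "(u, v) \<in> F \<Longrightarrow> (u, w) \<in> F \<Longrightarrow> v = w" "(v, u) \<in> F \<Longrightarrow> (w, u) \<in> F \<Longrightarrow> v = w"
proof -
  have 0: "F \<subseteq> E \<and> balanced (ind F)" and 1: "\<forall>u v w. (u, v) \<in> F \<and> (u, w) \<in> F \<longrightarrow> v = w"
    and 2: "\<forall>u v w. (v, u) \<in> F \<and> (w, u) \<in> F \<longrightarrow> v = w"
    using assms unfolding edge_flow_def by (elim conjE; simp)+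
  show "F \<subseteq> E" "balanced (ind F)" using 0 by simp_all
  show "(u, v) \<in> F \<Longrightarrow> (u, w) \<in> F \<Longrightarrow> v = w" using 1 by metis
  show "(v, u) \<in> F \<Longrightarrow> (w, u) \<in> F \<Longrightarrow> v = w" using 2 by metis
qed

lemma edge_flow_through:
  assumes F: "edge_flow F" and w: "w \<in> inner G"
  shows "(\<exists>u. (u, w) \<in> F) \<longleftrightarrow> (\<exists>u. (w, u) \<in> F)"
proof -
  have fin: "finite F" using edge_flowD(1)[OF F] finite_edges finite_subset by blast
  have cnt: "(\<Sum>e\<in>F. of_bool (P e)) = int (card {e\<in>F. P e})" for P
    using sum.inter_filter[OF fin, of "\<lambda>_. 1 :: int" P] by (simp add: of_bool_def)
  have "0 = (\<Sum>e\<in>E. ind F e * (of_bool (snd e = w) - of_bool (fst e = w)))"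
    using edge_flowD(2)[OF F] w by (simp add: balanced_def)
  also have "\<dots> = (\<Sum>e\<in>F. of_bool (snd e = w) - of_bool (fst e = w))"
    by (rule sum.mono_neutral_cong_right[OF finite_edges edge_flowD(1)[OF F]]) auto
  also have "\<dots> = int (card {e\<in>F. snd e = w}) - int (card {e\<in>F. fst e = w})"
    by (simp only: sum_subtractf cnt)
  finally have "card {e\<in>F. snd e = w} = card {e\<in>F. fst e = w}" by simp
  moreover have "finite {e\<in>F. snd e = w}" "finite {e\<in>F. fst e = w}" using fin by auto
  ultimately have "{e\<in>F. snd e = w} = {} \<longleftrightarrow> {e\<in>F. fst e = w} = {}"
    by (simp only: card_0_eq[symmetric])
  then show ?thesis by auto
qed

lemma hsum_avoid:
  assumes "\<nexists>u. (u, w) \<in> F" "\<nexists>u. (w, u) \<in> F"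
  shows "hsum (ind F) w = 0"
  unfolding hsum_def
proof (rule sum.neutral, rule ballI)
  fix e show "ind F e * h_div e w = 0"
    using assms by (cases e) (auto simp: h_div_def)
qed

text \<open>This is the turn made at \<open>w\<close>: 1 from rightward to downward, -1 from
  downward to rightward, 0 straight on.\<close>

lemma hsum_through:
  assumes F: "edge_flow F" and w: "w \<in> inner G" and e: "(u, w) \<in> F" "(w, v) \<in> F"
  shows "hsum (ind F) w = of_bool (H_edge G (u, w)) - of_bool (H_edge G (w, v))"
proof -
  have ne: "(u, w) \<noteq> (w, v)" "u \<noteq> w" "v \<noteq> w" using edge_flowD(1)[OF F] e edge_neq by auto
  have "hsum (ind F) w = (\<Sum>e\<in>{(u, w), (w, v)}. h_div e w)"
    unfolding hsum_def
  proof (intro sum.mono_neutral_cong_right finite_edges ballI)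
    show "{(u, w), (w, v)} \<subseteq> E" using edge_flowD(1)[OF F] e by auto
    fix e assume "e \<in> E - {(u, w), (w, v)}"
    then show "ind F e * h_div e w = 0"
      using edge_flowD(3)[OF F _ e(2)] edge_flowD(4)[OF F _ e(1)] by (cases e) (auto simp: h_div_def)
  qed (use e in auto)
  also have "\<dots> = of_bool (H_edge G (u, w)) - of_bool (H_edge G (w, v))"
    using ne w by (simp add: h_div_def)
  finally show ?thesis .
qed

lemma flow_edge_flow:
  assumes F: "is_flow G I J phi"
  shows "edge_flow (flow_edges I phi)"
proof -
  note pe = flow_ends[OF F]
  have out: "b = c" if "distinct p" "(a, b) \<in> pedges p" "(a, c) \<in> pedges p" for a b c and p :: "'v list"
    using that
  proof (induction p)
    case (Cons x p)
    then show ?case by (cases p) (auto dest: pedges_verts)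
  qed (simp add: pedges_def)
  have inn: "b = c" if "distinct p" "(b, a) \<in> pedges p" "(c, a) \<in> pedges p" for a b c and p :: "'v list"
    using that
  proof (induction p)
    case (Cons x p)
    then show ?case
    proof (cases p)
      case (Cons z r)
      \<comment> \<open>By distinctness no edge of a path returns to its first vertex.\<close>
      have z: "(t, z) \<notin> pedges (z # r)" for t
      proof (cases r)
        case Nil then show ?thesis by simp
      next
        case (Cons s r')
        have "z \<notin> set r" using \<open>distinct (x # p)\<close> \<open>p = z # r\<close> by auto
        then show ?thesis using pedges_verts[of "(t, z)" r] Cons by auto
      qed
      then show ?thesis using Cons.IH Cons.prems Cons by auto
    qed (simp add: pedges_def)
  qed (simp add: pedges_def)
  have same: "i = i'" if "i \<in> I" "i' \<in> I" "v \<in> set (phi i)" "v \<in> set (phi i')" for i i' v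
    using F that unfolding is_flow_def by blast
  have "flow_edges I phi \<subseteq> E" using pe(1) by (auto simp: flow_edges_def dpath_def)
  moreover have "v = w" if uvw: "(u, v) \<in> flow_edges I phi" "(u, w) \<in> flow_edges I phi" for u v w
  proof -
    obtain i i' where i: "i \<in> I" "(u, v) \<in> pedges (phi i)" "i' \<in> I" "(u, w) \<in> pedges (phi i')"
      using uvw unfolding flow_edges_def by blast
    then have "i = i'" using same pedges_verts by (metis fst_conv)
    then show ?thesis using out[of "phi i"] i pe(1) by (auto simp: dpath_def)
  qed
  moreover have "v = w" if uvw: "(v, u) \<in> flow_edges I phi" "(w, u) \<in> flow_edges I phi" for u v w
  proof -
    obtain i i' where i: "i \<in> I" "(v, u) \<in> pedges (phi i)" "i' \<in> I" "(w, u) \<in> pedges (phi i')"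
      using uvw unfolding flow_edges_def by blast
    then have "i = i'" using same pedges_verts by (metis snd_conv)
    then show ?thesis using inn[of "phi i"] i pe(1) by (auto simp: dpath_def)
  qed
  \<comment> \<open>\<open>weyl_flow\<close> delivers balancedness together with the normalisation;
    its field and parameter are free here, and 1 in the reals is an arbitrary nonzero
    choice.\<close>
  moreover have "balanced (ind (flow_edges I phi))"
    by (rule weyl_flow(2)[of "1::real", OF _ F]) simp
  ultimately show ?thesis unfolding edge_flow_def by (intro conjI allI impI) (assumption | elim conjE)+
qed

lemma flow_source_edge:
  assumes F: "is_flow G I J phi" and i: "i \<in> {1..nsrc G}"
  shows "(\<exists>v. (src G i, v) \<in> flow_edges I phi) \<longleftrightarrow> i \<in> I"
proof
  assume "i \<in> I"
  note pe = flow_ends[OF F \<open>i \<in> I\<close>]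
  then obtain v r where "phi i = src G i # v # r"
    using source_not_sink by (metis dpath_def last_ConsL list.collapse)
  then have "(src G i, v) \<in> pedges (phi i)" by simp
  then show "\<exists>v. (src G i, v) \<in> flow_edges I phi" using \<open>i \<in> I\<close> by (auto simp: flow_edges_def)
next
  assume "\<exists>v. (src G i, v) \<in> flow_edges I phi"
  then obtain v j where j: "j \<in> I" "(src G i, v) \<in> pedges (phi j)" by (auto simp: flow_edges_def)
  note pe = flow_ends[OF F \<open>j \<in> I\<close>]
  have s: "src G i \<in> sources G" using i by (auto simp: sources_def)
  have "src G i \<in> set (phi j)" using pedges_verts[OF j(2)] by simp
  \<comment> \<open>No edge enters a source, so a path meets sources only at its first
    vertex.\<close>
  moreover have "x = hd p" if "pedges p \<subseteq> E" "x \<in> sources G" "x \<in> set p" for x p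
    using that
  proof (induction p)
    case (Cons u p)
    then show ?case
    proof (cases p)
      case (Cons z r)
      have "(u, z) \<in> E" using Cons.prems Cons by auto
      then show ?thesis using Cons.IH Cons.prems Cons no_edge_into_source[of "(u, z)"] by auto
    qed auto
  qed auto
  ultimately have "src G i = src G j" using pe s by (auto simp: dpath_def)
  moreover have "j \<in> {1..nsrc G}" using F j by (auto simp: is_flow_def)
  ultimately show "i \<in> I" using inj_src i j(1) by (metis inj_onD)
qed

lemma flow_sink_edge:
  assumes F: "is_flow G I J phi" and j: "j \<in> {1..nsnk G}"
  shows "(\<exists>v. (v, snk G j) \<in> flow_edges I phi) \<longleftrightarrow> j \<in> J"
proof
  assume "j \<in> J"
  then obtain i where i: "i \<in> I" "last (phi i) = snk G j" using F unfolding is_flow_def by (metis imageE imageI)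
  note pe = flow_ends[OF F i(1)]
  have last: "\<exists>u. (u, last p) \<in> pedges p" if "p \<noteq> []" "tl p \<noteq> []" for p :: "'v list"
    using that
  proof (induction p)
    case (Cons u p)
    then show ?case by (cases p; cases "tl p") auto
  qed simp
  have "tl (phi i) \<noteq> []" using pe source_not_sink by (metis dpath_def last_ConsL list.collapse)
  then show "\<exists>v. (v, snk G j) \<in> flow_edges I phi" using last[of "phi i"] i pe(1) by (auto simp: flow_edges_def dpath_def)
next
  assume "\<exists>v. (v, snk G j) \<in> flow_edges I phi"
  then obtain v i where i: "i \<in> I" "(v, snk G j) \<in> pedges (phi i)" by (auto simp: flow_edges_def)
  note pe = flow_ends[OF F \<open>i \<in> I\<close>]
  have s: "snk G j \<in> sinks G" using j by (auto simp: sinks_def)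
  have "snk G j \<in> set (phi i)" using pedges_verts[OF i(2)] by simp
  moreover have "x = last p" if "pedges p \<subseteq> E" "x \<in> sinks G" "x \<in> set p" for x p
    using that
  proof (induction p)
    case (Cons u p)
    then show ?case
    proof (cases p)
      case (Cons z r)
      have "(u, z) \<in> E" using Cons.prems Cons by auto
      then show ?thesis using Cons.IH Cons.prems Cons no_edge_from_sink[of "(u, z)"] by auto
    qed auto
  qed auto
  ultimately have "snk G j = last (phi i)" using pe s by (auto simp: dpath_def)
  then obtain j' where "j' \<in> J" "snk G j = snk G j'" using F i unfolding is_flow_def by (metis imageE imageI)
  moreover have "j' \<in> {1..nsnk G}" using F \<open>j' \<in> J\<close> by (auto simp: is_flow_def)
  ultimately show "j \<in> J" using inj_snk j by (metis inj_onD)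
qed

end

section \<open>Colours, open ends and the order of the sweep\<close>

locale two_edge_flows = se_graph G for G :: "('v::linorder) segraph" +
  fixes F F' :: "('v \<times> 'v) set"
  assumes flowF: "edge_flow F" and flowF': "edge_flow F'"
begin

abbreviation U :: "('v \<times> 'v) set" where "U \<equiv> symdiff F F'"

text \<open>The sign of the change in \<open>F\<close> when a part of \<open>U\<close> is exchanged:
  edges of \<open>F'\<close> are gained, edges of \<open>F\<close> are lost.\<close>

definition colour :: "'v \<times> 'v \<Rightarrow> int" where
  "colour e = (if e \<in> F' then 1 else - 1)"

definition pot :: "'v \<Rightarrow> int" where
  "pot = hsum (\<lambda>e. ind F e + ind F' e)"

text \<open>The stub (r, r) stands for the free end at the source r of the path of U starting at r.\<close>
definition stubs :: "('v \<times> 'v) set" where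
  "stubs = {(r, r) | r. r \<in> sources G \<and> (\<exists>v. (r, v) \<in> U)}"

definition nodes_of :: "'v \<times> 'v \<Rightarrow> ('v \<times> bool) set" where
  "nodes_of e = {out_node U (fst e), in_node U (snd e)}"

text \<open>Orders the ends of swept arcs linearly along the boundary of the swept region: edges by their
  height on the sweep line, with edges into sinks below all other edges (from left to right) and stubs
  above all edges (from top to bottom). The exponential only serves as a positive monotone function.\<close>
definition key :: "'v \<times> 'v \<Rightarrow> real" where
  "key e = (if fst e = snd e then 2 * Max (py ` V) + exp (- py (fst e))
            else if snd e \<in> sinks G then 2 * py (snd e) - exp (- px (snd e))
            else py (fst e) + py (snd e))"

text \<open>A stub has the sign opposite to the edge at its source, since these two are the ends of
  a newly created arc and the ends of an arc have opposite signs.\<close>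

definition sg :: "'v \<times> 'v \<Rightarrow> int" where
  "sg e = (if fst e = snd e then (if \<exists>v. (fst e, v) \<in> F' then - 1 else 1) else colour e)"

text \<open>An open end carries that part of the turn count of its arc that depends on the direction of the
  end, so that what remains, twice the sign of the upper end, is unchanged when an arc is prolonged.\<close>
definition en :: "'v \<times> 'v \<Rightarrow> int" where
  "en e = (if fst e = snd e then - 2 * sg e else colour e * (2 * of_bool (V_edge G e) + pot (snd e)))"

text \<open>Up to a global sign, the contribution of an edge to the first sum of
  \<open>Lam_hsum_hsum\<close> for the colour vector against the sum of both flows.\<close>

definition wt :: "'v \<times> 'v \<Rightarrow> int" where
  "wt e = (if fst e = snd e then 0 else colour e * (pot (fst e) + pot (snd e)))"

text \<open>An edge lies in the component of the node that it leaves, so tails suffice; a stub is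
  attached to the node of its source.\<close>

definition linked :: "(('v \<times> 'v) \<times> ('v \<times> 'v)) set" where
  "linked = {(e, e'). (out_node U (fst e), out_node U (fst e')) \<in> split_conn U}"

lemma U_sub: "U \<subseteq> E"
  using edge_flowD(1)[OF flowF] edge_flowD(1)[OF flowF'] by (auto simp: symdiff_def)

lemma finite_U: "finite U"
  using U_sub finite_edges finite_subset by blast

lemma U_neq: "e \<in> U \<Longrightarrow> fst e \<noteq> snd e"
  using U_sub edge_neq[of "fst e" "snd e"] by auto

lemma sym_split: "(a, b) \<in> split_conn U \<Longrightarrow> (b, a) \<in> split_conn U"
proof -
  have "sym (split_conn U)" unfolding split_conn_def by (intro sym_rtrancl) (simp add: sym_Un_converse)
  then show "(a, b) \<in> split_conn U \<Longrightarrow> (b, a) \<in> split_conn U" by (auto dest: symD)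
qed

lemma trans_split: "(a, b) \<in> split_conn U \<Longrightarrow> (b, c) \<in> split_conn U \<Longrightarrow> (a, c) \<in> split_conn U"
  unfolding split_conn_def by auto

lemma split_edge: "e \<in> U \<Longrightarrow> (out_node U (fst e), in_node U (snd e)) \<in> split_conn U"
  unfolding split_conn_def split_adj_def by (rule r_into_rtrancl) blast

lemma split_refl: "(a, a) \<in> split_conn U"
  by (simp add: split_conn_def)

sublocale arc_sweep "U \<union> stubs" nodes_of key sg en wt linked
proof
  show "sym linked" by (auto simp: sym_def linked_def intro: sym_split)
  show "trans linked" unfolding trans_def linked_def by (auto intro: trans_split)
qed

definition before :: "'v \<Rightarrow> 'v \<Rightarrow> bool" where
  "before u v \<longleftrightarrow> px u < px v \<or> (px u = px v \<and> py v < py u)"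

definition rank :: "'v \<Rightarrow> nat" where
  "rank v = card {w \<in> V. before w v}"

lemma before_total: "u \<in> V \<Longrightarrow> v \<in> V \<Longrightarrow> u \<noteq> v \<Longrightarrow> before u v \<or> before v u"
  using inj_pos unfolding before_def inj_on_def by (metis linorder_neqE prod_eqI)

lemma before_rank: "before u v \<Longrightarrow> u \<in> V \<Longrightarrow> v \<in> V \<Longrightarrow> rank u < rank v"
  unfolding rank_def using finite_verts
  by (intro psubset_card_mono) (auto simp: before_def)

lemma edge_before: "(u, v) \<in> E \<Longrightarrow> before u v"
  using edge_HV[of "(u, v)"] by (auto simp: before_def dest: H_edgeD V_edgeD)

text \<open>Sinks are never passed: edges into sinks, like stubs, stay open to the end of the sweep
  and mark the ends of the paths of \<open>U\<close>.\<close>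

definition prefix_set :: "'v set \<Rightarrow> bool" where
  "prefix_set S \<longleftrightarrow> S \<subseteq> V - sinks G \<and> (\<forall>w\<in>S. \<forall>u\<in>V - sinks G. before u w \<longrightarrow> u \<in> S)"

definition cut :: "'v set \<Rightarrow> ('v \<times> 'v) set" where
  "cut S = {e \<in> U. fst e \<in> S \<and> snd e \<notin> S} \<union> {e \<in> stubs. fst e \<in> S}"

definition entered :: "'v set \<Rightarrow> ('v \<times> 'v) set" where
  "entered S = {e \<in> U \<union> stubs. fst e \<in> S}"

lemma stubsD: "e \<in> stubs \<Longrightarrow> fst e = snd e \<and> fst e \<in> sources G \<and> (\<exists>v. (fst e, v) \<in> U)"
  by (auto simp: stubs_def)

lemma udeg_split:
  "udeg U v = card {e \<in> U. snd e = v} + card {e \<in> U. fst e = v}"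
proof -
  have "{e \<in> U. fst e = v \<or> snd e = v} = {e \<in> U. snd e = v} \<union> {e \<in> U. fst e = v}" by auto
  moreover have "{e \<in> U. snd e = v} \<inter> {e \<in> U. fst e = v} = {}" using U_neq by auto
  ultimately show ?thesis unfolding udeg_def using finite_U by (simp add: card_Un_disjoint)
qed

lemma py_le_Max: "v \<in> V \<Longrightarrow> py v \<le> Max (py ` V)"
  using finite_verts by simp

lemma key_edge_less_stub:
  assumes "e \<in> E" "s \<in> stubs"
  shows "key e < key s"
proof -
  have v: "fst e \<in> V" "snd e \<in> V" "fst e \<noteq> snd e"
    using edge_verts[of "fst e" "snd e"] edge_neq[of "fst e" "snd e"] assms by auto
  have pos: "0 < exp (- px (snd e))" by simp
  have "key e = 2 * py (snd e) - exp (- px (snd e)) \<or> key e = py (fst e) + py (snd e)"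
    using v by (simp add: key_def)
  then have "key e \<le> 2 * Max (py ` V)"
    using py_le_Max[OF v(1)] py_le_Max[OF v(2)] pos by linarith
  moreover have "key s = 2 * Max (py ` V) + exp (- py (fst s))" using stubsD[OF assms(2)] by (simp add: key_def)
  moreover have "0 < exp (- py (fst s))" by simp
  ultimately show ?thesis by linarith
qed

text \<open>An edge that the sweep crosses both before and after passing v lies entirely above or
  entirely below all edges incident with v.\<close>
lemma crossing_key:
  assumes x: "x \<in> U" "before (fst x) v" "snd x \<in> sinks G \<or> before v (snd x)"
    and v: "v \<in> inner G" and xv: "fst x \<noteq> v" "snd x \<noteq> v"
  shows "key x \<noteq> 2 * py v"
    "(u, v) \<in> E \<Longrightarrow> key x \<noteq> key (u, v) \<and> (key x < key (u, v) \<longleftrightarrow> key x < 2 * py v)"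
    "(v, w) \<in> E \<Longrightarrow> key x \<noteq> key (v, w) \<and> (key x < key (v, w) \<longleftrightarrow> key x < 2 * py v)"
proof -
  obtain a b where ab: "x = (a, b)" by (cases x)
  have abE: "(a, b) \<in> E" using x U_sub ab by auto
  have vV: "v \<in> V" "v \<notin> sources G" "v \<notin> sinks G" using v by (auto simp: inner_iff)
  have ne: "a \<noteq> b" "a \<noteq> v" "b \<noteq> v" using edge_neq[OF abE] xv ab by auto
  have aV: "a \<in> V" "b \<in> V" "a \<notin> sinks G" using edge_verts[OF abE] no_edge_from_sink[OF abE] by auto
  have up: "u \<noteq> v" "v \<notin> sinks G" "py v \<le> py u" if "(u, v) \<in> E" for u
    using that edge_neq vV edge_mono by auto
  have kin: "key (u, v) = py u + py v" if "(u, v) \<in> E" for u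
    using up[OF that] by (simp add: key_def)
  show "key x \<noteq> 2 * py v"
    "(u, v) \<in> E \<Longrightarrow> key x \<noteq> key (u, v) \<and> (key x < key (u, v) \<longleftrightarrow> key x < 2 * py v)"
    "(v, w) \<in> E \<Longrightarrow> key x \<noteq> key (v, w) \<and> (key x < key (v, w) \<longleftrightarrow> key x < 2 * py v)"
  proof (atomize (full), cases "b \<in> sinks G")
    case True
    have V: "V_edge G (a, b)" using sink_edge_V[OF abE] True by simp
    have bv: "py b < py v" using sink_below vV True by auto
    \<comment> \<open>In the same column \<open>v\<close> would lie on the edge.\<close>
    have "px a \<noteq> px v"
    proof
      assume "px a = px v"
      then have "py v < py a" using x(2) ab by (auto simp: before_def)
      then show False using on_V_edge[OF V vV(1)] bv ne \<open>px a = px v\<close> by auto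
    qed
    then have lt: "px b < px v" using V_edgeD[OF V] x(2) ab by (auto simp: before_def)
    have kx: "key x = 2 * py b - exp (- px b)" using True ab ne by (simp add: key_def)
    have pos: "0 < exp (- px b)" by simp
    have "key x < 2 * py v" using kx bv pos by linarith
    moreover have "key x < key (u, v)" if "(u, v) \<in> E"
      using kin[OF that] up(3)[OF that] \<open>key x < 2 * py v\<close> by linarith
    moreover have "key x < key (v, w)" if "(v, w) \<in> E"
    proof (cases "w \<in> sinks G")
      case T: True
      have "px w = px v" using sink_edge_V[OF that] T V_edgeD by auto
      then have "key (v, w) = 2 * py b - exp (- px v)"
        using T edge_neq[OF that] py_sinks[OF T True] by (auto simp: key_def)
      then show ?thesis using kx lt by simp
    next
      case False
      then have "py b < py w" using sink_below[of w b] edge_verts[OF that] True by auto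
      moreover have "key (v, w) = py v + py w" using False edge_neq[OF that] by (simp add: key_def)
      ultimately show ?thesis using kx bv pos by linarith
    qed
    ultimately show "key x \<noteq> 2 * py v \<and> ((u, v) \<in> E \<longrightarrow> key x \<noteq> key (u, v) \<and> (key x < key (u, v) \<longleftrightarrow> key x < 2 * py v)) \<and>
      ((v, w) \<in> E \<longrightarrow> key x \<noteq> key (v, w) \<and> (key x < key (v, w) \<longleftrightarrow> key x < 2 * py v))" by auto
  next
    case False
    then have b: "before v b" using x(3) ab by simp
    \<comment> \<open>A V-edge crossed both before and after \<open>v\<close> would contain
      \<open>v\<close>.\<close>
    have "\<not> V_edge G (a, b)"
    proof
      assume V: "V_edge G (a, b)"
      then have "px a = px v" "py v < py a" "py b < py v"
        using V_edgeD[OF V] x(2) b ab by (auto simp: before_def)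
      then show False using on_V_edge[OF V vV(1)] ne by auto
    qed
    then have H: "H_edge G (a, b)" using not_H[OF abE] by blast
    have yab: "py b = py a" using H_edgeD[OF H] by auto
    have xab: "px a \<le> px v" "px v \<le> px b" using x(2) b ab by (auto simp: before_def)
    have kx: "key x = 2 * py a" using ab ne False yab by (simp add: key_def)
    \<comment> \<open>The horizontal edge avoids the row of \<open>v\<close>, as \<open>v\<close> is
      not on it; planarity then keeps its height outside the V-edges at \<open>v\<close>.\<close>
    have 1: "py a \<noteq> py v" using on_H_edge[OF H vV(1)] xab ne by auto
    have 2: "\<not> (py v < py a \<and> py a < py u)" if "V_edge G (u, v)" for u
      using no_crossing[OF H that] V_edgeD[OF that] xab by auto
    have 3: "\<not> (py w < py a \<and> py a < py v)" if "V_edge G (v, w)" for w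
      using no_crossing[OF H that] xab by auto
    have "key x \<noteq> key (u, v) \<and> (key x < key (u, v) \<longleftrightarrow> key x < 2 * py v)" if e: "(u, v) \<in> E"
    proof (cases "H_edge G (u, v)")
      case True
      then show ?thesis using kin[OF e] kx 1 H_edgeD[OF True] by auto
    next
      case F: False
      then have V: "V_edge G (u, v)" using not_H[OF e] by blast
      show ?thesis using 1 2[OF V] V_edgeD[OF V] kin[OF e] kx by auto
    qed
    moreover have "key x \<noteq> key (v, w) \<and> (key x < key (v, w) \<longleftrightarrow> key x < 2 * py v)" if e: "(v, w) \<in> E"
    proof (cases "H_edge G (v, w)")
      case True
      then have "w \<notin> sinks G" using sink_edge_V[OF e] not_HV by auto
      then have "key (v, w) = 2 * py v" using edge_neq[OF e] H_edgeD[OF True] by (simp add: key_def)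
      then show ?thesis using kx 1 by auto
    next
      case F: False
      then have V: "V_edge G (v, w)" using not_H[OF e] by blast
      show ?thesis
      proof (cases "w \<in> sinks G")
        case True
        then have "py w < py a" using sink_below[OF aV(1,3)] by auto
        moreover have "key (v, w) < 2 * py w" using True edge_neq[OF e] by (simp add: key_def)
        ultimately show ?thesis using 1 3[OF V] V_edgeD[OF V] kx by auto
      next
        case False
        then have "key (v, w) = py v + py w" using edge_neq[OF e] by (simp add: key_def)
        then show ?thesis using 1 3[OF V] V_edgeD[OF V] kx by auto
      qed
    qed
    ultimately show "key x \<noteq> 2 * py v \<and> ((u, v) \<in> E \<longrightarrow> key x \<noteq> key (u, v) \<and> (key x < key (u, v) \<longleftrightarrow> key x < 2 * py v)) \<and>
      ((v, w) \<in> E \<longrightarrow> key x \<noteq> key (v, w) \<and> (key x < key (v, w) \<longleftrightarrow> key x < 2 * py v))"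
      using kx 1 by auto
  qed
qed

lemma key_H_in: "H_edge G (u, v) \<Longrightarrow> key (u, v) = 2 * py v"
  using H_edgeD[of u v] H_snd_inner[of u v] by (auto simp: key_def inner_iff)

lemma key_H_out: "H_edge G (u, v) \<Longrightarrow> key (u, v) = 2 * py u"
  using H_edgeD[of u v] H_snd_inner[of u v] by (auto simp: key_def inner_iff)

lemma key_V_in: "V_edge G (u, v) \<Longrightarrow> v \<in> inner G \<Longrightarrow> 2 * py v < key (u, v)"
  using V_edgeD[of u v] by (auto simp: key_def inner_iff)

lemma key_V_out:
  assumes "V_edge G (v, w)" shows "key (v, w) < 2 * py v"
proof (cases "w \<in> sinks G")
  case True
  have "0 < exp (- px w)" by simp
  moreover have "key (v, w) = 2 * py w - exp (- px w)" using V_edgeD[OF assms] True edge_neq[of v w] by (simp add: key_def)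
  ultimately show ?thesis using V_edgeD[OF assms] by linarith
next
  case False
  then show ?thesis using V_edgeD[OF assms] edge_neq[of v w] by (simp add: key_def)
qed

lemma prefix_edge:
  assumes "prefix_set S" "(u, w) \<in> E" "w \<in> S"
  shows "u \<in> S"
  using assms edge_before[of u w] no_edge_from_sink[of "(u, w)"] edge_verts[of u w] unfolding prefix_set_def by auto

section \<open>The edges of \<open>U\<close> around a vertex\<close>

lemma out_U_unique:
  assumes "r \<in> sources G" "(r, v) \<in> U" "(r, w) \<in> U"
  shows "v = w"
  using assms U_sub source_edge_H[of "(r, v)"] source_edge_H[of "(r, w)"] H_out_unique[of r v w] by auto

text \<open>Each flow enters \<open>v\<close> by at most one edge, so the two edges belong to
  different flows.\<close>

lemma colour_opposite_in:
  assumes "(u, v) \<in> U" "(u', v) \<in> U" "u \<noteq> u'"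
  shows "colour (u', v) = - colour (u, v)"
  using assms edge_flowD(4)[OF flowF] edge_flowD(4)[OF flowF'] unfolding symdiff_def colour_def by auto

lemma colour_opposite_out:
  assumes "(v, u) \<in> U" "(v, u') \<in> U" "u \<noteq> u'"
  shows "colour (v, u') = - colour (v, u)"
  using assms edge_flowD(3)[OF flowF] edge_flowD(3)[OF flowF'] unfolding symdiff_def colour_def by auto

lemma sg_edge: "e \<in> U \<Longrightarrow> sg e = colour e"
  using U_neq by (simp add: sg_def)

lemma en_edge: "e \<in> U \<Longrightarrow> en e = colour e * (2 * of_bool (V_edge G e) + pot (snd e))"
  using U_neq by (simp add: en_def)

lemma wt_edge: "e \<in> U \<Longrightarrow> wt e = colour e * (pot (fst e) + pot (snd e))"
  using U_neq by (simp add: wt_def)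

lemma sg_stub:
  assumes "r \<in> sources G" "(r, w) \<in> U"
  shows "sg (r, r) = - colour (r, w)"
proof -
  have "(\<exists>v. (r, v) \<in> F') \<longleftrightarrow> (r, w) \<in> F'"
  proof
    assume "\<exists>v. (r, v) \<in> F'"
    then obtain v where v: "(r, v) \<in> F'" by blast
    then have "(r, v) \<in> E" "(r, w) \<in> E" using edge_flowD(1)[OF flowF'] assms U_sub by auto
    then have "v = w" using source_edge_H[of "(r, v)"] source_edge_H[of "(r, w)"] H_out_unique[of r v w] assms by auto
    then show "(r, w) \<in> F'" using v by simp
  qed blast
  then show ?thesis by (simp add: sg_def colour_def)
qed

lemma pot_source: "r \<in> sources G \<Longrightarrow> pot r = 0"
  unfolding pot_def by (rule hsum_outside) (simp add: inner_iff)

lemma pot_sink: "t \<in> sinks G \<Longrightarrow> pot t = 0"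
  unfolding pot_def by (rule hsum_outside) (simp add: inner_iff)

lemma pot_split: "pot v = hsum (ind F) v + hsum (ind F') v"
  by (simp add: pot_def hsum_add)

text \<open>The first set holds the edges of \<open>U\<close> entering \<open>v\<close>, the second
  those leaving it. The value of \<open>pot v\<close> is recorded only for \<open>pass\<close>;
  where edges come in pairs it occurs with two opposite colours and cancels.\<close>

inductive vertex_config :: "'v \<Rightarrow> ('v \<times> 'v) set \<Rightarrow> ('v \<times> 'v) set \<Rightarrow> bool" for v where
  none: "vertex_config v {} {}"
| pass: "colour b = colour a \<Longrightarrow> pot v = of_bool (H_edge G a) - of_bool (H_edge G b) \<Longrightarrow> vertex_config v {a} {b}"
| join: "H_edge G h \<Longrightarrow> V_edge G w \<Longrightarrow> colour w = - colour h \<Longrightarrow> vertex_config v {h, w} {}"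
| create: "H_edge G h \<Longrightarrow> V_edge G w \<Longrightarrow> colour w = - colour h \<Longrightarrow> vertex_config v {} {h, w}"
| join_create: "H_edge G h \<Longrightarrow> V_edge G w \<Longrightarrow> colour w = - colour h \<Longrightarrow>
    H_edge G h' \<Longrightarrow> V_edge G w' \<Longrightarrow> colour w' = - colour h' \<Longrightarrow> vertex_config v {h, w} {h', w'}"

lemma two_in_edges:
  assumes "(u, v) \<in> U" "(u', v) \<in> U" "u \<noteq> u'"
  shows "\<exists>h w. {(u, v), (u', v)} = {h, w} \<and> H_edge G h \<and> V_edge G w \<and> colour w = - colour h"
proof -
  have e: "(u, v) \<in> E" "(u', v) \<in> E" using assms U_sub by auto
  consider "H_edge G (u, v)" "V_edge G (u', v)" | "V_edge G (u, v)" "H_edge G (u', v)"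
    using edge_HV[OF e(1)] edge_HV[OF e(2)] H_in_unique[of u v u'] V_in_unique[of u v u'] assms by blast
  then show ?thesis
  proof cases
    case 1
    then show ?thesis using colour_opposite_in[OF assms] by (intro exI[of _ "(u, v)"] exI[of _ "(u', v)"]) simp
  next
    case 2
    then show ?thesis using colour_opposite_in[OF assms] by (intro exI[of _ "(u', v)"] exI[of _ "(u, v)"]) (simp add: insert_commute)
  qed
qed

lemma two_out_edges:
  assumes "(v, u) \<in> U" "(v, u') \<in> U" "u \<noteq> u'"
  shows "\<exists>h w. {(v, u), (v, u')} = {h, w} \<and> H_edge G h \<and> V_edge G w \<and> colour w = - colour h"
proof -
  have e: "(v, u) \<in> E" "(v, u') \<in> E" using assms U_sub by auto
  consider "H_edge G (v, u)" "V_edge G (v, u')" | "V_edge G (v, u)" "H_edge G (v, u')"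
    using edge_HV[OF e(1)] edge_HV[OF e(2)] H_out_unique[of v u u'] V_out_unique[of v u u'] assms by blast
  then show ?thesis
  proof cases
    case 1
    then show ?thesis using colour_opposite_out[OF assms] by (intro exI[of _ "(v, u)"] exI[of _ "(v, u')"]) simp
  next
    case 2
    then show ?thesis using colour_opposite_out[OF assms] by (intro exI[of _ "(v, u')"] exI[of _ "(v, u)"]) (simp add: insert_commute)
  qed
qed

text \<open>One flow alone through \<open>v\<close> gives \<open>pass\<close>. If both pass through
  \<open>v\<close>, shared edges drop out of \<open>U\<close>, and two different entering or leaving
  edges are an H-edge and a V-edge of opposite colours.\<close>

lemma config_cases:
  assumes v: "v \<in> inner G"
  shows "vertex_config v {e \<in> U. snd e = v} {e \<in> U. fst e = v}"
proof -
  let ?in = "{e \<in> U. snd e = v}" and ?out = "{e \<in> U. fst e = v}"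
  note f = edge_flowD(3,4)[OF flowF] and f' = edge_flowD(3,4)[OF flowF']
  have one: "?in = {(a, v)} \<and> ?out = {(v, b)}" if "A = F \<and> B = F' \<or> A = F' \<and> B = F" "(a, v) \<in> A" "(v, b) \<in> A"
      "\<nexists>u. (u, v) \<in> B" "\<nexists>u. (v, u) \<in> B" for A B a b
    using that f f' by (auto simp: symdiff_def)
  show ?thesis
  proof (cases "\<exists>u. (u, v) \<in> F")
    case True
    then obtain a b where ab: "(a, v) \<in> F" "(v, b) \<in> F" using edge_flow_through[OF flowF v] by blast
    show ?thesis
    proof (cases "\<exists>u. (u, v) \<in> F'")
      case True
      then obtain c d where cd: "(c, v) \<in> F'" "(v, d) \<in> F'" using edge_flow_through[OF flowF' v] by blast
      have i: "?in = (if a = c then {} else {(a, v), (c, v)})" and o: "?out = (if b = d then {} else {(v, b), (v, d)})"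
      proof -
        have "(x, v) \<in> F \<longleftrightarrow> x = a" "(v, x) \<in> F \<longleftrightarrow> x = b" "(x, v) \<in> F' \<longleftrightarrow> x = c" "(v, x) \<in> F' \<longleftrightarrow> x = d" for x
          using f(2)[of x v a] f(1)[of v x b] f'(2)[of x v c] f'(1)[of v x d] ab cd by blast+
        then show "?in = (if a = c then {} else {(a, v), (c, v)})" "?out = (if b = d then {} else {(v, b), (v, d)})"
          by (auto simp: symdiff_def)
      qed
      have hi: "a \<noteq> c \<Longrightarrow> \<exists>h w. {(a, v), (c, v)} = {h, w} \<and> H_edge G h \<and> V_edge G w \<and> colour w = - colour h"
        using i by (intro two_in_edges) auto
      have ho: "b \<noteq> d \<Longrightarrow> \<exists>h w. {(v, b), (v, d)} = {h, w} \<and> H_edge G h \<and> V_edge G w \<and> colour w = - colour h"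
        using o by (intro two_out_edges) auto
      show ?thesis
        unfolding i o using hi ho by (cases "a = c"; cases "b = d") (auto intro: vertex_config.intros)
    next
      case False
      then have F: "\<nexists>u. (v, u) \<in> F'" using edge_flow_through[OF flowF' v] by blast
      have "pot v = of_bool (H_edge G (a, v)) - of_bool (H_edge G (v, b))"
        using hsum_through[OF flowF v ab] hsum_avoid[OF False F] by (simp add: pot_split)
      then show ?thesis using one[of F F' a b] ab False F by (auto simp: colour_def intro!: pass)
    qed
  next
    case False
    then have F: "\<nexists>u. (v, u) \<in> F" using edge_flow_through[OF flowF v] by blast
    show ?thesis
    proof (cases "\<exists>u. (u, v) \<in> F'")
      case True
      then obtain a b where ab: "(a, v) \<in> F'" "(v, b) \<in> F'" using edge_flow_through[OF flowF' v] by blast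
      have "pot v = of_bool (H_edge G (a, v)) - of_bool (H_edge G (v, b))"
        using hsum_through[OF flowF' v ab] hsum_avoid[OF False F] by (simp add: pot_split)
      then show ?thesis using one[of F' F a b] ab False F by (auto simp: colour_def intro!: pass)
    next
      case False': False
      then have F': "\<nexists>u. (v, u) \<in> F'" using edge_flow_through[OF flowF' v] by blast
      have "?in = {}" "?out = {}" using False False' F F' by (auto simp: symdiff_def)
      then show ?thesis by (simp only: none)
    qed
  qed
qed

section \<open>Nodes of the split graph and the passing of one vertex\<close>

lemma nodes_of_iff: "(v, b) \<in> nodes_of e \<longleftrightarrow> fst e = v \<and> b = (udeg U v = 4) \<or> snd e = v \<and> \<not> b"
  by (auto simp: nodes_of_def out_node_def in_node_def)

text \<open>Both nodes of a vertex are passed together; \<open>(v, True)\<close> lies on an edge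
  only if \<open>v\<close> has degree 4 and is skipped otherwise.\<close>

lemma Times_insert: "insert v S \<times> (UNIV :: bool set) = insert (v, True) (insert (v, False) (S \<times> UNIV))"
  by (auto simp: UNIV_bool)

lemma linked_out: "fst e = fst e' \<Longrightarrow> (e, e') \<in> linked"
  by (simp add: linked_def split_refl)

lemma linked_in:
  assumes "e \<in> U" "e' \<in> U" "snd e = snd e'"
  shows "(e, e') \<in> linked"
  using trans_split[OF split_edge[OF assms(1), unfolded assms(3)] sym_split[OF split_edge[OF assms(2)]]]
  by (simp add: linked_def)

lemma linked_pass:
  assumes "e \<in> U" "snd e = fst e'" "udeg U (fst e') \<noteq> 4"
  shows "(e, e') \<in> linked" "(e', e) \<in> linked"
proof -
  have "out_node U (fst e') = in_node U (snd e)" using assms by (simp add: out_node_def in_node_def)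
  then show "(e, e') \<in> linked" "(e', e) \<in> linked"
    using split_edge[OF assms(1)] sym_split[OF split_edge[OF assms(1)]] by (simp_all add: linked_def)
qed

lemma cut_sub: "cut S \<subseteq> entered S" and entered_sub: "entered S \<subseteq> U \<union> stubs"
  by (auto simp: cut_def entered_def)

text \<open>Hence sources are not split, and the node that \<open>term_node\<close> assigns to a
  source is the one left by its edge.\<close>

lemma udeg_source:
  assumes "r \<in> sources G"
  shows "udeg U r \<noteq> 4"
proof -
  have "{e \<in> U. snd e = r} = {}" using no_edge_into_source U_sub assms by blast
  then have "card {e \<in> U. snd e = r} = 0" by (simp only: card.empty)
  moreover have "card {e \<in> U. fst e = r} \<le> 1"
  proof (cases "\<exists>w. (r, w) \<in> U")
    case True
    then obtain w where w: "(r, w) \<in> U" by blast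
    have "{e \<in> U. fst e = r} \<subseteq> {(r, w)}"
    proof
      fix e assume "e \<in> {e \<in> U. fst e = r}"
      then show "e \<in> {(r, w)}" using out_U_unique[OF assms w, of "snd e"] by (cases e) auto
    qed
    then show ?thesis using card_mono[of "{(r, w)}" "{e \<in> U. fst e = r}"] by simp
  next
    case False
    then have "{e \<in> U. fst e = r} = {}" by auto
    then show ?thesis by (metis card.empty zero_le_one)
  qed
  ultimately show ?thesis unfolding udeg_split by linarith
qed

text \<open>Sources form the leftmost column and are passed from top to bottom, so all open ends
  belong to higher sources. Their edges lie above the edge of \<open>r\<close> and their stubs below
  its stub: the new arc encloses them all.\<close>

lemma sweep_source:
  assumes S: "prefix_set S" and r: "r \<in> sources G" "r \<notin> S" and bef: "\<And>w. w \<in> S \<Longrightarrow> before w r"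
    and A: "arcs (cut S) (entered S) (S \<times> UNIV) \<mu> P"
  shows "\<exists>\<mu> P. arcs (cut (insert r S)) (entered (insert r S)) (insert r S \<times> UNIV) \<mu> P"
proof -
  have in_r: "snd e \<noteq> r" if "e \<in> U" for e using no_edge_into_source[of e] U_sub that r by auto
  show ?thesis
  proof (cases "\<exists>w. (r, w) \<in> U")
    case False
    have st: "(r, r) \<notin> stubs" using False by (auto simp: stubs_def)
    have "fst e \<noteq> r" "snd e \<noteq> r" if "e \<in> U \<union> stubs" for e
      using that False in_r by (cases e; auto simp: stubs_def)+
    then have no: "(r, b) \<notin> nodes_of e" if "e \<in> U \<union> stubs" for e b
      using that by (auto simp: nodes_of_iff)
    have "cut (insert r S) = cut S" "entered (insert r S) = entered S"
      using False in_r by (auto simp: cut_def entered_def stubs_def)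
    moreover have "arcs (cut S) (entered S) (insert (r, True) (insert (r, False) (S \<times> UNIV))) \<mu> P"
      by (rule arcs_skip[OF arcs_skip[OF A no] no])
    ultimately show ?thesis unfolding Times_insert by metis
  next
    case True
    then obtain w where w: "(r, w) \<in> U" by blast
    have wU: "fst e = r \<longleftrightarrow> e = (r, w)" if "e \<in> U" for e
      using out_U_unique[OF r(1) w, of "snd e"] that by (cases e) auto
    have wE: "(r, w) \<in> E" using w U_sub by auto
    have H: "H_edge G (r, w)" using source_edge_H[OF wE] r by simp
    have rV: "r \<in> V" using r sources_sub by auto
    have wS: "w \<notin> S" "w \<noteq> r" using prefix_edge[OF S wE] r edge_neq[OF wE] by auto
    have stub: "(r, r) \<in> stubs" using r w by (auto simp: stubs_def)
    let ?p = "(r, w)" and ?q = "(r, r)"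
    have deg: "udeg U r \<noteq> 4" using udeg_source[OF r(1)] .
    have cutx: "x \<in> U \<union> stubs" "fst x \<in> S" if "x \<in> cut S" for x using that by (auto simp: cut_def)
    have kp: "key ?p = 2 * py r" using key_H_out[OF H] .
    have kq: "key ?q = 2 * Max (py ` V) + exp (- py r)" by (simp add: key_def)
    have between: "key ?p < key x \<and> key x < key ?q" if x: "x \<in> cut S" for x
    proof -
      have fV: "fst x \<in> V" using cutx[OF x] S by (auto simp: prefix_set_def)
      have "before (fst x) r" using bef cutx[OF x] by auto
      moreover have fsrc: "fst x \<in> sources G"
      proof (rule ccontr)
        assume "fst x \<notin> sources G"
        then show False using source_right[OF fV _ r(1)] \<open>before (fst x) r\<close> unfolding before_def by fastforce
      qed
      ultimately have py: "py r < py (fst x)" using px_sources[OF _ r(1)] by (fastforce simp: before_def)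
      show ?thesis
      proof (cases "x \<in> stubs")
        case True
        then have kx: "key x = 2 * Max (py ` V) + exp (- py (fst x))" using stubsD by (simp add: key_def)
        have "0 < exp (- py (fst x))" by simp
        moreover have "exp (- py (fst x)) < exp (- py r)" using py by simp
        ultimately show ?thesis using kx kp kq py_le_Max[OF rV] by linarith
      next
        case False
        then have xU: "x \<in> U" "x \<in> E" using cutx[OF x] U_sub by auto
        then have "key x = 2 * py (fst x)" using key_H_out[of "fst x" "snd x"] source_edge_H[OF xU(2) fsrc] by simp
        then show ?thesis using key_edge_less_stub[OF xU(2) stub] py kp by auto
      qed
    qed
    have "arcs (insert ?p (insert ?q (cut S))) (insert ?p (insert ?q (entered S))) (insert (r, False) (S \<times> UNIV))
       (\<mu>(?p := ?q, ?q := ?p)) (P(?p := {?p, ?q}, ?q := {?p, ?q}))"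
    proof (rule arcs_create[OF A])
      show "?p \<in> U \<union> stubs - entered S" "?q \<in> U \<union> stubs - entered S" using w stub r by (auto simp: entered_def)
      show "key ?p < key ?q" using key_edge_less_stub[OF wE stub] .
      show "\<And>x. x \<in> cut S \<Longrightarrow> key x \<noteq> key ?p \<and> key x \<noteq> key ?q" using between by fastforce
      show "(\<forall>x\<in>cut S. \<not> (key ?p < key x \<and> key x < key ?q)) \<or> (\<forall>x\<in>cut S. key ?p < key x \<and> key x < key ?q)"
        using between by blast
      show "{e \<in> U \<union> stubs. (r, False) \<in> nodes_of e} = {?p, ?q}"
        using deg wU in_r w stub by (auto simp: nodes_of_iff stubs_def)
      show "nodes_of ?p \<inter> S \<times> UNIV = {}" "nodes_of ?q \<inter> S \<times> UNIV = {}"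
        using r wS by (auto simp: nodes_of_def out_node_def in_node_def)
      show "sg ?q = - sg ?p" using sg_stub[OF r(1) w] sg_edge[OF w] by simp
      \<comment> \<open>\<open>pot\<close> vanishes at a source, and the end term of the stub
        cancels \<open>2 * sg ?q\<close>.\<close>
      show "wt ?p + wt ?q = 2 * sg ?q + en ?p + en ?q"
        using wt_edge[OF w] en_edge[OF w] pot_source[OF r(1)] not_HV[OF H] by (simp add: wt_def en_def)
      show "{?p, ?q} \<times> {?p, ?q} \<subseteq> linked" using linked_out by auto
    qed (use cut_sub entered_sub in auto)
    then have "arcs (insert ?p (insert ?q (cut S))) (insert ?p (insert ?q (entered S))) (insert (r, True) (insert (r, False) (S \<times> UNIV)))
       (\<mu>(?p := ?q, ?q := ?p)) (P(?p := {?p, ?q}, ?q := {?p, ?q}))"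
      by (rule arcs_skip) (use deg in \<open>auto simp: nodes_of_iff\<close>)
    moreover have "cut (insert r S) = insert ?p (insert ?q (cut S))"
      using wU in_r w stub wS by (auto simp: cut_def stubs_def)
    moreover have "entered (insert r S) = insert ?p (insert ?q (entered S))"
      using wU w stub by (auto simp: entered_def stubs_def)
    ultimately show ?thesis unfolding Times_insert by metis
  qed
qed

text \<open>An entering H-edge is at the height of \<open>v\<close> and an entering V-edge above it;
  a leaving H-edge is at that height and a leaving V-edge below it. By \<open>crossing_key\<close>
  no other open end comes between, so two entering edges can be joined, two leaving edges created,
  and one of each is a prolongation.\<close>

lemma sweep_inner:
  assumes S: "prefix_set S" and S': "prefix_set (insert v S)" and v: "v \<in> inner G" "v \<notin> S"
    and bef: "\<And>w. w \<in> S \<Longrightarrow> before w v"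
    and A: "arcs (cut S) (entered S) (S \<times> UNIV) \<mu> P"
  shows "\<exists>\<mu> P. arcs (cut (insert v S)) (entered (insert v S)) (insert v S \<times> UNIV) \<mu> P"
proof -
  define Iv Ov where "Iv = {e \<in> U. snd e = v}" and "Ov = {e \<in> U. fst e = v}"
  have vV: "v \<in> V" "v \<notin> sources G" "v \<notin> sinks G" using v by (auto simp: inner_iff)
  have inU: "e \<in> U \<and> e \<in> E \<and> e = (fst e, v) \<and> fst e \<in> S \<and> e \<in> cut S \<and> fst e \<noteq> v" if "e \<in> Iv" for e
  proof -
    have e: "e \<in> U" "e \<in> E" "snd e = v" "fst e \<noteq> v" using that U_sub U_neq[of e] by (auto simp: Iv_def)
    then have "fst e \<in> insert v S" using prefix_edge[OF S', of "fst e" v] by (metis insertI1 prod.collapse)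
    then show ?thesis using e v by (auto simp: cut_def)
  qed
  have outU: "e \<in> U \<and> e \<in> E \<and> e = (v, snd e) \<and> snd e \<notin> S \<and> snd e \<noteq> v" if "e \<in> Ov" for e
  proof -
    have e: "e \<in> U" "e \<in> E" "fst e = v" "snd e \<noteq> v" using that U_sub U_neq[of e] by (auto simp: Ov_def)
    then have "snd e \<notin> S" using prefix_edge[OF S, of v "snd e"] v by (metis prod.collapse)
    then show ?thesis using e by auto
  qed
  have nostub: "fst e \<noteq> v" "snd e \<noteq> v" if "e \<in> stubs" for e using stubsD[OF that] vV by auto
  have cut': "cut (insert v S) = (cut S - Iv) \<union> Ov"
  proof (intro subset_antisym subsetI)
    fix e assume "e \<in> cut (insert v S)"
    then show "e \<in> (cut S - Iv) \<union> Ov" using nostub[of e] by (auto simp: cut_def Iv_def Ov_def)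
  next
    fix e assume "e \<in> (cut S - Iv) \<union> Ov"
    then show "e \<in> cut (insert v S)" using outU[of e] nostub[of e] by (auto simp: cut_def Iv_def Ov_def)
  qed
  have ent': "entered (insert v S) = entered S \<union> Ov"
    by (rule set_eqI) (use nostub in \<open>auto simp: entered_def Ov_def simp del: split_paired_All\<close>)
  have Ov_new: "e \<in> U \<union> stubs - entered S \<and> e \<notin> cut S \<and> nodes_of e \<inter> S \<times> UNIV = {}" if "e \<in> Ov" for e
  proof -
    have "fst e = v" using that by (simp add: Ov_def)
    then show ?thesis using outU[OF that] v by (auto simp: entered_def cut_def nodes_of_def out_node_def in_node_def)
  qed
  \<comment> \<open>An open end away from \<open>v\<close> compares with every edge at
    \<open>v\<close> as it does with the height \<open>2 * py v\<close>.\<close>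
  have sep: "key x \<noteq> 2 * py v \<and> (\<forall>e\<in>Iv \<union> Ov. key x \<noteq> key e \<and> (key x < key e \<longleftrightarrow> key x < 2 * py v))"
    if x: "x \<in> cut S - Iv" for x
  proof (cases "x \<in> stubs")
    case True
    have "key e < key x" if "e \<in> Iv \<union> Ov" for e
    proof -
      have "e \<in> E" using that inU outU by blast
      then show ?thesis by (rule key_edge_less_stub[OF _ True])
    qed
    moreover have "key x = 2 * Max (py ` V) + exp (- py (fst x))" using stubsD[OF True] by (simp add: key_def)
    moreover have "0 < exp (- py (fst x))" by simp
    ultimately show ?thesis using py_le_Max[OF vV(1)] by fastforce
  next
    case False
    then have xU: "x \<in> U" "fst x \<in> S" "snd x \<notin> S" using x by (auto simp: cut_def)
    have xE: "(fst x, snd x) \<in> E" using xU U_sub by auto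
    have ne: "fst x \<noteq> v" "snd x \<noteq> v" using x xU v by (auto simp: Iv_def)
    \<comment> \<open>A head before \<open>v\<close> that is not a sink would already have been
      passed, and the edge would not be open.\<close>
    have 2: "snd x \<in> sinks G \<or> before v (snd x)"
    proof (rule ccontr)
      assume c: "\<not> ?thesis"
      then have "before (snd x) v" using before_total[of "snd x" v] edge_verts[OF xE] vV ne by auto
      then have "snd x \<in> insert v S" using S' c edge_verts[OF xE] unfolding prefix_set_def by blast
      then show False using xU ne by auto
    qed
    note ck = crossing_key[OF xU(1) bef[OF xU(2)] 2 v(1) ne]
    have "key x \<noteq> key e \<and> (key x < key e \<longleftrightarrow> key x < 2 * py v)" if e: "e \<in> Iv \<union> Ov" for e
    proof (cases "e \<in> Iv")
      case True
      then have "e \<in> E" "e = (fst e, v)" using inU by blast+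
      then show ?thesis using ck(2)[of "fst e"] by metis
    next
      case False
      then have "e \<in> E" "e = (v, snd e)" using outU e by blast+
      then show ?thesis using ck(3)[of "snd e"] by metis
    qed
    then show ?thesis using ck(1) by blast
  qed
  have at: "{e \<in> U \<union> stubs. (v, b) \<in> nodes_of e} = {e. e \<in> Ov \<and> b = (udeg U v = 4) \<or> e \<in> Iv \<and> \<not> b}" for b
    by (rule set_eqI) (use nostub in \<open>auto simp: nodes_of_iff Iv_def Ov_def simp del: split_paired_All\<close>)
  have deg: "udeg U v = card Iv + card Ov" unfolding Iv_def Ov_def by (rule udeg_split)
  have key_in: "H_edge G e \<Longrightarrow> key e = 2 * py v" "V_edge G e \<Longrightarrow> 2 * py v < key e" if "e \<in> Iv" for e
    using inU[OF that] key_H_in[of "fst e" v] key_V_in[of "fst e" v] v(1) by metis+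
  have key_out: "H_edge G e \<Longrightarrow> key e = 2 * py v" "V_edge G e \<Longrightarrow> key e < 2 * py v" if "e \<in> Ov" for e
    using outU[OF that] key_H_out[of v "snd e"] key_V_out[of v "snd e"] by metis+
  have do_join: "\<exists>\<mu>' P'. arcs (cut S - {h, w}) (entered S) (insert (v, False) (S \<times> UNIV)) \<mu>' P'"
    if "Iv = {h, w}" "H_edge G h" "V_edge G w" "colour w = - colour h" "Ov = {} \<or> udeg U v = 4" for h w
  proof (rule arcs_join[OF A])
    have hw: "h \<in> Iv" "w \<in> Iv" using that by auto
    have e: "h \<in> U" "w \<in> U" "snd h = v" "snd w = v" using hw by (auto simp: Iv_def)
    show "entered S \<subseteq> U \<union> stubs" by (rule entered_sub)
    show "h \<in> cut S" "w \<in> cut S" using inU hw by blast+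
    show "key h < key w" using key_in(1)[OF hw(1)] key_in(2)[OF hw(2)] that by simp
    show "\<not> (key h < key r \<and> key r < key w)" if "r \<in> cut S" for r
    proof (cases "r \<in> Iv")
      case True
      then show ?thesis using \<open>Iv = {h, w}\<close> by auto
    next
      case False
      then show ?thesis using sep[of r] hw that key_in(1)[OF hw(1) \<open>H_edge G h\<close>] by auto
    qed
    show "{e \<in> U \<union> stubs. (v, False) \<in> nodes_of e} = {h, w}"
      unfolding at using that by auto
    show "sg w = - sg h" using e that by (simp add: sg_edge)
    \<comment> \<open>\<open>pot v\<close> occurs with opposite colours and cancels; the
      \<open>2\<close> of the V-edge remains.\<close>
    show "en h + en w = 2 * sg w" using e that not_HV[of h] by (simp add: sg_edge en_edge algebra_simps)
    show "{h, w} \<times> {h, w} \<subseteq> linked" using linked_in e by auto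
  qed
  \<comment> \<open>In degree 4 the creation takes place at the second node
    \<open>(v, True)\<close>, after the join at \<open>(v, False)\<close>; otherwise it takes place
    at \<open>(v, False)\<close>.\<close>
  have do_create: "\<exists>\<mu>' P'. arcs (insert w (insert h C)) (insert w (insert h (entered S))) (insert (v, b) N) \<mu>' P'"
    if "arcs C (entered S) N \<mu>0 P0" "C = cut S - Iv" "(N = S \<times> UNIV \<and> \<not> b \<and> Iv = {} \<and> udeg U v \<noteq> 4) \<or> (N = insert (v, False) (S \<times> UNIV) \<and> b \<and> udeg U v = 4)"
      "Ov = {h, w}" "H_edge G h" "V_edge G w" "colour w = - colour h" for h w C N b \<mu>0 P0
  proof -
    have hw: "h \<in> Ov" "w \<in> Ov" using that by auto
    have e: "h \<in> U" "w \<in> U" "fst h = v" "fst w = v" using hw by (auto simp: Ov_def)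
    have k: "key h = 2 * py v" "key w < 2 * py v" using key_out(1)[OF hw(1)] key_out(2)[OF hw(2)] that by auto
    have "arcs (insert w (insert h C)) (insert w (insert h (entered S))) (insert (v, b) N) (\<mu>0(w := h, h := w)) (P0(w := {w, h}, h := {w, h}))"
    proof (rule arcs_create[OF that(1)])
      show "entered S \<subseteq> U \<union> stubs" by (rule entered_sub)
      show "w \<in> U \<union> stubs - entered S" "h \<in> U \<union> stubs - entered S" using Ov_new hw by blast+
      show "C \<subseteq> entered S" using that(2) cut_sub by blast
      show "key w < key h" using k by simp
      show "\<And>r. r \<in> C \<Longrightarrow> key r \<noteq> key w \<and> key r \<noteq> key h" using sep hw that(2) by blast
      show "(\<forall>r\<in>C. \<not> (key w < key r \<and> key r < key h)) \<or> (\<forall>r\<in>C. key w < key r \<and> key r < key h)"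
        using sep hw that(2) k by (smt (verit, best) UnI2)
      show "{e \<in> U \<union> stubs. (v, b) \<in> nodes_of e} = {w, h}"
        unfolding at using that(3,4) by auto
      have "snd h \<noteq> v" "snd w \<noteq> v" using outU hw by blast+
      then have n: "(v, False) \<notin> nodes_of h" "(v, False) \<notin> nodes_of w" if "udeg U v = 4"
        using that by (auto simp: nodes_of_iff)
      show "nodes_of w \<inter> N = {}" "nodes_of h \<inter> N = {}"
        using that(3) Ov_new[OF hw(1)] Ov_new[OF hw(2)] n by blast+
      show "sg h = - sg w" using e that by (simp add: sg_edge)
      \<comment> \<open>\<open>pot v\<close> cancels between the two weights, and the
        \<open>2\<close> in the end term of the V-edge cancels \<open>2 * sg h\<close>.\<close>
      show "wt w + wt h = 2 * sg h + en w + en h"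
        using e that(5,6,7) not_HV[of h] by (simp add: sg_edge en_edge wt_edge algebra_simps)
      show "{w, h} \<times> {w, h} \<subseteq> linked" using linked_out e by auto
    qed
    then show ?thesis by blast
  qed
  have skip: "\<exists>\<mu>' P'. arcs C D (insert (v, True) N) \<mu>' P'" if "arcs C D N \<mu>0 P0" "udeg U v \<noteq> 4" for C D N \<mu>0 P0
    using arcs_skip[OF that(1), of "(v, True)"] at[of True] that(2) by blast
  have finI: "finite Iv" "finite Ov" using finite_U by (auto simp: Iv_def Ov_def)
  note cc = config_cases[OF v(1), folded Iv_def Ov_def]
  show ?thesis
    unfolding cut' ent' Times_insert using cc
  proof cases
    case none
    then have d: "udeg U v \<noteq> 4" using deg by simp
    have "arcs (cut S) (entered S) (insert (v, False) (S \<times> UNIV)) \<mu> P"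
      by (rule arcs_skip[OF A]) (use at[of False] none in blast)
    then show "\<exists>\<mu> P. arcs (cut S - Iv \<union> Ov) (entered S \<union> Ov) (insert (v, True) (insert (v, False) (S \<times> UNIV))) \<mu> P"
      using skip d none by simp
  next
    case (pass b a)
    then have d: "udeg U v \<noteq> 4" using deg by simp
    have ab: "a \<in> Iv" "b \<in> Ov" using pass by auto
    have e: "a \<in> U" "b \<in> U" "snd a = v" "fst b = v" "a \<in> E" "b \<in> E" using ab U_sub by (auto simp: Iv_def Ov_def)
    have "\<exists>\<mu>' P'. arcs (insert b (cut S - {a})) (insert b (entered S)) (insert (v, False) (S \<times> UNIV)) \<mu>' P'"
    proof (rule arcs_replace[OF A])
      show "entered S \<subseteq> U \<union> stubs" by (rule entered_sub)
      show "a \<in> cut S" using inU ab by blast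
      show "b \<in> U \<union> stubs - entered S" using Ov_new ab by blast
      show "cut S \<subseteq> entered S" by (rule cut_sub)
      show "key r \<noteq> key b \<and> (key r < key a \<longleftrightarrow> key r < key b)" if "r \<in> cut S" "r \<noteq> a" for r
        using sep[of r] that ab pass by auto
      show "{e \<in> U \<union> stubs. (v, False) \<in> nodes_of e} = {a, b}" unfolding at using d pass by auto
      show "nodes_of b \<inter> S \<times> UNIV = {}" using Ov_new ab by blast
      show "sg b = sg a" using e pass by (simp add: sg_edge)
      show "wt b = en b - en a"
      proof -
        \<comment> \<open>The turn at \<open>v\<close> expressed by V-edges instead of H-edges, as
          the end terms require.\<close>
        have *: "of_bool (V_edge G b) = pot v + of_bool (V_edge G a)"
          using pass(4) not_H[OF e(5)] not_H[OF e(6)] by (cases "H_edge G a"; cases "H_edge G b") (auto dest: not_HV)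
        show ?thesis
          unfolding wt_edge[OF e(2)] en_edge[OF e(1)] en_edge[OF e(2)] e(3,4) pass(3) * ring_distribs by linarith
      qed
      show "{a, b} \<times> {a, b} \<subseteq> linked"
        using linked_pass[of a b] e d linked_out[of a a] linked_out[of b b] by auto
    qed
    then show "\<exists>\<mu> P. arcs (cut S - Iv \<union> Ov) (entered S \<union> Ov) (insert (v, True) (insert (v, False) (S \<times> UNIV))) \<mu> P"
      using skip d pass by auto
  next
    case (join h w)
    have "h \<noteq> w" using join not_HV by blast
    then have d: "udeg U v \<noteq> 4" using deg join by simp
    have "\<exists>\<mu>' P'. arcs (cut S - {h, w}) (entered S) (insert (v, False) (S \<times> UNIV)) \<mu>' P'"
      using do_join[OF join(1,3-5)] join(2) by blast
    then show "\<exists>\<mu> P. arcs (cut S - Iv \<union> Ov) (entered S \<union> Ov) (insert (v, True) (insert (v, False) (S \<times> UNIV))) \<mu> P"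
      using skip d join by auto
  next
    case (create h w)
    have "h \<noteq> w" using create not_HV by blast
    then have d: "udeg U v \<noteq> 4" using deg create by simp
    have "\<exists>\<mu>' P'. arcs (insert w (insert h (cut S))) (insert w (insert h (entered S))) (insert (v, False) (S \<times> UNIV)) \<mu>' P'"
      using do_create[OF A _ _ create(2-5), of False] create(1) d by auto
    moreover have "cut S - Iv \<union> Ov = insert w (insert h (cut S))" "entered S \<union> Ov = insert w (insert h (entered S))"
      using create by auto
    ultimately show "\<exists>\<mu> P. arcs (cut S - Iv \<union> Ov) (entered S \<union> Ov) (insert (v, True) (insert (v, False) (S \<times> UNIV))) \<mu> P"
      using skip d by metis
  next
    case (join_create h w h' w')
    have "h \<noteq> w" "h' \<noteq> w'" using join_create not_HV by blast+
    then have d: "udeg U v = 4" using deg join_create by simp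
    obtain \<mu>1 P1 where 1: "arcs (cut S - {h, w}) (entered S) (insert (v, False) (S \<times> UNIV)) \<mu>1 P1"
      using do_join[OF join_create(1,3-5)] d by blast
    have "\<exists>\<mu>' P'. arcs (insert w' (insert h' (cut S - {h, w}))) (insert w' (insert h' (entered S))) (insert (v, True) (insert (v, False) (S \<times> UNIV))) \<mu>' P'"
      using do_create[OF 1 _ _ join_create(2,6-8), of True] join_create(1) d by auto
    moreover have "cut S - Iv \<union> Ov = insert w' (insert h' (cut S - {h, w}))" "entered S \<union> Ov = insert w' (insert h' (entered S))"
      using join_create by auto
    ultimately show "\<exists>\<mu> P. arcs (cut S - Iv \<union> Ov) (entered S \<union> Ov) (insert (v, True) (insert (v, False) (S \<times> UNIV))) \<mu> P"
      by metis
  qed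
qed

text \<open>\<open>rank\<close> increases strictly along \<open>before\<close>, so a vertex of
  largest rank in a prefix comes last, and removing it leaves a prefix.\<close>

lemma sweep:
  assumes "prefix_set S"
  shows "\<exists>\<mu> P. arcs (cut S) (entered S) (S \<times> UNIV) \<mu> P"
proof -
  have "finite S" using assms finite_verts unfolding prefix_set_def by (meson finite_Diff finite_subset)
  then show ?thesis using assms
  proof (induction S rule: finite_ranking_induct[where f = rank])
    case empty
    have "cut {} = {}" "entered {} = {}" by (auto simp: cut_def entered_def)
    then show ?case using arcs_empty by auto
  next
    case (insert v S)
    show ?case
    proof (cases "v \<in> S")
      case True
      then show ?thesis using insert by (simp add: insert_absorb)
    next
      case False
      have V: "w \<in> V" "w \<notin> sinks G" if "w \<in> insert v S" for w using insert.prems that unfolding prefix_set_def by blast+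
      have bef: "before w v" if "w \<in> S" for w
      proof -
        have "\<not> before v w" using before_rank[of v w] insert.hyps(2)[OF that] V that by fastforce
        then show ?thesis using before_total[of w v] V that False by blast
      qed
      have "\<not> before v w" if "w \<in> S" for w using bef[OF that] by (auto simp: before_def)
      then have S: "prefix_set S" using insert.prems unfolding prefix_set_def by blast
      obtain \<mu> P where A: "arcs (cut S) (entered S) (S \<times> UNIV) \<mu> P" using insert.IH[OF S] by blast
      show ?thesis
      proof (cases "v \<in> sources G")
        case True
        then show ?thesis using sweep_source[OF S True False bef A] by blast
      next
        case v: False
        then have "v \<in> inner G" using V[of v] by (simp add: inner_iff)
        then show ?thesis using sweep_inner[OF S insert.prems _ False bef A] by blast
      qed
    qed
  qed
qed

section \<open>The arcs left after the sweep\<close>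

definition ends :: "('v \<times> 'v) set" where
  "ends = {e \<in> U. snd e \<in> sinks G} \<union> stubs"

definition component :: "'v \<times> 'v \<Rightarrow> ('v \<times> 'v) set" where
  "component p = {e \<in> U. (p, e) \<in> linked}"

text \<open>The colour of the edge of \<open>U\<close> at the end; for a stub this is the edge at
  its source, whose sign is opposite to that of the stub.\<close>

definition flux :: "'v \<times> 'v \<Rightarrow> int" where
  "flux e = (if e \<in> stubs then - sg e else sg e)"

text \<open>After all other vertices have been passed, an arc is closed at every node: at the passed
  ones by the invariant, at a sink because only one edge enters it. With its stubs it is therefore a
  whole component, and linked ends are partners.\<close>

lemma component_ends:
  assumes pq: "p \<in> ends" "q \<in> ends" "p \<noteq> q" "(p, q) \<in> linked"
  shows "sg q = - sg p" "sum wt (component p) = 2 * sg (upper key p q) + en p + en q"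
    "{e \<in> component p. snd e \<in> sinks G} = {p, q} - stubs"
    "e \<in> component p \<Longrightarrow> fst e \<in> sources G \<Longrightarrow> (fst e, fst e) \<in> {p, q}"
    "(r, r) \<in> {p, q} \<Longrightarrow> (r, w) \<in> U \<Longrightarrow> (r, w) \<in> component p"
proof -
  let ?S = "V - sinks G"
  have "prefix_set ?S" by (simp add: prefix_set_def)
  then obtain \<mu> P where A: "arcs (cut ?S) (entered ?S) (?S \<times> UNIV) \<mu> P" using sweep by blast
  have inS: "fst e \<in> ?S" if "e \<in> U \<union> stubs" for e
  proof (cases "e \<in> stubs")
    case True
    then show ?thesis using stubsD[OF True] sources_sub source_not_sink by auto
  next
    case False
    then have "e \<in> E" using that U_sub by auto
    then show ?thesis using edge_verts[of "fst e" "snd e"] no_edge_from_sink[of e] by auto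
  qed
  have sndV: "snd e \<in> V" if "e \<in> U" for e using that U_sub edge_verts[of "fst e" "snd e"] by auto
  have C: "cut ?S = ends"
  proof (rule set_eqI)
    fix e
    show "e \<in> cut ?S \<longleftrightarrow> e \<in> ends" using inS[of e] sndV[of e] by (auto simp: cut_def ends_def)
  qed
  note d = arcsD[OF A[unfolded C]]
  have endsU: "e \<in> U \<union> stubs" if "e \<in> ends" for e using that by (auto simp: ends_def)
  have PU: "P p \<subseteq> U \<union> stubs" using d(7)[OF pq(1)] entered_sub by blast
  have closed: "e' \<in> P p" if e: "e \<in> P p" "e' \<in> U \<union> stubs" "m \<in> nodes_of e" "m \<in> nodes_of e'" for e e' m
  proof (cases "fst m \<in> ?S")
    case True
    then have "m \<in> ?S \<times> UNIV" by (cases m) auto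
    then show ?thesis using d(10)[OF pq(1) e(1,2,3,4)] by blast
  next
    case False
    have *: "x \<in> U \<and> snd x = fst m" if "x \<in> U \<union> stubs" "m \<in> nodes_of x" for x
    proof -
      have "fst m = fst x \<or> fst m = snd x" using that(2) by (auto simp: nodes_of_def out_node_def in_node_def)
      then have "fst m = snd x" "snd x \<noteq> fst x" using inS[OF that(1)] False by auto
      then show ?thesis using that(1) stubsD[of x] by auto
    qed
    have x: "e \<in> U" "e' \<in> U" "snd e = fst m" "snd e' = fst m" using *[of e] *[of e'] e PU by auto
    then have "fst m \<in> sinks G" using sndV[of e] False by auto
    then have "V_edge G (fst e, fst m)" "V_edge G (fst e', fst m)"
      using x U_sub sink_edge_V[of e] sink_edge_V[of e'] by (metis prod.collapse subsetD)+
    then have "e' = e" using V_in_unique x by (metis prod.collapse)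
    then show ?thesis using e by simp
  qed
  have reach: "\<exists>e\<in>P p. m \<in> nodes_of e" if "(out_node U (fst p), m) \<in> split_conn U" for m
    using that unfolding split_conn_def
  proof (induction rule: rtrancl_induct)
    case base
    then show ?case using d(5)[OF pq(1)] by (auto simp: nodes_of_def)
  next
    case (step m n)
    then obtain e e' where e: "e \<in> P p" "m \<in> nodes_of e" "e' \<in> U" "m \<in> nodes_of e'" "n \<in> nodes_of e'"
      unfolding split_adj_def nodes_of_def by blast
    then show ?case using closed[OF e(1) _ e(2,4)] by blast
  qed
  have in_P: "e \<in> P p" if pe: "(p, e) \<in> linked" "e \<in> U \<union> stubs" for e
  proof -
    obtain e' where "e' \<in> P p" "out_node U (fst e) \<in> nodes_of e'" using reach[of "out_node U (fst e)"] pe(1) unfolding linked_def by blast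
    then show ?thesis using closed[of e' e] pe(2) by (auto simp: nodes_of_def)
  qed
  \<comment> \<open>Arcs of different pairs are disjoint, so an arc contains no ends but its own
    two.\<close>
  have P_ends: "e \<in> {p, \<mu> p}" if "e \<in> ends" "e \<in> P p" for e
    using d(9)[OF pq(1) that(1)] d(5)[OF that(1)] that(2) by auto
  have mu: "\<mu> p = q" using P_ends[OF pq(2)] in_P[OF pq(4)] endsU[OF pq(2)] pq(3) by auto
  have K: "component p = P p - stubs"
    using in_P d(11)[OF pq(1) d(5)[OF pq(1)]] PU by (auto simp: component_def dest: U_neq stubsD)
  show "sg q = - sg p" using d(4)[OF pq(1)] mu by simp
  have "sum wt (component p) = sum wt (P p)"
    unfolding K using d(6)[OF pq(1)] by (intro sum.mono_neutral_left) (auto simp: wt_def dest: stubsD)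
  then show "sum wt (component p) = 2 * sg (upper key p q) + en p + en q"
    using d(12)[OF pq(1)] mu by simp
  show "{e \<in> component p. snd e \<in> sinks G} = {p, q} - stubs"
  proof (intro subset_antisym subsetI)
    fix e assume "e \<in> {e \<in> component p. snd e \<in> sinks G}"
    then show "e \<in> {p, q} - stubs" using P_ends[of e] mu K PU by (auto simp: ends_def)
  next
    fix e assume "e \<in> {p, q} - stubs"
    then show "e \<in> {e \<in> component p. snd e \<in> sinks G}"
      using pq(1,2) d(5)[OF pq(1)] d(5)[OF pq(2)] d(8)[OF pq(1)] mu K by (auto simp: ends_def)
  qed
  show "(fst e, fst e) \<in> {p, q}" if e: "e \<in> component p" "fst e \<in> sources G"
  proof -
    have "(fst e, snd e) \<in> U" using e by (simp add: component_def)
    then have s: "(fst e, fst e) \<in> stubs" using e(2) unfolding stubs_def by blast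
    have "e \<in> P p" using e K by blast
    moreover have "out_node U (fst e) \<in> nodes_of e" "out_node U (fst e) \<in> nodes_of (fst e, fst e)" by (auto simp: nodes_of_def)
    ultimately have "(fst e, fst e) \<in> P p" using closed s by blast
    then show ?thesis using P_ends[of "(fst e, fst e)"] s mu by (auto simp: ends_def)
  qed
  show "(r, w) \<in> component p" if r: "(r, r) \<in> {p, q}" "(r, w) \<in> U"
  proof -
    have "q \<in> P p" using d(5)[OF pq(2)] d(8)[OF pq(1)] mu by simp
    then have "(r, r) \<in> P p" using r(1) d(5)[OF pq(1)] by (metis insertE singletonD)
    moreover have "out_node U r \<in> nodes_of (r, r)" "out_node U r \<in> nodes_of (r, w)" by (auto simp: nodes_of_def)
    ultimately have "(r, w) \<in> P p" using closed r(2) by blast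
    then show ?thesis using K stubsD[of "(r, w)"] U_neq[OF r(2)] by auto
  qed
qed

text \<open>The local formula gives minus the weight of the component plus the fluxes at its two
  ends. Each end term in the weight is twice the flux, so the fluxes finally appear with a minus
  sign.\<close>

lemma Lam_component:
  assumes pq: "p \<in> ends" "q \<in> ends" "p \<noteq> q" "(p, q) \<in> linked"
    and bal: "balanced (\<lambda>e. ind (component p) e * colour e)"
  shows "Lam G (hsum (\<lambda>e. ind (component p) e * colour e)) (hsum (\<lambda>e. ind F e + ind F' e))
     = - 2 * sg (upper key p q) - (flux p + flux q)"
proof -
  let ?K = "component p" and ?c = "\<lambda>e. ind (component p) e * colour e"
  note ce = component_ends[OF pq]
  have KU: "?K \<subseteq> U" by (auto simp: component_def)
  then have KE: "?K \<subseteq> E" and fK: "finite ?K" using U_sub finite_U finite_subset by blast+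
  \<comment> \<open>An edge of \<open>U\<close> lies in exactly one of the two flows.\<close>
  have one: "?c e * (ind F e + ind F' e) = ?c e" for e
    using KU by (auto simp: symdiff_def)
  have bF: "balanced (\<lambda>e. ind F e + ind F' e)"
    by (intro balanced_add edge_flowD(2) flowF flowF')
  have restrict: "(\<Sum>e\<in>{e\<in>E. Q e}. ?c e) = (\<Sum>e\<in>{e\<in>?K. Q e}. colour e)" for Q
    using KE finite_edges by (intro sum.mono_neutral_cong_right) auto
  have "(\<Sum>e\<in>E. ?c e * (pot (fst e) + pot (snd e))) = (\<Sum>e\<in>?K. colour e * (pot (fst e) + pot (snd e)))"
    using KE finite_edges by (intro sum.mono_neutral_cong_right) auto
  also have "\<dots> = sum wt ?K" by (rule sum.cong) (use KU wt_edge in auto)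
  finally have W: "(\<Sum>e\<in>E. ?c e * (pot (fst e) + pot (snd e))) = 2 * sg (upper key p q) + en p + en q"
    using ce(2) by simp
  have T: "(\<Sum>e\<in>{e\<in>?K. snd e \<in> sinks G}. colour e) = (\<Sum>x\<in>{p, q} - stubs. sg x)"
    unfolding ce(3) by (rule sum.cong) (use pq(1,2) sg_edge in \<open>auto simp: ends_def\<close>)
  \<comment> \<open>Each stub is matched with the edge of \<open>U\<close> leaving its source;
    \<open>SOME\<close> picks this edge, which is unique.\<close>
  have S: "(\<Sum>e\<in>{e\<in>?K. fst e \<in> sources G}. colour e) = (\<Sum>x\<in>{p, q} \<inter> stubs. - sg x)"
  proof (rule sum.reindex_bij_witness[of _ "\<lambda>x. (fst x, SOME w. (fst x, w) \<in> U)" "\<lambda>e. (fst e, fst e)"])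
    fix e assume e: "e \<in> {e\<in>?K. fst e \<in> sources G}"
    then have eU: "(fst e, snd e) \<in> U" "fst e \<in> sources G" using KU by auto
    have "(SOME w. (fst e, w) \<in> U) = snd e"
      using out_U_unique[OF eU(2)] someI[of "\<lambda>w. (fst e, w) \<in> U", OF eU(1)] eU(1) by blast
    then show "(fst (fst e, fst e), SOME w. (fst (fst e, fst e), w) \<in> U) = e" by simp
    have "(fst e, fst e) \<in> stubs" using eU unfolding stubs_def by blast
    then show "(fst e, fst e) \<in> {p, q} \<inter> stubs" using ce(4)[of e] e by blast
    show "- sg (fst e, fst e) = colour e" using sg_stub[OF eU(2,1)] by simp
  next
    fix x assume x: "x \<in> {p, q} \<inter> stubs"
    then have st: "fst x = snd x" "fst x \<in> sources G" "\<exists>v. (fst x, v) \<in> U" using stubsD by blast+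
    show "(fst (fst x, SOME w. (fst x, w) \<in> U), fst (fst x, SOME w. (fst x, w) \<in> U)) = x" using st by (simp add: prod_eq_iff)
    have "(fst x, SOME w. (fst x, w) \<in> U) \<in> U" using someI_ex[OF st(3)] .
    moreover have "(fst x, fst x) \<in> {p, q}" using x st(1) by (metis IntD1 prod.collapse)
    ultimately show "(fst x, SOME w. (fst x, w) \<in> U) \<in> {e\<in>?K. fst e \<in> sources G}" using ce(5) st(2) by simp
  qed
  have L: "Lam G (hsum ?c) (hsum (\<lambda>e. ind F e + ind F' e))
    = - (2 * sg (upper key p q) + en p + en q) + (\<Sum>x\<in>{p, q} \<inter> stubs. - sg x) + (\<Sum>x\<in>{p, q} - stubs. sg x)"
    unfolding Lam_hsum_hsum[OF bal bF] one unfolding pot_def[symmetric] W restrict S T ..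
  have "(\<Sum>x\<in>{p, q} \<inter> stubs. - sg x) + (\<Sum>x\<in>{p, q} - stubs. sg x) = flux p + flux q"
    using pq(3) by (cases "p \<in> stubs"; cases "q \<in> stubs") (auto simp: flux_def insert_Diff_if Int_insert_left)
  with L have *: "Lam G (hsum ?c) (hsum (\<lambda>e. ind F e + ind F' e))
    = - (2 * sg (upper key p q) + en p + en q) + (flux p + flux q)" by simp
  have "en x = 2 * flux x" if "x \<in> ends" for x
  proof (cases "x \<in> stubs")
    case True
    then show ?thesis using stubsD[OF True] by (simp add: en_def flux_def)
  next
    case False
    then have x: "x \<in> U" "snd x \<in> sinks G" using that by (auto simp: ends_def)
    then have "V_edge G x" using sink_edge_V U_sub by blast
    then show ?thesis using False en_edge[OF x(1)] sg_edge[OF x(1)] pot_sink[OF x(2)] by (simp add: flux_def)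
  qed
  then show ?thesis unfolding * using pq(1,2) by simp
qed

lemma key_stub_less:
  assumes "i \<in> {1..nsrc G}" "i' \<in> {1..nsrc G}" "i < i'"
  shows "key (src G i', src G i') < key (src G i, src G i)"
  using src_order[OF assms(1,2)] assms(3) by (simp add: key_def)

lemma key_sink_less:
  assumes "(u, snk G j) \<in> U" "(u', snk G j') \<in> U" "j \<in> {1..nsnk G}" "j' \<in> {1..nsnk G}" "j < j'"
  shows "key (u, snk G j) < key (u', snk G j')"
proof -
  have "u \<noteq> snk G j" "u' \<noteq> snk G j'" using assms U_neq by fastforce+
  moreover have "snk G j \<in> sinks G" "snk G j' \<in> sinks G" using assms by (auto simp: sinks_def)
  ultimately show ?thesis using snk_order[OF assms(3,4)] assms(5) by (simp add: key_def)
qed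

end

section \<open>From the local formula to the exchange identity\<close>

lemma weyl_exchange:
  assumes "q \<noteq> 0" "weyl G q X a 0" "weyl G q X' a' 0" "weyl G q Y (\<lambda>x. a x + d x) 0" "weyl G q Y' (\<lambda>x. a' x - d x) 0"
    and L: "Lam G d (\<lambda>x. a x + a' x) = - 2 * k"
  shows "qmult G q X X' = smul (q powi k) (qmult G q Y Y')"
proof (rule weyl_compare[OF assms(1)])
  show "weyl G q (qmult G q X X') (\<lambda>x. a x + a' x) (Lam G a a')"
    using weyl_mult[OF assms(1,2,3)] by simp
  have e: "(\<lambda>x. (a x + d x) + (a' x - d x)) = (\<lambda>x. a x + a' x)" by auto
  show "weyl G q (qmult G q Y Y') (\<lambda>x. a x + a' x) (Lam G (\<lambda>x. a x + d x) (\<lambda>x. a' x - d x))"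
    using weyl_mult[OF assms(1,4,5)] unfolding e by simp
  have "Lam G b (\<lambda>x. a' x - d x) = Lam G b a' - Lam G b d" for b
    using Lam_add_right[of G b "\<lambda>x. a' x - d x" d] by simp
  \<comment> \<open>In the expansion \<open>Lam G a a'\<close> cancels and \<open>Lam G d d\<close>
    vanishes by skewness, which leaves \<open>- Lam G d\<close> applied to the sum of
    \<open>a\<close> and \<open>a'\<close>.\<close>
  then show "Lam G a a' - Lam G (\<lambda>x. a x + d x) (\<lambda>x. a' x - d x) = 2 * k"
    using L Lam_skew[of G a d] Lam_skew[of G d d] by (simp add: Lam_add_left Lam_add_right)
qed

lemma smul_one: "smul 1 f = f"
  by (simp add: smul_def)

theorem theorem4p4:
  fixes G :: "('v::linorder) segraph" and q :: "'k::field"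
    and I J I' J' :: "nat set" and phi phi' psi psi' :: "nat \<Rightarrow> 'v list"
    and f g :: "nat + nat"
  assumes "SE_graph G" and "q \<noteq> 0"
    and "is_flow G I J phi" and "is_flow G I' J' phi'"
    and "is_couple G I J phi I' J' phi' f g"
    and "is_flow G (symdiff I (rows_of {f, g})) (symdiff J (cols_of {f, g})) psi"
    and "flow_edges (symdiff I (rows_of {f, g})) psi
           = symdiff (flow_edges I phi) (couple_path G I phi I' phi' f)"
    and "is_flow G (symdiff I' (rows_of {f, g})) (symdiff J' (cols_of {f, g})) psi'"
    and "flow_edges (symdiff I' (rows_of {f, g})) psi'
           = symdiff (flow_edges I' phi') (couple_path G I phi I' phi' f)"
  defines "LHS \<equiv> qmult G q (flow_weight G q I phi) (flow_weight G q I' phi')"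
    and "RHS \<equiv> qmult G q (flow_weight G q (symdiff I (rows_of {f, g})) psi)
                          (flow_weight G q (symdiff I' (rows_of {f, g})) psi')"
  shows
    "(\<forall>a b. f = Inl a \<and> g = Inl b \<and> a < b \<longrightarrow>
        (a \<in> I \<longrightarrow> LHS = smul q RHS) \<and> (a \<in> I' \<longrightarrow> LHS = smul (inverse q) RHS)) \<and>
     (\<forall>a b. f = Inr a \<and> g = Inr b \<and> a < b \<longrightarrow>
        (a \<in> J \<longrightarrow> LHS = smul q RHS) \<and> (a \<in> J' \<longrightarrow> LHS = smul (inverse q) RHS)) \<and>
     ((\<exists>a b. f = Inl a \<and> g = Inr b) \<or> (\<exists>a b. f = Inr a \<and> g = Inl b) \<longrightarrow> LHS = RHS)"
proof -
  interpret se_graph G by unfold_locales (rule assms(1))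
  define F F' where "F = flow_edges I phi" and "F' = flow_edges I' phi'"
  interpret two_edge_flows G F F'
    by unfold_locales (simp_all add: F_def F'_def flow_edge_flow[OF assms(3)] flow_edge_flow[OF assms(4)])
  have Uset: "U_set I phi I' phi' = U" by (simp add: U_set_def F_def F'_def)
  have Y: "f \<in> Yset I J I' J'" "g \<in> Yset I J I' J'" "f \<noteq> g" "(term_node G f, term_node G g) \<in> split_conn U"
    using assms(5) by (auto simp: is_couple_def Uset)
  have I: "I \<subseteq> {1..nsrc G}" "I' \<subseteq> {1..nsrc G}" "J \<subseteq> {1..nsnk G}" "J' \<subseteq> {1..nsnk G}"
    using assms(3,4) by (auto simp: is_flow_def)
  \<comment> \<open>A source in \<open>I\<close> starts an edge of \<open>F\<close>, of colour -1,
    so its stub has sign 1.\<close>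
  have row: "a \<in> {1..nsrc G} \<and> (src G a, src G a) \<in> stubs \<and> (a \<in> I \<longrightarrow> sg (src G a, src G a) = 1) \<and> (a \<in> I' \<longrightarrow> sg (src G a, src G a) = - 1)"
    if a: "Inl a \<in> Yset I J I' J'" for a
  proof -
    have a': "a \<in> symdiff I I'" using a by (auto simp: Yset_def)
    then have an: "a \<in> {1..nsrc G}" using I by (auto simp: symdiff_def)
    then have s: "src G a \<in> sources G" by (auto simp: sources_def)
    note F = flow_source_edge[OF assms(3) an, folded F_def] and F' = flow_source_edge[OF assms(4) an, folded F'_def]
    have "\<exists>v. (src G a, v) \<in> U" using a' F F' by (auto simp: symdiff_def)
    then have "(src G a, src G a) \<in> stubs" using s unfolding stubs_def by blast
    moreover have "sg (src G a, src G a) = (if a \<in> I' then - 1 else 1)" using F' by (simp add: sg_def)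
    moreover have "a \<in> I \<longrightarrow> a \<notin> I'" using a' by (auto simp: symdiff_def)
    ultimately show ?thesis using an by auto
  qed
  \<comment> \<open>At a sink the end is the edge itself, so the signs are the reverse of those for
    rows.\<close>
  have col: "\<exists>u. (u, snk G b) \<in> U \<and> b \<in> {1..nsnk G} \<and> snk G b \<in> sinks G \<and> (b \<in> J \<longrightarrow> sg (u, snk G b) = - 1) \<and> (b \<in> J' \<longrightarrow> sg (u, snk G b) = 1)"
    if b: "Inr b \<in> Yset I J I' J'" for b
  proof -
    have b': "b \<in> symdiff J J'" using b by (auto simp: Yset_def)
    then have bn: "b \<in> {1..nsnk G}" using I by (auto simp: symdiff_def)
    then have s: "snk G b \<in> sinks G" by (auto simp: sinks_def)
    note F = flow_sink_edge[OF assms(3) bn, folded F_def] and F' = flow_sink_edge[OF assms(4) bn, folded F'_def]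
    obtain u where u: "(u, snk G b) \<in> U" using b' F F' by (auto simp: symdiff_def)
    have "b \<in> J' \<longleftrightarrow> (u, snk G b) \<in> F'"
      using u F F' b' by (auto simp: symdiff_def)
    moreover have "b \<in> J \<longrightarrow> b \<notin> J'" using b' by (auto simp: symdiff_def)
    ultimately show ?thesis using u bn s sg_edge[OF u] by (auto simp: colour_def)
  qed
  \<comment> \<open>A row is represented by the stub at its source, a column by the edge whose head
    is its sink.\<close>
  have ex: "\<exists>p. p \<in> ends \<and> (term_node G x, out_node U (fst p)) \<in> split_conn U \<and>
      (\<forall>a. x = Inl a \<longrightarrow> p = (src G a, src G a)) \<and> (\<forall>b. x = Inr b \<longrightarrow> snd p = snk G b \<and> p \<in> U)"
    if x: "x \<in> Yset I J I' J'" for x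
  proof (cases x)
    case (Inl a)
    then have s: "(src G a, src G a) \<in> stubs" using row x by blast
    then obtain v where v: "(src G a, v) \<in> U" "src G a \<in> sources G" using stubsD[OF s] by auto
    have "udeg U (src G a) \<noteq> 4" using udeg_source[OF v(2)] .
    then have "term_node G x = out_node U (src G a)" using Inl by (simp add: term_node_def out_node_def)
    then show ?thesis using s Inl split_refl by (intro exI[of _ "(src G a, src G a)"]) (simp add: ends_def)
  next
    case (Inr b)
    then obtain u where u: "(u, snk G b) \<in> U" "snk G b \<in> sinks G" using col x by blast
    have "term_node G x = in_node U (snk G b)" using Inr by (simp add: term_node_def in_node_def)
    then show ?thesis using sym_split[OF split_edge[OF u(1)]] u Inr by (intro exI[of _ "(u, snk G b)"]) (simp add: ends_def)
  qed
  obtain p where p: "p \<in> ends" "(term_node G f, out_node U (fst p)) \<in> split_conn U"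
      "\<And>a. f = Inl a \<Longrightarrow> p = (src G a, src G a)" "\<And>b. f = Inr b \<Longrightarrow> snd p = snk G b \<and> p \<in> U"
    using ex[OF Y(1)] by blast
  obtain r where r: "r \<in> ends" "(term_node G g, out_node U (fst r)) \<in> split_conn U"
      "\<And>a. g = Inl a \<Longrightarrow> r = (src G a, src G a)" "\<And>b. g = Inr b \<Longrightarrow> snd r = snk G b \<and> r \<in> U"
    using ex[OF Y(2)] by blast
  have link: "(p, r) \<in> linked"
    using trans_split[OF trans_split[OF sym_split[OF p(2)] Y(4)] r(2)] by (simp add: linked_def)
  have stub_p: "p \<in> stubs \<longleftrightarrow> (\<exists>a. f = Inl a)"
    using p(3,4) row Y(1) stubsD[of p] U_neq[of p] by (cases f) auto
  have stub_r: "r \<in> stubs \<longleftrightarrow> (\<exists>a. g = Inl a)"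
    using r(3,4) row Y(2) stubsD[of r] U_neq[of r] by (cases g) auto
  have ne: "p \<noteq> r"
  proof
    assume e: "p = r"
    show False
    proof (cases f)
      case (Inl a)
      then obtain b where b: "g = Inl b" using stub_p stub_r e by auto
      have "a \<in> {1..nsrc G}" "b \<in> {1..nsrc G}" using row Y(1,2) Inl b by auto
      then show False using p(3)[OF Inl] r(3)[OF b] e Y(3) Inl b inj_src by (auto dest: inj_onD)
    next
      case (Inr a)
      then obtain b where b: "g = Inr b" using stub_p stub_r e by (cases g) auto
      have "a \<in> {1..nsnk G}" "b \<in> {1..nsnk G}" using col Y(1,2) Inr b by blast+
      then show False using p(4)[OF Inr] r(4)[OF b] e Y(3) Inr b inj_snk by (auto dest: inj_onD)
    qed
  qed
  let ?K = "couple_path G I phi I' phi' f" and ?d = "\<lambda>e. ind (component p) e * colour e"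
  have K: "?K = component p"
    unfolding couple_path_def Uset component_def linked_def
    using trans_split[OF p(2)] trans_split[OF sym_split[OF p(2)]] by blast
  have KU: "component p \<subseteq> U" by (auto simp: component_def)
  let ?E1 = "flow_edges (symdiff I (rows_of {f, g})) psi" and ?E2 = "flow_edges (symdiff I' (rows_of {f, g})) psi'"
  \<comment> \<open>On the exchanged part of \<open>U\<close> the first flow gains the edges of
    \<open>F'\<close> and loses those of \<open>F\<close>, which is the coloured indicator; the
    second flow changes by its negative.\<close>
  have E1: "ind ?E1 = (\<lambda>e. ind F e + ?d e)" and E2: "ind ?E2 = (\<lambda>e. ind F' e - ?d e)"
    unfolding assms(7,9) K F_def[symmetric] F'_def[symmetric]
    using KU by (auto simp: fun_eq_iff symdiff_def colour_def of_bool_def)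
  \<comment> \<open>The coloured component is the difference of the flows \<open>psi\<close> and
    \<open>phi\<close>, both balanced.\<close>
  have bal: "balanced ?d"
  proof -
    have "balanced (\<lambda>e. ind ?E1 e - ind F e)"
      using balanced_diff[OF weyl_flow(2)[OF assms(2,6)] edge_flowD(2)[OF flowF]] .
    moreover have "ind ?E1 e - ind F e = ?d e" for e using fun_cong[OF E1, of e] by linarith
    ultimately show ?thesis by simp
  qed
  have main: "LHS = smul (q powi k) RHS" if k: "2 * sg (upper key p r) + (flux p + flux r) = 2 * k" for k
    unfolding LHS_def RHS_def
  proof (rule weyl_exchange[OF assms(2), where d = "hsum ?d"])
    show "weyl G q (flow_weight G q I phi) (hsum (ind F)) 0" "weyl G q (flow_weight G q I' phi') (hsum (ind F')) 0"
      unfolding F_def F'_def using weyl_flow(1)[OF assms(2,3)] weyl_flow(1)[OF assms(2,4)] .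
    have h: "hsum (\<lambda>e. ind F e + ?d e) = (\<lambda>x. hsum (ind F) x + hsum ?d x)"
       "hsum (\<lambda>e. ind F' e - ?d e) = (\<lambda>x. hsum (ind F') x - hsum ?d x)"
       "hsum (\<lambda>e. ind F e + ind F' e) = (\<lambda>x. hsum (ind F) x + hsum (ind F') x)"
      by (rule ext, rule hsum_add hsum_diff)+
    note h1 = trans[OF arg_cong[OF E1, of hsum] h(1)] and h2 = trans[OF arg_cong[OF E2, of hsum] h(2)]
    show "weyl G q (flow_weight G q (symdiff I (rows_of {f, g})) psi) (\<lambda>x. hsum (ind F) x + hsum ?d x) 0"
      using weyl_flow(1)[OF assms(2,6)] unfolding h1 .
    show "weyl G q (flow_weight G q (symdiff I' (rows_of {f, g})) psi') (\<lambda>x. hsum (ind F') x - hsum ?d x) 0"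
      using weyl_flow(1)[OF assms(2,8)] unfolding h2 .
    show "Lam G (hsum ?d) (\<lambda>x. hsum (ind F) x + hsum (ind F') x) = - 2 * k"
      using Lam_component[OF p(1) r(1) ne link bal] k unfolding h(3) by simp
  qed
  have opp: "sg r = - sg p" by (rule component_ends(1)[OF p(1) r(1) ne link])
  have concl: "s = 1 \<Longrightarrow> LHS = smul q RHS" "s = - 1 \<Longrightarrow> LHS = smul (inverse q) RHS" if "LHS = smul (q powi s) RHS" for s
    using that by (auto simp: power_int_minus)
  show ?thesis
  proof (intro conjI allI impI)
    fix a b assume "f = Inl a \<and> g = Inl b \<and> a < b"
    then have fg: "f = Inl a" "g = Inl b" "a < b" by auto
    \<comment> \<open>Stubs are ordered downwards, so the smaller index belongs to the upper end
      \<open>p\<close>; the two fluxes cancel and the exponent is \<open>sg p\<close>.\<close>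
    have "key r < key p" using p(3)[OF fg(1)] r(3)[OF fg(2)] key_stub_less[of a b] row Y(1,2) fg by auto
    then have "LHS = smul (q powi sg p) RHS"
      using stub_p stub_r fg opp by (intro main) (auto simp: upper_def flux_def)
    note c = concl[OF this]
    show "a \<in> I \<Longrightarrow> LHS = smul q RHS" "a \<in> I' \<Longrightarrow> LHS = smul (inverse q) RHS"
      using c row[of a] Y(1) fg p(3) by auto
  next
    fix a b assume "f = Inr a \<and> g = Inr b \<and> a < b"
    then have fg: "f = Inr a" "g = Inr b" "a < b" by auto
    have pU: "p \<in> U" "r \<in> U" "p = (fst p, snk G a)" "r = (fst r, snk G b)" using p(4)[OF fg(1)] r(4)[OF fg(2)] by (auto simp: prod_eq_iff)
    have n: "a \<in> {1..nsnk G}" "b \<in> {1..nsnk G}" using col Y(1,2) fg by blast+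
    \<comment> \<open>Edges into sinks are ordered from left to right, so the upper end is
      \<open>r\<close>, of sign \<open>- sg p\<close>; the fluxes cancel again.\<close>
    have "key p < key r" using key_sink_less[of "fst p" a "fst r" b] pU n fg by metis
    then have "LHS = smul (q powi - sg p) RHS"
      using stub_p stub_r fg opp by (intro main) (auto simp: upper_def flux_def)
    note c = concl[OF this]
    obtain u where u: "(u, snk G a) \<in> U" "snk G a \<in> sinks G" "a \<in> J \<longrightarrow> sg (u, snk G a) = - 1" "a \<in> J' \<longrightarrow> sg (u, snk G a) = 1"
      using col Y(1) fg by blast
    have "(u, snk G a) \<in> E" "p \<in> E" using u pU U_sub by auto
    \<comment> \<open>Only one edge enters a sink, so the edge provided by \<open>col\<close> is
      \<open>p\<close>.\<close>
    then have "u = fst p" using V_in_unique sink_edge_V u(2) pU(3) by (metis snd_conv)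
    then have "p = (u, snk G a)" using pU by simp
    then show "a \<in> J \<Longrightarrow> LHS = smul q RHS" "a \<in> J' \<Longrightarrow> LHS = smul (inverse q) RHS"
      using c u by auto
  next
    assume "(\<exists>a b. f = Inl a \<and> g = Inr b) \<or> (\<exists>a b. f = Inr a \<and> g = Inl b)"
    then have "p \<in> stubs \<and> r \<in> ends - stubs \<or> r \<in> stubs \<and> p \<in> ends - stubs"
      using stub_p stub_r p(1) r(1) by auto
    moreover have "e \<in> E" if "e \<in> ends - stubs" for e using that U_sub by (auto simp: ends_def)
    \<comment> \<open>The stub is the upper end, and the two fluxes add up to minus twice its sign,
      so the exponent is 0.\<close>
    ultimately have "LHS = smul (q powi 0) RHS"
      using key_edge_less_stub opp by (intro main) (fastforce simp: upper_def flux_def)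
    then show "LHS = RHS" by (simp add: smul_one)
  qed
qed

end
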